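(* Let $n\ge1$ and let $p>m\ge1$ be integers, let $\mathcal E,\mathcal E_*$ be Hilbert spaces, and let $\Phi\in\mathcal M_1(\mathbb H_m(\mathbb B^n,\mathcal E),\mathbb H_p(\mathbb B^n,\mathcal E_* ))$. Then $\Phi$ can be factorized as $\Phi=\Phi_2\Phi_1$, where, for some Hilbert space $\mathcal F$, $\Phi_1:\mathbb B^n\to\mathcal B(\mathcal E,\mathcal F)$ is a Schur-Agler function and $\Phi_2\in\mathcal M_1(\mathbb H_m(\mathbb B^n,\mathcal F),\mathbb H_p(\mathbb B^n,\mathcal E_* ))$ is a co-isometric multiplier, if and only if $\Phi\in\mathcal M_1(\mathbb H_1(\mathbb B^n,\mathcal E),\mathbb H_{p-m+1}(\mathbb B^n,\mathcal E_* ))$.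
   Context: All Hilbert spaces are complex; $\mathbb B^n$ is the open unit ball of $\mathbb C^n$. For an integer $m\ge1$ and a Hilbert space $\mathcal E$, $\mathbb H_m(\mathbb B^n,\mathcal E)$ is the $\mathcal E$-valued reproducing kernel Hilbert space of holomorphic functions on $\mathbb B^n$ with kernel $(1-\langle\boldsymbol z,\boldsymbol w\rangle)^{-m}I_{\mathcal E}$. $\mathcal M_1(\mathbb H_m(\mathbb B^n,\mathcal E_1),\mathbb H_p(\mathbb B^n,\mathcal E_2))$ is the set of holomorphic $\Phi:\mathbb B^n\to\mathcal B(\mathcal E_1,\mathcal E_2)$ such that $M_\Phi:f\mapsto\Phi f$ is a contraction from $\mathbb H_m(\mathbb B^n,\mathcal E_1)$ to $\mathbb H_p(\mathbb B^n,\mathcal E_2)$; such a multiplier is co-isometric if $M_\Phi M_\Phi^*=I$. A Schur-Agler function $\mathbb B^n\to\mathcal B(\mathcal E_1,\mathcal E_2)$ is an element of $\mathcal M_1(\mathbb H_1(\mathbb B^n,\mathcal E_1),\mathbb H_1(\mathbb B^n,\mathcal E_2))$. *)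

theory Defs
  imports "HOL-Analysis.Analysis" "HOL-Library.Function_Algebras"
begin

section \<open>Complex vector spaces\<close>

class complex_vector = ab_group_add +
  fixes scaleC :: "complex \<Rightarrow> 'a \<Rightarrow> 'a"  (infixr "*\<^sub>C" 75)
  assumes scaleC_add_right: "a *\<^sub>C (x + y) = a *\<^sub>C x + a *\<^sub>C y"
    and scaleC_add_left: "(a + b) *\<^sub>C x = a *\<^sub>C x + b *\<^sub>C x"
    and scaleC_scaleC: "a *\<^sub>C b *\<^sub>C x = (a * b) *\<^sub>C x"
    and scaleC_one: "1 *\<^sub>C x = x"

global_interpretation cvs: vector_space "scaleC :: complex \<Rightarrow> 'a \<Rightarrow> 'a::complex_vector"
  by standard (simp_all add: scaleC_add_right scaleC_add_left scaleC_scaleC scaleC_one)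

instantiation "fun" :: (type, complex_vector) complex_vector
begin

definition scaleC_fun_def: "a *\<^sub>C f = (\<lambda>x. a *\<^sub>C f x)"

instance
  by standard (simp_all add: scaleC_fun_def fun_eq_iff scaleC_add_right scaleC_add_left
      scaleC_scaleC scaleC_one)

end

section \<open>Complex Hilbert spaces and bounded operators\<close>

text \<open>A Hilbert space is an object, not a type: its vectors form a linear subspace of some
  ambient complex vector space, and only the values of the inner product on that subspace matter.
  This way the function spaces below (which depend on a natural number parameter) and a space that
  is existentially quantified are Hilbert spaces in the same sense as the given ones.\<close>

record 'a hilbert =
  vecs :: "'a set"
  ip :: "'a \<Rightarrow> 'a \<Rightarrow> complex"

definition hnorm :: "'a hilbert \<Rightarrow> 'a \<Rightarrow> real" where
  "hnorm H x = sqrt (Re (ip H x x))"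

text \<open>Inner products are linear in the first and conjugate-linear in the second argument.\<close>

definition complex_hilbert :: "'a::complex_vector hilbert \<Rightarrow> bool" where
  "complex_hilbert H \<longleftrightarrow>
     cvs.subspace (vecs H) \<and>
     (\<forall>x\<in>vecs H. \<forall>y\<in>vecs H. \<forall>z\<in>vecs H. ip H (x + y) z = ip H x z + ip H y z) \<and>
     (\<forall>a. \<forall>x\<in>vecs H. \<forall>y\<in>vecs H. ip H (a *\<^sub>C x) y = a * ip H x y) \<and>
     (\<forall>x\<in>vecs H. \<forall>y\<in>vecs H. ip H y x = cnj (ip H x y)) \<and>
     (\<forall>x\<in>vecs H. x \<noteq> 0 \<longrightarrow> Re (ip H x x) > 0) \<and>
     (\<forall>s :: nat \<Rightarrow> 'a. (\<forall>k. s k \<in> vecs H) \<longrightarrow>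
        (\<forall>e>0. \<exists>N. \<forall>i\<ge>N. \<forall>j\<ge>N. hnorm H (s i - s j) < e) \<longrightarrow>
        (\<exists>x\<in>vecs H. (\<lambda>k. hnorm H (s k - x)) \<longlonglongrightarrow> 0))"

text \<open>Operators are HOL functions of which only the restriction to the vectors of the domain
  is relevant.\<close>

definition bounded_ops ::
    "'a::complex_vector hilbert \<Rightarrow> 'b::complex_vector hilbert \<Rightarrow> ('a \<Rightarrow> 'b) set" where
  "bounded_ops H K = {T.
     (\<forall>x\<in>vecs H. T x \<in> vecs K) \<and>
     (\<forall>x\<in>vecs H. \<forall>y\<in>vecs H. T (x + y) = T x + T y) \<and>
     (\<forall>a. \<forall>x\<in>vecs H. T (a *\<^sub>C x) = a *\<^sub>C T x) \<and>
     (\<exists>c. \<forall>x\<in>vecs H. hnorm K (T x) \<le> c * hnorm H x)}"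

definition op_norm :: "'a hilbert \<Rightarrow> 'b hilbert \<Rightarrow> ('a \<Rightarrow> 'b) \<Rightarrow> real" where
  "op_norm H K T = Inf {c. 0 \<le> c \<and> (\<forall>x\<in>vecs H. hnorm K (T x) \<le> c * hnorm H x)}"

text \<open>For \<open>T\<close> in \<open>bounded_ops H K\<close> and \<open>y\<close> in \<open>vecs K\<close> the vector \<open>hadj H K T y\<close> exists and is
  unique by the Riesz representation theorem.\<close>

definition hadj :: "'a hilbert \<Rightarrow> 'b hilbert \<Rightarrow> ('a \<Rightarrow> 'b) \<Rightarrow> 'b \<Rightarrow> 'a" where
  "hadj H K T y = (THE x. x \<in> vecs H \<and> (\<forall>u\<in>vecs H. ip K (T u) y = ip H u x))"

definition coisometric :: "'a hilbert \<Rightarrow> 'b hilbert \<Rightarrow> ('a \<Rightarrow> 'b) \<Rightarrow> bool" where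
  "coisometric H K T \<longleftrightarrow> (\<forall>y\<in>vecs K. T (hadj H K T y) = y)"

section \<open>Holomorphic functions on the unit ball\<close>

abbreviation unit_ball :: "(complex ^ 'n) set" where
  "unit_ball \<equiv> ball 0 1"

text \<open>Complex Frechet differentiability at every point of the ball, for functions with values in a
  normed space with vectors \<open>V\<close> and norm \<open>N\<close>; \<open>D i\<close> is the partial derivative in direction \<open>i\<close>.\<close>

definition holomorphic_ball ::
    "'a::complex_vector set \<Rightarrow> ('a \<Rightarrow> real) \<Rightarrow> (complex ^ 'n \<Rightarrow> 'a) \<Rightarrow> bool" where
  "holomorphic_ball V N f \<longleftrightarrow>
     (\<forall>z\<in>unit_ball. f z \<in> V) \<and>
     (\<forall>z\<in>unit_ball. \<exists>D :: 'n \<Rightarrow> 'a. (\<forall>i. D i \<in> V) \<and>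
        ((\<lambda>h. N (f (z + h) - f z - (\<Sum>i\<in>UNIV. (h $ i) *\<^sub>C D i)) / norm h) \<longlongrightarrow> 0) (at 0))"

abbreviation holomorphic_vec ::
    "'a::complex_vector hilbert \<Rightarrow> (complex ^ 'n \<Rightarrow> 'a) \<Rightarrow> bool" where
  "holomorphic_vec E \<equiv> holomorphic_ball (vecs E) (hnorm E)"

abbreviation holomorphic_op ::
    "'a::complex_vector hilbert \<Rightarrow> 'b::complex_vector hilbert \<Rightarrow>
     (complex ^ 'n \<Rightarrow> 'a \<Rightarrow> 'b) \<Rightarrow> bool" where
  "holomorphic_op E F \<equiv> holomorphic_ball (bounded_ops E F) (op_norm E F)"

section \<open>The spaces with kernel \<open>(1 - \<langle>z,w\<rangle>)\<^sup>-\<^sup>m I\<close>\<close>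

definition cdot :: "complex ^ 'n \<Rightarrow> complex ^ 'n \<Rightarrow> complex" where
  "cdot z w = (\<Sum>i\<in>UNIV. z $ i * cnj (w $ i))"

text \<open>Functions on the ball are represented by total functions that vanish off the ball.\<close>

definition kernel_fun :: "nat \<Rightarrow> complex ^ 'n \<Rightarrow> 'a::complex_vector \<Rightarrow> complex ^ 'n \<Rightarrow> 'a" where
  "kernel_fun m w x = (\<lambda>z. if z \<in> unit_ball then (1 / (1 - cdot z w) ^ m) *\<^sub>C x else 0)"

text \<open>\<open>H\<close> is a Hilbert space of holomorphic \<open>E\<close>-valued functions on the ball, with pointwise
  operations, in which the kernel functions lie and reproduce point evaluations. The last conjunct
  fixes the irrelevant values of the inner product, so that the reproducing property determines
  \<open>H\<close> as a record.\<close>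

definition is_rkhs ::
    "nat \<Rightarrow> 'a::complex_vector hilbert \<Rightarrow> (complex ^ 'n \<Rightarrow> 'a) hilbert \<Rightarrow> bool" where
  "is_rkhs m E H \<longleftrightarrow>
     complex_hilbert H \<and>
     (\<forall>f\<in>vecs H. holomorphic_vec E f \<and> (\<forall>z. z \<notin> unit_ball \<longrightarrow> f z = 0)) \<and>
     (\<forall>w\<in>unit_ball. \<forall>x\<in>vecs E. kernel_fun m w x \<in> vecs H \<and>
        (\<forall>f\<in>vecs H. ip H f (kernel_fun m w x) = ip E (f w) x)) \<and>
     (\<forall>f g. f \<notin> vecs H \<or> g \<notin> vecs H \<longrightarrow> ip H f g = 0)"

definition rkhs :: "nat \<Rightarrow> 'a::complex_vector hilbert \<Rightarrow> (complex ^ 'n \<Rightarrow> 'a) hilbert" where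
  "rkhs m E = (THE H. is_rkhs m E H)"

section \<open>Multipliers\<close>

definition mult_op ::
    "(complex ^ 'n \<Rightarrow> 'a \<Rightarrow> 'b) \<Rightarrow> (complex ^ 'n \<Rightarrow> 'a) \<Rightarrow> complex ^ 'n \<Rightarrow> 'b::complex_vector" where
  "mult_op \<Phi> f = (\<lambda>z. if z \<in> unit_ball then \<Phi> z (f z) else 0)"

definition contractive_multipliers ::
    "nat \<Rightarrow> 'a::complex_vector hilbert \<Rightarrow> nat \<Rightarrow> 'b::complex_vector hilbert \<Rightarrow>
     (complex ^ 'n \<Rightarrow> 'a \<Rightarrow> 'b) set" where
  "contractive_multipliers m E p F = {\<Phi>. holomorphic_op E F \<Phi> \<and>
     (\<forall>f\<in>vecs (rkhs m E). mult_op \<Phi> f \<in> vecs (rkhs p F) \<and>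
        hnorm (rkhs p F) (mult_op \<Phi> f) \<le> hnorm (rkhs m E) f)}"

definition schur_agler ::
    "'a::complex_vector hilbert \<Rightarrow> 'b::complex_vector hilbert \<Rightarrow>
     (complex ^ 'n \<Rightarrow> 'a \<Rightarrow> 'b) set" where
  "schur_agler E F = contractive_multipliers 1 E 1 F"

definition coisometric_multipliers ::
    "nat \<Rightarrow> 'a::complex_vector hilbert \<Rightarrow> nat \<Rightarrow> 'b::complex_vector hilbert \<Rightarrow>
     (complex ^ 'n \<Rightarrow> 'a \<Rightarrow> 'b) set" where
  "coisometric_multipliers m E p F = {\<Phi> \<in> contractive_multipliers m E p F.
     coisometric (rkhs m E) (rkhs p F) (mult_op \<Phi>)}"

text \<open>An existential over Hilbert spaces needs an ambient type for \<open>F\<close>. The ambient type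
  \<open>complex ^ 'n \<Rightarrow> 'b\<close> is always large enough for a factorization to exist, since \<open>F\<close> can be
  taken to be \<open>rkhs (p - m) E'\<close>; necessity has to be claimed for every ambient type.\<close>

definition factors_through ::
    "nat \<Rightarrow> 'a::complex_vector hilbert \<Rightarrow> nat \<Rightarrow> 'b::complex_vector hilbert \<Rightarrow>
     'f::complex_vector hilbert \<Rightarrow> (complex ^ 'n \<Rightarrow> 'a \<Rightarrow> 'b) \<Rightarrow> bool" where
  "factors_through m E p E' F \<Phi> \<longleftrightarrow>
     complex_hilbert F \<and>
     (\<exists>\<Phi>1 \<Phi>2. \<Phi>1 \<in> schur_agler E F \<and> \<Phi>2 \<in> coisometric_multipliers m F p E' \<and>
        (\<forall>z\<in>unit_ball. \<forall>x\<in>vecs E. \<Phi> z x = \<Phi>2 z (\<Phi>1 z x)))"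

end

theory Submission imports Defs begin

text \<open>Write \<open>k\<^sub>j = (1 - \<langle>z,w\<rangle>)\<^sup>-\<^sup>j\<close> and \<open>q = p - m\<close>. A multiplier \<open>\<Phi>\<^sub>2\<close> from exponent \<open>m\<close> to
  exponent \<open>p\<close> is co-isometric iff \<open>\<Phi>\<^sub>2(z) \<Phi>\<^sub>2(w)\<^sup>* = k\<^sub>q I\<close>. Multiplied by \<open>k\<^sub>1\<close> this identity says
  that \<open>\<Phi>\<^sub>2\<close> is also a contractive multiplier from exponent \<open>1\<close> to exponent \<open>q + 1\<close>, so composing
  with a Schur-Agler function gives one direction. Conversely, take for \<open>\<F>\<close> the space with
  exponent \<open>q\<close> and for \<open>\<Phi>\<^sub>2\<close> its point evaluations. The kernel
  \<open>K = k\<^sub>q\<^sub>+\<^sub>1 I - k\<^sub>1 \<Phi>(z) \<Phi>(w)\<^sup>*\<close> is positive and satisfies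
  \<open>\<Phi>\<^sub>2(z) \<Phi>\<^sub>2(w)\<^sup>* + \<langle>z,w\<rangle> K = \<Phi>(z) \<Phi>(w)\<^sup>* + K\<close>. The contraction that extends this lurking
  isometry is a colligation whose transfer function \<open>A + C (1 - z D)\<^sup>-\<^sup>1 z B\<close> is the factor
  \<open>\<Phi>\<^sub>1\<close>.\<close>

section \<open>Inner product geometry\<close>

text \<open>Multiplying the positive kernel \<open>K\<close> by
  \<open>1 - \<langle>z,w\<rangle>\<close> lowers both exponents by one, which is why
  \<open>k\<^sub>q I\<close>, the kernel that the co-isometric factor produces, meets
  \<open>\<Phi>(z) \<Phi>(w)\<^sup>*\<close> without a weight. Moving the negative terms across
  turns this into an equality of two Gram kernels, and such an equality defines an operator only on
  a span. It is extended by a contraction whose adjoint vanishes on the orthogonal complement: this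
  keeps the state space, whereas a unitary extension could force it to grow, and a contraction
  already suffices for a Schur-Agler transfer function. In several variables z acts as a row, so the
  target of the colligation carries n copies of the state space.

  Kernel functions are natural arguments of adjoints. Operators are therefore built from prescribed
  values of the adjoint, in \<open>contraction_from_gram\<close>; that lemma yields the
  colligations, the uniqueness of the kernel spaces and the multiplier criterion.

  A further obstacle is that \<open>rkhs\<close> is a definite description, so that existence,
  including holomorphy of every member, has to be proved. The colligation argument is reused for
  this, raising the exponent by one at a time.\<close>

definition semi_hilbert :: "'a::complex_vector hilbert \<Rightarrow> bool" where
  "semi_hilbert H \<longleftrightarrow>
     cvs.subspace (vecs H) \<and>
     (\<forall>x\<in>vecs H. \<forall>y\<in>vecs H. \<forall>z\<in>vecs H. ip H (x + y) z = ip H x z + ip H y z) \<and>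
     (\<forall>a. \<forall>x\<in>vecs H. \<forall>y\<in>vecs H. ip H (a *\<^sub>C x) y = a * ip H x y) \<and>
     (\<forall>x\<in>vecs H. \<forall>y\<in>vecs H. ip H y x = cnj (ip H x y)) \<and>
     (\<forall>x\<in>vecs H. 0 \<le> Re (ip H x x))"

text \<open>Definiteness and completeness are left out so that the geometry below, in particular
  Cauchy-Schwarz, already applies to the degenerate form on finitely supported functions in
  \<open>kolmogorov\<close>, before it is completed.\<close>

locale semi_hilb =
  fixes H :: "'a::complex_vector hilbert"
  assumes semi_hilbert: "semi_hilbert H"
begin

lemma subspace: "cvs.subspace (vecs H)"
  using semi_hilbert unfolding semi_hilbert_def by blast

lemma zero_in [simp, intro]: "0 \<in> vecs H"
  using subspace by (rule cvs.subspace_0)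

lemma add_in [simp, intro]: "x \<in> vecs H \<Longrightarrow> y \<in> vecs H \<Longrightarrow> x + y \<in> vecs H"
  using subspace by (rule cvs.subspace_add)

lemma diff_in [simp, intro]: "x \<in> vecs H \<Longrightarrow> y \<in> vecs H \<Longrightarrow> x - y \<in> vecs H"
  using subspace by (rule cvs.subspace_diff)

lemma minus_in [simp, intro]: "x \<in> vecs H \<Longrightarrow> - x \<in> vecs H"
  using subspace by (rule cvs.subspace_neg)

lemma scale_in [simp, intro]: "x \<in> vecs H \<Longrightarrow> a *\<^sub>C x \<in> vecs H"
  using subspace by (rule cvs.subspace_scale)

lemma sum_in [intro]: "(\<And>i. i \<in> I \<Longrightarrow> f i \<in> vecs H) \<Longrightarrow> sum f I \<in> vecs H"
  using subspace by (rule cvs.subspace_sum)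

lemma ip_add_left [simp]:
  "x \<in> vecs H \<Longrightarrow> y \<in> vecs H \<Longrightarrow> z \<in> vecs H \<Longrightarrow> ip H (x + y) z = ip H x z + ip H y z"
  using semi_hilbert unfolding semi_hilbert_def by blast

lemma ip_scale_left [simp]:
  "x \<in> vecs H \<Longrightarrow> y \<in> vecs H \<Longrightarrow> ip H (a *\<^sub>C x) y = a * ip H x y"
  using semi_hilbert unfolding semi_hilbert_def by blast

lemma ip_cnj: "x \<in> vecs H \<Longrightarrow> y \<in> vecs H \<Longrightarrow> ip H y x = cnj (ip H x y)"
  using semi_hilbert unfolding semi_hilbert_def by blast

lemma ip_nonneg: "x \<in> vecs H \<Longrightarrow> 0 \<le> Re (ip H x x)"
  using semi_hilbert unfolding semi_hilbert_def by blast

lemma ip_add_right [simp]: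
  assumes "x \<in> vecs H" "y \<in> vecs H" "z \<in> vecs H"
  shows "ip H z (x + y) = ip H z x + ip H z y"
  using assms ip_cnj[of "x + y" z] ip_cnj[of x z] ip_cnj[of y z] by simp

lemma ip_scale_right [simp]:
  assumes "x \<in> vecs H" "y \<in> vecs H"
  shows "ip H x (a *\<^sub>C y) = cnj a * ip H x y"
  using assms ip_cnj[of "a *\<^sub>C y" x] ip_cnj[of y x] by simp

lemma ip_zero_left [simp]: "y \<in> vecs H \<Longrightarrow> ip H 0 y = 0"
  using ip_scale_left[of 0 y 0] by simp

lemma ip_zero_right [simp]: "y \<in> vecs H \<Longrightarrow> ip H y 0 = 0"
  using ip_cnj[of 0 y] by simp

lemma ip_minus_left [simp]: "x \<in> vecs H \<Longrightarrow> y \<in> vecs H \<Longrightarrow> ip H (- x) y = - ip H x y"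
  using ip_add_left[of x "- x" y] by (simp add: eq_neg_iff_add_eq_0 add.commute)

lemma ip_minus_right [simp]: "x \<in> vecs H \<Longrightarrow> y \<in> vecs H \<Longrightarrow> ip H x (- y) = - ip H x y"
  using ip_add_right[of y "- y" x] by (simp add: eq_neg_iff_add_eq_0 add.commute)

lemma ip_diff_left [simp]:
  "x \<in> vecs H \<Longrightarrow> y \<in> vecs H \<Longrightarrow> z \<in> vecs H \<Longrightarrow> ip H (x - y) z = ip H x z - ip H y z"
  using ip_add_left[of x "- y" z] by simp

lemma ip_diff_right [simp]:
  "x \<in> vecs H \<Longrightarrow> y \<in> vecs H \<Longrightarrow> z \<in> vecs H \<Longrightarrow> ip H z (x - y) = ip H z x - ip H z y"
  using ip_add_right[of x "- y" z] by simp

lemma ip_sum_left: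
  "y \<in> vecs H \<Longrightarrow> (\<And>i. i \<in> I \<Longrightarrow> f i \<in> vecs H) \<Longrightarrow> ip H (sum f I) y = (\<Sum>i\<in>I. ip H (f i) y)"
  by (induction I rule: infinite_finite_induct) (simp_all add: sum_in)

lemma ip_sum_right:
  "y \<in> vecs H \<Longrightarrow> (\<And>i. i \<in> I \<Longrightarrow> f i \<in> vecs H) \<Longrightarrow> ip H y (sum f I) = (\<Sum>i\<in>I. ip H y (f i))"
  by (induction I rule: infinite_finite_induct) (simp_all add: sum_in)

lemma hnorm_nonneg [simp]: "x \<in> vecs H \<Longrightarrow> 0 \<le> hnorm H x"
  by (simp add: hnorm_def ip_nonneg)

lemma hnorm_sq: "x \<in> vecs H \<Longrightarrow> (hnorm H x)\<^sup>2 = Re (ip H x x)"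
  by (simp add: hnorm_def ip_nonneg)

lemma ip_self: "x \<in> vecs H \<Longrightarrow> ip H x x = complex_of_real ((hnorm H x)\<^sup>2)"
  using ip_cnj[of x x] by (auto simp: hnorm_sq complex_eq_iff)

lemma hnorm_zero [simp]: "hnorm H 0 = 0"
  by (simp add: hnorm_def)

lemma hnorm_add_sq:
  assumes "x \<in> vecs H" "y \<in> vecs H"
  shows "(hnorm H (x + y))\<^sup>2 = (hnorm H x)\<^sup>2 + 2 * Re (ip H x y) + (hnorm H y)\<^sup>2"
  using assms ip_cnj[of x y] by (simp add: hnorm_sq)

lemma hnorm_diff_sq:
  assumes "x \<in> vecs H" "y \<in> vecs H"
  shows "(hnorm H (x - y))\<^sup>2 = (hnorm H x)\<^sup>2 - 2 * Re (ip H x y) + (hnorm H y)\<^sup>2"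
  using assms ip_cnj[of x y] by (simp add: hnorm_sq)

lemma hnorm_scale [simp]: "x \<in> vecs H \<Longrightarrow> hnorm H (a *\<^sub>C x) = cmod a * hnorm H x"
proof -
  assume x: "x \<in> vecs H"
  have "ip H (a *\<^sub>C x) (a *\<^sub>C x) = complex_of_real ((cmod a)\<^sup>2) * ip H x x"
    using x unfolding complex_norm_square by (simp add: mult.assoc)
  then have "Re (ip H (a *\<^sub>C x) (a *\<^sub>C x)) = (cmod a)\<^sup>2 * Re (ip H x x)"
    by simp
  then show ?thesis
    by (simp add: hnorm_def real_sqrt_mult)
qed

lemma hnorm_minus [simp]: "x \<in> vecs H \<Longrightarrow> hnorm H (- x) = hnorm H x"
  by (simp add: hnorm_def)

lemma hnorm_diff_commute: "x \<in> vecs H \<Longrightarrow> y \<in> vecs H \<Longrightarrow> hnorm H (x - y) = hnorm H (y - x)"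
  using hnorm_minus[of "x - y"] by simp

text \<open>Nonnegativity of |x - t y|^2 for t = s <x, y> with s real. The form may be degenerate,
  so |y| = 0 does not give y = 0 and gets its own choice of s.\<close>

lemma Cauchy_Schwarz:
  assumes x: "x \<in> vecs H" and y: "y \<in> vecs H"
  shows "cmod (ip H x y) \<le> hnorm H x * hnorm H y"
proof -
  define a where "a = (hnorm H x)\<^sup>2"
  define c where "c = (hnorm H y)\<^sup>2"
  define b where "b = (cmod (ip H x y))\<^sup>2"
  have quad: "0 \<le> a - 2 * s * b + s\<^sup>2 * b * c" for s :: real
  proof -
    define t where "t = complex_of_real s * ip H x y"
    have "Re (ip H x (t *\<^sub>C y)) = s * b"
      using x y by (simp add: t_def b_def mult.assoc complex_mult_cnj cmod_power2 mult.commute[of "cnj _"])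
    moreover have "(hnorm H (t *\<^sub>C y))\<^sup>2 = s\<^sup>2 * b * c"
      using y by (simp add: t_def b_def c_def power_mult_distrib norm_mult)
    ultimately have "(hnorm H (x - t *\<^sub>C y))\<^sup>2 = a - 2 * s * b + s\<^sup>2 * b * c"
      using x y hnorm_diff_sq[of x "t *\<^sub>C y"] by (simp add: a_def)
    then show ?thesis by (metis zero_le_power2)
  qed
  have "b \<le> a * c"
  proof (cases "c = 0")
    case True
    \<comment> \<open>For nonzero \<open>b\<close> this s would turn the quadratic into a - (a + 1)
      = -1.\<close>
    then have "b = 0"
      using quad[of "(a + 1) / (2 * b)"] by (cases "b = 0") (auto simp: field_simps a_def)
    then show ?thesis by (simp add: a_def c_def)
  next
    case False
    then have "c > 0" by (simp add: c_def)
    then show ?thesis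
      using quad[of "1 / c"] by (simp add: field_simps power2_eq_square)
  qed
  then have "(cmod (ip H x y))\<^sup>2 \<le> (hnorm H x * hnorm H y)\<^sup>2"
    by (simp add: a_def b_def c_def power_mult_distrib)
  then show ?thesis
    by (rule power2_le_imp_le) (use x y in simp)
qed

lemma hnorm_triangle:
  assumes x: "x \<in> vecs H" and y: "y \<in> vecs H"
  shows "hnorm H (x + y) \<le> hnorm H x + hnorm H y"
proof (rule power2_le_imp_le)
  have "Re (ip H x y) \<le> hnorm H x * hnorm H y"
    using Cauchy_Schwarz[OF x y] complex_Re_le_cmod[of "ip H x y"] by linarith
  then show "(hnorm H (x + y))\<^sup>2 \<le> (hnorm H x + hnorm H y)\<^sup>2"
    using x y by (simp add: hnorm_add_sq power2_sum)
qed (use x y in simp)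

lemma hnorm_triangle_mid:
  assumes "x \<in> vecs H" "y \<in> vecs H" "z \<in> vecs H"
  shows "hnorm H (x - z) \<le> hnorm H (x - y) + hnorm H (y - z)"
  using hnorm_triangle[of "x - y" "y - z"] assms by simp

lemma hnorm_diff_abs:
  assumes "x \<in> vecs H" "y \<in> vecs H"
  shows "\<bar>hnorm H x - hnorm H y\<bar> \<le> hnorm H (x - y)"
  using hnorm_triangle[of "x - y" y] hnorm_triangle[of "y - x" x] hnorm_diff_commute[of x y] assms
  by simp

text \<open>The imaginary part is the real part for - i x, so the norms determine the whole inner
  product.\<close>

lemma polarization:
  assumes "x \<in> vecs H" "y \<in> vecs H"
  shows "Re (ip H x y) = ((hnorm H (x + y))\<^sup>2 - (hnorm H (x - y))\<^sup>2) / 4"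
    and "Im (ip H x y) = Re (ip H ((- \<i>) *\<^sub>C x) y)"
  using assms by (simp_all add: hnorm_add_sq hnorm_diff_sq)

lemma hnorm_sum_le:
  "(\<And>i. i \<in> I \<Longrightarrow> f i \<in> vecs H) \<Longrightarrow> hnorm H (sum f I) \<le> (\<Sum>i\<in>I. hnorm H (f i))"
proof (induction I rule: infinite_finite_induct)
  case (insert i I)
  then show ?case
    using hnorm_triangle[of "f i" "sum f I"] by (simp add: sum_in)
qed simp_all

lemma ip_tendsto_left:
  assumes s: "\<And>k::nat. s k \<in> vecs H" and x: "x \<in> vecs H" and y: "y \<in> vecs H"
    and lim: "(\<lambda>k. hnorm H (s k - x)) \<longlonglongrightarrow> 0"
  shows "(\<lambda>k. ip H (s k) y) \<longlonglongrightarrow> ip H x y"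
proof -
  have "(\<lambda>k. ip H (s k) y - ip H x y) \<longlonglongrightarrow> 0"
  proof (rule Lim_null_comparison)
    show "\<forall>\<^sub>F k in sequentially. norm (ip H (s k) y - ip H x y) \<le> hnorm H (s k - x) * hnorm H y"
      using Cauchy_Schwarz[of "s _ - x" y] s x y by simp
    show "(\<lambda>k. hnorm H (s k - x) * hnorm H y) \<longlonglongrightarrow> 0"
      using tendsto_mult_right[OF lim, of "hnorm H y"] by simp
  qed
  then show ?thesis by (rule LIM_zero_cancel)
qed

lemma hnorm_tendsto:
  assumes s: "\<And>k::nat. s k \<in> vecs H" and x: "x \<in> vecs H"
    and lim: "(\<lambda>k. hnorm H (s k - x)) \<longlonglongrightarrow> 0"
  shows "(\<lambda>k. hnorm H (s k)) \<longlonglongrightarrow> hnorm H x"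
proof -
  have "(\<lambda>k. hnorm H (s k) - hnorm H x) \<longlonglongrightarrow> 0"
    by (rule Lim_null_comparison[OF _ lim]) (use hnorm_diff_abs s x in simp)
  then show ?thesis by (rule LIM_zero_cancel)
qed

end

section \<open>Hilbert spaces and the Riesz representation\<close>

locale hilb =
  fixes H :: "'a::complex_vector hilbert"
  assumes complex_hilbert: "complex_hilbert H"
begin

sublocale semi_hilb H
proof
  have "Re (ip H x x) \<ge> 0" if "x \<in> vecs H" for x
  proof (cases "x = 0")
    case True
    have "ip H (0 *\<^sub>C x) x = 0 * ip H x x"
      using complex_hilbert that unfolding complex_hilbert_def by blast
    then show ?thesis using True by simp
  next
    case False
    then show ?thesis using complex_hilbert that unfolding complex_hilbert_def by (meson less_imp_le)
  qed
  then show "semi_hilbert H"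
    using complex_hilbert unfolding complex_hilbert_def semi_hilbert_def
    by (elim conjE, intro conjI) (assumption+, blast)
qed

lemma hnorm_eq_0_iff [simp]: "x \<in> vecs H \<Longrightarrow> hnorm H x = 0 \<longleftrightarrow> x = 0"
proof
  assume "x \<in> vecs H" "hnorm H x = 0"
  then have "\<not> 0 < Re (ip H x x)"
    using hnorm_sq[of x] by simp
  with \<open>x \<in> vecs H\<close> show "x = 0"
    using complex_hilbert unfolding complex_hilbert_def by blast
qed simp

lemma ip_self_eq_0: "x \<in> vecs H \<Longrightarrow> ip H x x = 0 \<Longrightarrow> x = 0"
  using hnorm_eq_0_iff[of x] by (simp add: ip_self)

lemma vec_eqI:
  assumes "x \<in> vecs H" "y \<in> vecs H" "\<And>u. u \<in> vecs H \<Longrightarrow> ip H x u = ip H y u"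
  shows "x = y"
  using ip_self_eq_0[of "x - y"] assms by simp

lemma complete:
  assumes "\<And>k::nat. s k \<in> vecs H"
    and "\<And>e. e > 0 \<Longrightarrow> \<exists>N. \<forall>i\<ge>N. \<forall>j\<ge>N. hnorm H (s i - s j) < e"
  obtains x where "x \<in> vecs H" "(\<lambda>k. hnorm H (s k - x)) \<longlonglongrightarrow> 0"
proof -
  have "\<forall>s :: nat \<Rightarrow> 'a. (\<forall>k. s k \<in> vecs H) \<longrightarrow>
      (\<forall>e>0. \<exists>N. \<forall>i\<ge>N. \<forall>j\<ge>N. hnorm H (s i - s j) < e) \<longrightarrow>
      (\<exists>x\<in>vecs H. (\<lambda>k. hnorm H (s k - x)) \<longlonglongrightarrow> 0)"
    using complex_hilbert unfolding complex_hilbert_def by (elim conjE)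
  from this[rule_format, of s] assms show thesis
    using that by blast
qed

text \<open>The vector is the minimizer of \<open>\<parallel>a\<parallel>\<^sup>2 - 2 Re b\<close> over the pairs \<open>(a, b)\<close> of the relation.\<close>

lemma riesz_relation:
  assumes S: "\<And>a b. (a, b) \<in> S \<Longrightarrow> a \<in> vecs H"
    and zero: "(0, 0) \<in> S"
    and add: "\<And>a b a' b'. (a, b) \<in> S \<Longrightarrow> (a', b') \<in> S \<Longrightarrow> (a + a', b + b') \<in> S"
    and scale: "\<And>a b t. (a, b) \<in> S \<Longrightarrow> (t *\<^sub>C a, t * b) \<in> S"
    and bound: "\<And>a b. (a, b) \<in> S \<Longrightarrow> cmod b \<le> C * hnorm H a"
  obtains u where "u \<in> vecs H" "\<And>a b. (a, b) \<in> S \<Longrightarrow> ip H a u = b" "hnorm H u \<le> C \<or> u = 0"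
    "\<And>v. v \<in> vecs H \<Longrightarrow> (\<And>a b. (a, b) \<in> S \<Longrightarrow> ip H a v = 0) \<Longrightarrow> ip H u v = 0"
proof -
  define J where "J = (\<lambda>(a, b). (hnorm H a)\<^sup>2 - 2 * Re b)"
  have J_ge: "- (C\<^sup>2) \<le> J s" if "s \<in> S" for s
  proof -
    obtain a b where s: "s = (a, b)" by (cases s)
    have "Re b \<le> C * hnorm H a"
      using bound[of a b] that s complex_Re_le_cmod[of b] by simp
    moreover have "0 \<le> (hnorm H a - C)\<^sup>2" by simp
    ultimately show ?thesis by (simp add: s J_def power2_diff mult.commute)
  qed
  define d where "d = Inf (J ` S)"
  have bdd: "bdd_below (J ` S)"
    using J_ge by (auto intro!: bdd_belowI2)
  have d_le: "d \<le> J s" if "s \<in> S" for s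
    unfolding d_def using bdd that by (rule cINF_lower)
  have "\<exists>s\<in>S. J s < d + 1 / Suc k" for k
    using cInf_lessD[of "J ` S" "d + 1 / Suc k"] zero by (auto simp: d_def)
  then obtain q where q: "\<And>k. q k \<in> S" "\<And>k. J (q k) < d + 1 / Suc k"
    by metis
  define s where "s = fst \<circ> q"
  define r where "r = snd \<circ> q"
  have sr: "(s k, r k) \<in> S" for k
    using q(1)[of k] by (simp add: s_def r_def)
  have Jk: "(hnorm H (s k))\<^sup>2 - 2 * Re (r k) < d + 1 / Suc k" for k
    using q(2)[of k] by (simp add: s_def r_def J_def split_beta)
  have sH: "s k \<in> vecs H" for k using S sr by blast
  \<comment> \<open>Parallelogram law: the midpoint of two members of the relation is again a
    member, so its value is at least \<open>d\<close>, and two near-minimizers must be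
    close.\<close>
  have near: "(hnorm H (s i - s j))\<^sup>2 \<le> 2 / Suc i + 2 / Suc j" for i j
  proof -
    have "((1/2) *\<^sub>C (s i + s j), (1/2) * (r i + r j)) \<in> S"
      by (intro scale add sr)
    then have "d \<le> (hnorm H ((1/2) *\<^sub>C (s i + s j)))\<^sup>2 - 2 * Re ((1/2) * (r i + r j))"
      using d_le by (force simp: J_def)
    moreover have "(hnorm H ((1/2) *\<^sub>C (s i + s j)))\<^sup>2 = 1/4 * (hnorm H (s i + s j))\<^sup>2"
      using sH by (subst hnorm_scale) (simp_all add: norm_divide power_divide)
    ultimately have "4 * d \<le> (hnorm H (s i + s j))\<^sup>2 - 4 * Re (r i + r j)"
      by (simp add: field_simps)
    then show ?thesis
      using Jk[of i] Jk[of j] sH by (simp add: hnorm_add_sq hnorm_diff_sq)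
  qed
  have "\<exists>N. \<forall>i\<ge>N. \<forall>j\<ge>N. hnorm H (s i - s j) < e" if "e > 0" for e
  proof -
    obtain N where N: "4 / e\<^sup>2 < real N" using reals_Archimedean2 by blast
    have "hnorm H (s i - s j) < e" if "i \<ge> N" "j \<ge> N" for i j
    proof (rule power2_less_imp_less)
      have "2 / Suc i + 2 / Suc j \<le> 4 / real (Suc N)"
        using that frac_le[of 2 2 "Suc N" "Suc i"] frac_le[of 2 2 "Suc N" "Suc j"] by simp
      also have "\<dots> < e\<^sup>2" using N \<open>e > 0\<close> by (simp add: field_simps) (smt (verit) zero_le_power2)
      finally show "(hnorm H (s i - s j))\<^sup>2 < e\<^sup>2"
        using near[of i j] by linarith
    qed (use \<open>e > 0\<close> in simp)
    then show ?thesis by blast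
  qed
  then obtain u where u: "u \<in> vecs H" and lim: "(\<lambda>k. hnorm H (s k - u)) \<longlonglongrightarrow> 0"
    using complete[of s] sH by blast
  have eq: "ip H a u = b" if ab: "(a, b) \<in> S" for a b
  proof -
    have aH: "a \<in> vecs H" using S ab by blast
    \<comment> \<open>Minimality at u under the perturbation t (a, b), obtained from the
      near-minimizers by passing to the limit. The second components \<open>r k\<close> cancel
      before the limit is taken, so only the \<open>s k\<close> have to converge.\<close>
    have pos: "0 \<le> 2 * Re (t * (ip H a u - b)) + (cmod t)\<^sup>2 * (hnorm H a)\<^sup>2" for t
    proof -
      have "- (1 / Suc k) \<le> 2 * Re (cnj t * ip H (s k) a) + (cmod t)\<^sup>2 * (hnorm H a)\<^sup>2 - 2 * Re (t * b)" for k
      proof -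
        have "(s k + t *\<^sub>C a, r k + t * b) \<in> S" by (intro add scale sr ab)
        then have "d \<le> (hnorm H (s k + t *\<^sub>C a))\<^sup>2 - 2 * Re (r k + t * b)"
          using d_le by (force simp: J_def)
        then show ?thesis
          using Jk[of k] sH aH by (simp add: hnorm_add_sq power_mult_distrib)
      qed
      moreover have "(\<lambda>k. 2 * Re (cnj t * ip H (s k) a) + (cmod t)\<^sup>2 * (hnorm H a)\<^sup>2 - 2 * Re (t * b))
          \<longlonglongrightarrow> 2 * Re (cnj t * ip H u a) + (cmod t)\<^sup>2 * (hnorm H a)\<^sup>2 - 2 * Re (t * b)"
        by (intro tendsto_intros ip_tendsto_left sH u aH lim)
      moreover have "(\<lambda>k. - (1 / real (Suc k))) \<longlonglongrightarrow> 0"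
        using LIMSEQ_inverse_real_of_nat[THEN tendsto_minus] by (simp add: inverse_eq_divide)
      ultimately have "0 \<le> 2 * Re (cnj t * ip H u a) + (cmod t)\<^sup>2 * (hnorm H a)\<^sup>2 - 2 * Re (t * b)"
        by (meson LIMSEQ_le)
      moreover have "Re (cnj t * ip H u a) = Re (t * ip H a u)"
        using ip_cnj[of a u] aH u by simp
      ultimately show ?thesis by (simp add: algebra_simps)
    qed
    define \<delta> where "\<delta> = ip H a u - b"
    define A where "A = (hnorm H a)\<^sup>2"
    \<comment> \<open>Taking t = - c cnj \<delta> turns \<open>pos\<close> into - c |\<delta>|^2 (2
      - c A) \<ge> 0. The summand 1 in the denominator gives c A \<le> 1 and covers A = 0.\<close>
    define c where "c = 1 / (A + 1)"
    have A: "A \<ge> 0" by (simp add: A_def)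
    have c: "c > 0" "c * A \<le> 1" using A by (simp_all add: c_def)
    have "0 \<le> 2 * Re (- complex_of_real c * cnj \<delta> * \<delta>) + (cmod (- complex_of_real c * cnj \<delta>))\<^sup>2 * A"
      using pos[of "- complex_of_real c * cnj \<delta>"] by (simp only: \<delta>_def A_def)
    also have "\<dots> = - (c * (cmod \<delta>)\<^sup>2 * (2 - c * A))"
    proof -
      have eqs: "- complex_of_real c * cnj \<delta> * \<delta> = complex_of_real (- (c * (cmod \<delta>)\<^sup>2))"
        "(cmod (- complex_of_real c * cnj \<delta>))\<^sup>2 = c\<^sup>2 * (cmod \<delta>)\<^sup>2"
        unfolding of_real_minus of_real_mult complex_norm_square
        by (simp_all add: norm_mult power_mult_distrib)
      show ?thesis
        unfolding eqs Re_complex_of_real by (simp add: algebra_simps power2_eq_square)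
    qed
    finally have "c * (cmod \<delta>)\<^sup>2 * (2 - c * A) \<le> 0" by simp
    moreover have "c * (2 - c * A) > 0" using c by simp
    ultimately have "(cmod \<delta>)\<^sup>2 \<le> 0"
      by (smt (verit) mult.commute mult.left_commute mult_pos_pos)
    then show ?thesis by (simp add: \<delta>_def)
  qed
  have "hnorm H u \<le> C \<or> u = 0"
  proof -
    have "cmod (ip H (s k) u) \<le> C * hnorm H (s k)" for k
      using eq[OF sr] bound[OF sr] by simp
    moreover have "(\<lambda>k. cmod (ip H (s k) u)) \<longlonglongrightarrow> cmod (ip H u u)"
      by (intro tendsto_intros ip_tendsto_left sH u lim)
    moreover have "(\<lambda>k. C * hnorm H (s k)) \<longlonglongrightarrow> C * hnorm H u"
      by (intro tendsto_intros hnorm_tendsto sH u lim)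
    ultimately have "cmod (ip H u u) \<le> C * hnorm H u"
      by (meson LIMSEQ_le)
    then have "hnorm H u * hnorm H u \<le> C * hnorm H u"
      using u by (simp add: ip_self power2_eq_square norm_mult)
    then show ?thesis
      using u by (metis hnorm_nonneg hnorm_eq_0_iff mult_right_le_imp_le order_le_less)
  qed
  \<comment> \<open>u is the limit of the first components \<open>s k\<close>, hence lies in their
    closed span.\<close>
  moreover have "ip H u v = 0" if v: "v \<in> vecs H" "\<And>a b. (a, b) \<in> S \<Longrightarrow> ip H a v = 0" for v
    using ip_tendsto_left[OF sH u v(1) lim] v(2)[OF sr] by (simp add: LIMSEQ_const_iff)
  ultimately show thesis using that u eq by blast
qed

end

lemma complex_hilbertI:
  assumes H: "semi_hilbert H"
    and definite: "\<And>x. x \<in> vecs H \<Longrightarrow> hnorm H x = 0 \<Longrightarrow> x = 0"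
    and complete: "\<And>s :: nat \<Rightarrow> _. (\<And>k. s k \<in> vecs H) \<Longrightarrow>
        (\<And>e. e > 0 \<Longrightarrow> \<exists>N. \<forall>i\<ge>N. \<forall>j\<ge>N. hnorm H (s i - s j) < e) \<Longrightarrow>
        \<exists>x\<in>vecs H. (\<lambda>k. hnorm H (s k - x)) \<longlonglongrightarrow> 0"
  shows "complex_hilbert H"
proof -
  interpret semi_hilb H by standard (rule H)
  have "Re (ip H x x) > 0" if "x \<in> vecs H" "x \<noteq> 0" for x
    using definite[OF that(1)] that(2) ip_nonneg[OF that(1)] by (force simp: hnorm_def)
  then show ?thesis
    using H complete unfolding semi_hilbert_def complex_hilbert_def
    by (elim conjE, intro conjI) (assumption+, blast+)
qed

section \<open>Operators with prescribed adjoints\<close>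

definition fsupp :: "'j set \<Rightarrow> ('j \<Rightarrow> complex) set" where
  "fsupp J = {c. finite {j. c j \<noteq> 0} \<and> {j. c j \<noteq> 0} \<subseteq> J}"

text \<open>Coefficients are functions on the whole index type. Combinations over an infinite family
  can then be added pointwise, and the closure properties demanded by \<open>riesz_relation\<close>
  become facts about \<open>fsupp\<close>.\<close>

definition lin_comb :: "('j \<Rightarrow> 'a::complex_vector) \<Rightarrow> ('j \<Rightarrow> complex) \<Rightarrow> 'a" where
  "lin_comb a c = (\<Sum>j | c j \<noteq> 0. c j *\<^sub>C a j)"

lemma lin_comb_superset:
  assumes "finite I" "{j. c j \<noteq> 0} \<subseteq> I"
  shows "lin_comb a c = (\<Sum>j\<in>I. c j *\<^sub>C a j)"
  unfolding lin_comb_def by (rule sum.mono_neutral_left) (use assms in auto)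

lemma fsupp_zero: "0 \<in> fsupp J"
  by (simp add: fsupp_def)

lemma fsupp_add: "c \<in> fsupp J \<Longrightarrow> d \<in> fsupp J \<Longrightarrow> c + d \<in> fsupp J"
proof -
  assume "c \<in> fsupp J" "d \<in> fsupp J"
  moreover have "{j. (c + d) j \<noteq> 0} \<subseteq> {j. c j \<noteq> 0} \<union> {j. d j \<noteq> 0}" by auto
  ultimately show ?thesis
    unfolding fsupp_def by (blast intro: finite_subset)
qed

lemma fsupp_mult: "c \<in> fsupp J \<Longrightarrow> (\<lambda>j. t j * c j) \<in> fsupp J"
  unfolding fsupp_def by (auto intro: finite_subset[of _ "{j. c j \<noteq> 0}"])

lemma fsupp_single: "j \<in> J \<Longrightarrow> (\<lambda>i. if i = j then t else 0) \<in> fsupp J"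
  unfolding fsupp_def by auto

lemma fsupp_finite: "c \<in> fsupp J \<Longrightarrow> finite {j. c j \<noteq> 0}"
  and fsupp_subset: "c \<in> fsupp J \<Longrightarrow> c j \<noteq> 0 \<Longrightarrow> j \<in> J"
  by (auto simp: fsupp_def)

lemma lin_comb_zero [simp]: "lin_comb a 0 = 0"
  by (simp add: lin_comb_def)

lemma lin_comb_add:
  assumes "c \<in> fsupp J" "d \<in> fsupp J"
  shows "lin_comb a (c + d) = lin_comb a c + lin_comb a d"
proof -
  let ?I = "{j. c j \<noteq> 0} \<union> {j. d j \<noteq> 0}"
  have "finite ?I" using assms by (simp add: fsupp_finite)
  then show ?thesis
    by (subst (1 2 3) lin_comb_superset[of ?I]) (auto simp: scaleC_add_left sum.distrib)
qed

lemma lin_comb_scale: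
  assumes "c \<in> fsupp J"
  shows "lin_comb a (\<lambda>j. t * c j) = t *\<^sub>C lin_comb a c"
  using fsupp_finite[OF assms]
  by (subst (1 2) lin_comb_superset[of "{j. c j \<noteq> 0}"])
    (auto simp: cvs.scale_sum_right scaleC_scaleC)

lemma lin_comb_single [simp]: "lin_comb a (\<lambda>i. if i = j then t else 0) = t *\<^sub>C a j"
  by (subst lin_comb_superset[of "{j}"]) auto

lemma (in semi_hilb) lin_comb_in:
  "c \<in> fsupp J \<Longrightarrow> (\<And>j. j \<in> J \<Longrightarrow> a j \<in> vecs H) \<Longrightarrow> lin_comb a c \<in> vecs H"
  unfolding lin_comb_def by (rule sum_in) (auto dest: fsupp_subset)

definition gram_form :: "('j \<Rightarrow> 'j \<Rightarrow> complex) \<Rightarrow> ('j \<Rightarrow> complex) \<Rightarrow> ('j \<Rightarrow> complex) \<Rightarrow> complex" where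
  "gram_form L c d = (\<Sum>i | c i \<noteq> 0. \<Sum>j | d j \<noteq> 0. c i * cnj (d j) * L i j)"

lemma gram_form_superset:
  assumes "finite I" "{j. c j \<noteq> 0} \<subseteq> I" "{j. d j \<noteq> 0} \<subseteq> I"
  shows "gram_form L c d = (\<Sum>i\<in>I. \<Sum>j\<in>I. c i * cnj (d j) * L i j)"
proof -
  have "gram_form L c d = (\<Sum>i | c i \<noteq> 0. \<Sum>j\<in>I. c i * cnj (d j) * L i j)"
    unfolding gram_form_def by (intro sum.cong refl sum.mono_neutral_left) (use assms in auto)
  also have "\<dots> = (\<Sum>i\<in>I. \<Sum>j\<in>I. c i * cnj (d j) * L i j)"
    by (rule sum.mono_neutral_left) (use assms in auto)
  finally show ?thesis .
qed

lemma (in semi_hilb) ip_lin_comb: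
  assumes "c \<in> fsupp J" "d \<in> fsupp J"
    and "\<And>j. j \<in> J \<Longrightarrow> a j \<in> vecs H" "\<And>j. j \<in> J \<Longrightarrow> b j \<in> vecs H"
  shows "ip H (lin_comb a c) (lin_comb b d) = gram_form (\<lambda>i j. ip H (a i) (b j)) c d"
proof -
  have "ip H (lin_comb a c) (lin_comb b d) = (\<Sum>i | c i \<noteq> 0. ip H (c i *\<^sub>C a i) (lin_comb b d))"
    unfolding lin_comb_def[of a]
    by (rule ip_sum_left) (use assms in \<open>auto dest: fsupp_subset intro: lin_comb_in[of _ J]\<close>)
  also have "\<dots> = (\<Sum>i | c i \<noteq> 0. \<Sum>j | d j \<noteq> 0. ip H (c i *\<^sub>C a i) (d j *\<^sub>C b j))"
    unfolding lin_comb_def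
    by (intro sum.cong refl ip_sum_right) (use assms in \<open>auto dest: fsupp_subset\<close>)
  also have "\<dots> = gram_form (\<lambda>i j. ip H (a i) (b j)) c d"
    unfolding gram_form_def
    by (intro sum.cong refl)
      (use assms fsupp_subset[OF assms(1)] fsupp_subset[OF assms(2)] in simp)
  finally show ?thesis .
qed

lemma gram_form_diff: "gram_form (\<lambda>i j. L i j - M i j) c d = gram_form L c d - gram_form M c d"
  by (simp add: gram_form_def right_diff_distrib sum_subtractf)

lemma gram_form_add: "gram_form (\<lambda>i j. L i j + M i j) c d = gram_form L c d + gram_form M c d"
  by (simp add: gram_form_def distrib_left sum.distrib)

text \<open>Only the real part is constrained, so hermitian symmetry does not follow;
  \<open>kolmogorov\<close> asks for it separately.\<close>

definition psd :: "'j set \<Rightarrow> ('j \<Rightarrow> 'j \<Rightarrow> complex) \<Rightarrow> bool" where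
  "psd J L \<longleftrightarrow> (\<forall>c\<in>fsupp J. 0 \<le> Re (gram_form L c c))"

lemma gram_form_cong:
  assumes "c \<in> fsupp J" "d \<in> fsupp J" "\<And>i j. i \<in> J \<Longrightarrow> j \<in> J \<Longrightarrow> L i j = M i j"
  shows "gram_form L c d = gram_form M c d"
  unfolding gram_form_def by (intro sum.cong refl) (use assms in \<open>auto dest: fsupp_subset\<close>)

lemma psd_cong:
  assumes "psd J L" "\<And>i j. i \<in> J \<Longrightarrow> j \<in> J \<Longrightarrow> L i j = M i j"
  shows "psd J M"
  using assms gram_form_cong[of _ J _ L M] unfolding psd_def by metis

lemma psd_eq_0I: "(\<And>i j. i \<in> J \<Longrightarrow> j \<in> J \<Longrightarrow> L i j = 0) \<Longrightarrow> psd J L"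
  by (rule psd_cong[of J "\<lambda>_ _. 0"]) (simp_all add: psd_def gram_form_def)

lemma psd_add: "psd J L \<Longrightarrow> psd J M \<Longrightarrow> psd J (\<lambda>i j. L i j + M i j)"
  by (simp add: psd_def gram_form_add)

lemma psd_sum: "(\<And>k. k \<in> K \<Longrightarrow> psd J (L k)) \<Longrightarrow> psd J (\<lambda>i j. \<Sum>k\<in>K. L k i j)"
proof (induction K rule: infinite_finite_induct)
  case (insert k K)
  then show ?case using psd_add[of J "L k" "\<lambda>i j. \<Sum>k\<in>K. L k i j"] by simp
qed (simp_all add: psd_def gram_form_def)

text \<open>Each test involves finitely many entries, so entrywise convergence suffices.\<close>

lemma psd_limit:
  assumes "\<And>n::nat. psd J (L n)" and "\<And>i j. i \<in> J \<Longrightarrow> j \<in> J \<Longrightarrow> (\<lambda>n. L n i j) \<longlonglongrightarrow> M i j"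
  shows "psd J M"
  unfolding psd_def
proof
  fix c assume c: "c \<in> fsupp J"
  have "(\<lambda>n. Re (gram_form (L n) c c)) \<longlonglongrightarrow> Re (gram_form M c c)"
    unfolding gram_form_def
    by (intro tendsto_intros assms(2)) (use c in \<open>auto dest: fsupp_subset\<close>)
  moreover have "0 \<le> Re (gram_form (L n) c c)" for n
    using assms(1) c by (simp add: psd_def)
  ultimately show "0 \<le> Re (gram_form M c c)"
    by (simp add: LIMSEQ_le_const)
qed

text \<open>The form with coefficients c is the form of \<open>L\<close> with coefficients t c,
  which again have finite support.\<close>

lemma psd_congruence:
  assumes "psd J L"
  shows "psd J (\<lambda>i j. t i * cnj (t j) * L i j)"
  unfolding psd_def
proof
  fix c assume c: "c \<in> fsupp J"
  define d where "d = (\<lambda>i. t i * c i)"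
  have d: "d \<in> fsupp J" using c by (simp add: d_def fsupp_mult)
  have "gram_form (\<lambda>i j. t i * cnj (t j) * L i j) c c = gram_form L d d"
    using fsupp_finite[OF c]
    by (subst (1 2) gram_form_superset[of "{j. c j \<noteq> 0}"]) (auto simp: d_def mult_ac)
  then show "0 \<le> Re (gram_form (\<lambda>i j. t i * cnj (t j) * L i j) c c)"
    using assms d by (simp add: psd_def)
qed

lemma (in semi_hilb) psd_ip:
  assumes "\<And>j. j \<in> J \<Longrightarrow> a j \<in> vecs H"
  shows "psd J (\<lambda>i j. ip H (a i) (a j))"
  unfolding psd_def
  using ip_lin_comb[of _ J _ a a] assms ip_nonneg[OF lin_comb_in[of _ J a]] by (metis (no_types, lifting))

section \<open>Bounded operators and adjoints\<close>

lemma bounded_opsI: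
  assumes "\<And>x. x \<in> vecs H \<Longrightarrow> T x \<in> vecs K"
    and "\<And>x y. x \<in> vecs H \<Longrightarrow> y \<in> vecs H \<Longrightarrow> T (x + y) = T x + T y"
    and "\<And>a x. x \<in> vecs H \<Longrightarrow> T (a *\<^sub>C x) = a *\<^sub>C T x"
    and "\<And>x. x \<in> vecs H \<Longrightarrow> hnorm K (T x) \<le> c * hnorm H x"
  shows "T \<in> bounded_ops H K"
  using assms unfolding bounded_ops_def by blast

lemma bounded_opsD:
  assumes "T \<in> bounded_ops H K"
  shows "x \<in> vecs H \<Longrightarrow> T x \<in> vecs K"
    and "x \<in> vecs H \<Longrightarrow> y \<in> vecs H \<Longrightarrow> T (x + y) = T x + T y"
    and "x \<in> vecs H \<Longrightarrow> T (a *\<^sub>C x) = a *\<^sub>C T x"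
  using assms unfolding bounded_ops_def by blast+

lemma bounded_ops_bound:
  assumes "T \<in> bounded_ops H K" "semi_hilb H"
  obtains c where "c \<ge> 0" "\<And>x. x \<in> vecs H \<Longrightarrow> hnorm K (T x) \<le> c * hnorm H x"
proof -
  interpret semi_hilb H by fact
  obtain c where c: "\<And>x. x \<in> vecs H \<Longrightarrow> hnorm K (T x) \<le> c * hnorm H x"
    using assms unfolding bounded_ops_def by blast
  show thesis
  proof (rule that[of "max c 0"])
    fix x assume x: "x \<in> vecs H"
    then show "hnorm K (T x) \<le> max c 0 * hnorm H x"
      using c[OF x] mult_right_mono[of c "max c 0" "hnorm H x"] by simp
  qed simp
qed

lemma bounded_ops_zero: "T \<in> bounded_ops H K \<Longrightarrow> semi_hilb H \<Longrightarrow> T 0 = 0"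
  using bounded_opsD(3)[of T H K 0 0] semi_hilb.zero_in[of H] by simp

lemma bounded_ops_diff:
  assumes "T \<in> bounded_ops H K" "semi_hilb H" "x \<in> vecs H" "y \<in> vecs H"
  shows "T (x - y) = T x - T y"
proof -
  interpret semi_hilb H by fact
  have "T (x - y + y) = T (x - y) + T y"
    using assms by (intro bounded_opsD(2)[of T H K]) auto
  then show ?thesis by simp
qed

lemma bounded_ops_sum:
  assumes "T \<in> bounded_ops H K" "semi_hilb H" "\<And>i. i \<in> I \<Longrightarrow> f i \<in> vecs H"
  shows "T (sum f I) = (\<Sum>i\<in>I. T (f i))"
  using assms(3)
proof (induction I rule: infinite_finite_induct)
  case (insert i I)
  then have "sum f I \<in> vecs H" "f i \<in> vecs H"
    using semi_hilb.sum_in[OF assms(2)] by blast+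
  with insert show ?case using bounded_opsD(2)[OF assms(1)] by simp
qed (use bounded_ops_zero[OF assms(1,2)] in simp_all)

text \<open>\<open>riesz_relation\<close> applied to the graph of the functional.\<close>

lemma (in hilb) riesz:
  assumes in_dom: "\<And>x y. x \<in> vecs H \<Longrightarrow> y \<in> vecs H \<Longrightarrow> \<phi> (x + y) = \<phi> x + \<phi> y"
    "\<And>a x. x \<in> vecs H \<Longrightarrow> \<phi> (a *\<^sub>C x) = a * \<phi> x"
    "\<And>x. x \<in> vecs H \<Longrightarrow> cmod (\<phi> x) \<le> C * hnorm H x"
  obtains u where "u \<in> vecs H" "\<And>x. x \<in> vecs H \<Longrightarrow> ip H x u = \<phi> x"
proof (rule riesz_relation[of "(\<lambda>x. (x, \<phi> x)) ` vecs H" C])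
  have "\<phi> 0 = 0" using assms(2)[of 0 0] by simp
  then show "(0, 0) \<in> (\<lambda>x. (x, \<phi> x)) ` vecs H"
    by (intro image_eqI[of _ _ 0]) auto
qed (use assms in \<open>auto intro!: image_eqI that\<close>)

lemma hadj:
  assumes H: "hilb H" and K: "semi_hilb K" and T: "T \<in> bounded_ops H K" and y: "y \<in> vecs K"
  shows hadj_in: "hadj H K T y \<in> vecs H"
    and ip_hadj: "u \<in> vecs H \<Longrightarrow> ip K (T u) y = ip H u (hadj H K T y)"
proof -
  interpret H: hilb H by fact
  interpret K: semi_hilb K by fact
  obtain c where c: "c \<ge> 0" "\<And>x. x \<in> vecs H \<Longrightarrow> hnorm K (T x) \<le> c * hnorm H x"
    using bounded_ops_bound[OF T H.semi_hilb_axioms] by blast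
  have bound: "cmod (ip K (T x) y) \<le> c * hnorm K y * hnorm H x" if "x \<in> vecs H" for x
    using K.Cauchy_Schwarz[of "T x" y] mult_right_mono[OF c(2)[OF that], of "hnorm K y"]
      bounded_opsD(1)[OF T that] y by (simp add: mult_ac)
  obtain r where r: "r \<in> vecs H" "\<And>x. x \<in> vecs H \<Longrightarrow> ip H x r = ip K (T x) y"
    by (rule H.riesz[of "\<lambda>x. ip K (T x) y" "c * hnorm K y"])
      (use bounded_opsD[OF T] y bound in auto)
  have "u' = r" if "u' \<in> vecs H \<and> (\<forall>x\<in>vecs H. ip K (T x) y = ip H x u')" for u'
  proof (rule H.vec_eqI)
    fix x assume "x \<in> vecs H"
    then show "ip H u' x = ip H r x"
      using that r H.ip_cnj[of x u'] H.ip_cnj[of x r] by simp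
  qed (use that r in auto)
  moreover have "r \<in> vecs H \<and> (\<forall>x\<in>vecs H. ip K (T x) y = ip H x r)"
    using r by simp
  ultimately have "hadj H K T y \<in> vecs H \<and> (\<forall>x\<in>vecs H. ip K (T x) y = ip H x (hadj H K T y))"
    unfolding hadj_def by (rule theI[rotated])
  then show "hadj H K T y \<in> vecs H" "u \<in> vecs H \<Longrightarrow> ip K (T u) y = ip H u (hadj H K T y)"
    by auto
qed

text \<open>|T^* y|^2 = <T T^* y, y> \<le> |T^* y| |y|, and one factor cancels.\<close>

lemma hadj_contraction:
  assumes H: "hilb H" and K: "semi_hilb K" and T: "T \<in> bounded_ops H K" and y: "y \<in> vecs K"
    and contr: "\<And>x. x \<in> vecs H \<Longrightarrow> hnorm K (T x) \<le> hnorm H x"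
  shows "hnorm H (hadj H K T y) \<le> hnorm K y"
proof -
  interpret H: hilb H by fact
  interpret K: semi_hilb K by fact
  define u where "u = hadj H K T y"
  have u: "u \<in> vecs H" unfolding u_def by (rule hadj_in[OF H K T y])
  have "hnorm H u * hnorm H u = cmod (ip H u u)"
    using u by (simp add: H.ip_self power2_eq_square norm_mult)
  also have "\<dots> = cmod (ip K (T u) y)"
    using ip_hadj[OF H K T y u] by (simp add: u_def)
  also have "\<dots> \<le> hnorm K (T u) * hnorm K y"
    using bounded_opsD(1)[OF T u] y by (rule K.Cauchy_Schwarz)
  also have "\<dots> \<le> hnorm H u * hnorm K y"
    using contr[OF u] y by (simp add: mult_right_mono)
  finally show ?thesis
    unfolding u_def[symmetric] using u y
    by (metis H.hnorm_nonneg K.hnorm_nonneg mult_left_le_imp_le order_le_less)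
qed

lemma bounded_ops_hadj:
  assumes H: "hilb H" and K: "semi_hilb K" and T: "T \<in> bounded_ops H K"
  shows "y \<in> vecs K \<Longrightarrow> y' \<in> vecs K \<Longrightarrow> hadj H K T (y + y') = hadj H K T y + hadj H K T y'"
    and "y \<in> vecs K \<Longrightarrow> hadj H K T (a *\<^sub>C y) = a *\<^sub>C hadj H K T y"
proof -
  interpret H: hilb H by fact
  interpret K: semi_hilb K by fact
  note adj = hadj_in[OF H K T] ip_hadj[OF H K T, symmetric]
  have eqI: "x = x'" if "x \<in> vecs H" "x' \<in> vecs H" "\<And>u. u \<in> vecs H \<Longrightarrow> ip H u x = ip H u x'" for x x'
    using that H.ip_cnj by (intro H.vec_eqI) metis+
  show "hadj H K T (y + y') = hadj H K T y + hadj H K T y'" if "y \<in> vecs K" "y' \<in> vecs K"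
    by (rule eqI) (use that adj bounded_opsD(1)[OF T] in auto)
  show "hadj H K T (a *\<^sub>C y) = a *\<^sub>C hadj H K T y" if "y \<in> vecs K"
    by (rule eqI) (use that adj bounded_opsD(1)[OF T] in auto)
qed

text \<open>The values of the operator are taken in the closed span of the \<open>a j\<close>, where they are
  determined by the prescribed inner products; this makes the operator linear.\<close>

lemma contraction_from_gram:
  assumes H: "hilb H" and K: "semi_hilb K"
    and a: "\<And>j. j \<in> J \<Longrightarrow> a j \<in> vecs H" and b: "\<And>j. j \<in> J \<Longrightarrow> b j \<in> vecs K"
    and psd: "psd J (\<lambda>i j. ip H (a i) (a j) - ip K (b i) (b j))"
  obtains U where "U \<in> bounded_ops K H" "\<And>k. k \<in> vecs K \<Longrightarrow> hnorm H (U k) \<le> hnorm K k"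
    "\<And>k j. k \<in> vecs K \<Longrightarrow> j \<in> J \<Longrightarrow> ip H (U k) (a j) = ip K k (b j)"
proof -
  interpret H: hilb H by fact
  interpret K: semi_hilb K by fact
  have le: "hnorm K (lin_comb b c) \<le> hnorm H (lin_comb a c)" if c: "c \<in> fsupp J" for c
  proof (rule power2_le_imp_le)
    show "(hnorm K (lin_comb b c))\<^sup>2 \<le> (hnorm H (lin_comb a c))\<^sup>2"
      using psd c H.lin_comb_in[OF c a] K.lin_comb_in[OF c b]
        H.ip_lin_comb[OF c c a a] K.ip_lin_comb[OF c c b b]
      by (simp add: psd_def gram_form_diff H.hnorm_sq K.hnorm_sq)
  qed (rule H.hnorm_nonneg[OF H.lin_comb_in[OF c a]])
  have "\<exists>u. u \<in> vecs H \<and> (\<forall>j\<in>J. ip H u (a j) = ip K k (b j)) \<and> hnorm H u \<le> hnorm K k \<and>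
      (\<forall>v\<in>vecs H. (\<forall>j\<in>J. ip H v (a j) = 0) \<longrightarrow> ip H u v = 0)" if k: "k \<in> vecs K" for k
  \<comment> \<open>One vector may have many coefficient families, so the functional sending
    \<open>lin_comb a c\<close> to <\<open>lin_comb b c\<close>, k> is passed as a relation;
    \<open>le\<close> supplies its bound.\<close>
  proof (rule H.riesz_relation[of "(\<lambda>c. (lin_comb a c, ip K (lin_comb b c) k)) ` fsupp J" "hnorm K k"])
    let ?S = "(\<lambda>c. (lin_comb a c, ip K (lin_comb b c) k)) ` fsupp J"
    show "x \<in> vecs H" if "(x, y) \<in> ?S" for x y
      using that H.lin_comb_in[OF _ a] by auto
    show "(0, 0) \<in> ?S"
      by (intro image_eqI[OF _ fsupp_zero]) (use k in simp)
    show "(x + x', y + y') \<in> ?S" if "(x, y) \<in> ?S" "(x', y') \<in> ?S" for x y x' y'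
    proof -
      from that obtain c d where cd: "c \<in> fsupp J" "x = lin_comb a c" "y = ip K (lin_comb b c) k"
        "d \<in> fsupp J" "x' = lin_comb a d" "y' = ip K (lin_comb b d) k" by auto
      show ?thesis
        by (intro image_eqI[OF _ fsupp_add[OF cd(1,4)]])
          (use cd k K.lin_comb_in[OF cd(1) b] K.lin_comb_in[OF cd(4) b] in \<open>simp add: lin_comb_add[OF cd(1,4)]\<close>)
    qed
    show "(t *\<^sub>C x, t * y) \<in> ?S" if xy: "(x, y) \<in> ?S" for x y t
    proof -
      from xy obtain c where c: "c \<in> fsupp J" "x = lin_comb a c" "y = ip K (lin_comb b c) k" by auto
      show ?thesis
        by (intro image_eqI[OF _ fsupp_mult[OF c(1), of "\<lambda>_. t"]])
          (use c k K.lin_comb_in[OF c(1) b] in \<open>simp add: lin_comb_scale[OF c(1)]\<close>)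
    qed
    show "cmod y \<le> hnorm K k * hnorm H x" if xy: "(x, y) \<in> ?S" for x y
    proof -
      from xy obtain c where c: "c \<in> fsupp J" "x = lin_comb a c" "y = ip K (lin_comb b c) k" by auto
      moreover have "lin_comb b c \<in> vecs K" by (rule K.lin_comb_in[OF c(1) b])
      ultimately show ?thesis
        using K.Cauchy_Schwarz[OF _ k, of "lin_comb b c"] mult_right_mono[OF le[OF c(1)], of "hnorm K k"] k
        by (simp add: mult.commute)
    qed
    fix u assume u: "u \<in> vecs H" "\<And>x y. (x, y) \<in> ?S \<Longrightarrow> ip H x u = y" "hnorm H u \<le> hnorm K k \<or> u = 0"
      "\<And>v. v \<in> vecs H \<Longrightarrow> (\<And>x y. (x, y) \<in> ?S \<Longrightarrow> ip H x v = 0) \<Longrightarrow> ip H u v = 0"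
    have "ip H u (a j) = ip K k (b j)" if "j \<in> J" for j
    proof -
      have "ip H (a j) u = ip K (b j) k"
        by (intro u(2) image_eqI[OF _ fsupp_single[OF that, of 1]]) (simp_all add: scaleC_one)
      then show ?thesis
        using H.ip_cnj[of "a j" u] K.ip_cnj[of "b j" k] a b k u(1) that by simp
    qed
    moreover have "ip H u v = 0" if v: "v \<in> vecs H" "\<forall>j\<in>J. ip H v (a j) = 0" for v
    proof (rule u(4)[OF v(1)])
      fix x y assume "(x, y) \<in> ?S"
      then obtain c where c: "c \<in> fsupp J" "x = lin_comb a c" by auto
      have "ip H (c j *\<^sub>C a j) v = 0" if "c j \<noteq> 0" for j
        using that v a[OF fsupp_subset[OF c(1) that]] fsupp_subset[OF c(1) that] H.ip_cnj[of v "a j"]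
        by simp
      then show "ip H x v = 0"
        unfolding c(2) lin_comb_def
        by (subst H.ip_sum_left) (use v a fsupp_subset[OF c(1)] in auto)
    qed
    moreover have "hnorm H u \<le> hnorm K k" using u(3) k by auto
    ultimately show ?thesis using u(1) by blast
  qed
  then obtain U where U: "\<And>k. k \<in> vecs K \<Longrightarrow> U k \<in> vecs H"
      "\<And>k j. k \<in> vecs K \<Longrightarrow> j \<in> J \<Longrightarrow> ip H (U k) (a j) = ip K k (b j)"
      "\<And>k. k \<in> vecs K \<Longrightarrow> hnorm H (U k) \<le> hnorm K k"
      "\<And>k v. k \<in> vecs K \<Longrightarrow> v \<in> vecs H \<Longrightarrow> (\<forall>j\<in>J. ip H v (a j) = 0) \<Longrightarrow> ip H (U k) v = 0"
    by metis
  \<comment> \<open>A candidate v with the same inner products against all \<open>a j\<close>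
    differs from \<open>U k\<close> by a vector w orthogonal to all of them. Both \<open>U k\<close>
    and v are orthogonal to every such w, so <w, w> = 0.\<close>
  have eqI: "U k = v"
    if "k \<in> vecs K" "v \<in> vecs H" "\<And>j. j \<in> J \<Longrightarrow> ip H v (a j) = ip K k (b j)"
      "\<And>u. u \<in> vecs H \<Longrightarrow> \<forall>j\<in>J. ip H u (a j) = 0 \<Longrightarrow> ip H v u = 0" for k v
  proof -
    have w: "U k - v \<in> vecs H" "\<forall>j\<in>J. ip H (U k - v) (a j) = 0"
      using that U(1,2) a by simp_all
    have "ip H (U k - v) (U k - v) = 0"
      using U(4)[OF that(1) w] that(4)[OF w] U(1) that by (subst H.ip_diff_left) (use w in auto)
    then show ?thesis using H.ip_self_eq_0[OF w(1)] by simp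
  qed
  have "U \<in> bounded_ops K H"
  proof (rule bounded_opsI[where c = 1])
    show "U (k + k') = U k + U k'" if "k \<in> vecs K" "k' \<in> vecs K" for k k'
      by (rule eqI) (use that U a b in auto)
    show "U (t *\<^sub>C k) = t *\<^sub>C U k" if "k \<in> vecs K" for t k
      by (rule eqI) (use that U a b in auto)
  qed (use U(1,3) in simp_all)
  then show thesis using that U by blast
qed

section \<open>Completion and Kolmogorov decomposition\<close>

text \<open>Makes complex-valued functions a complex vector space, the ambient space of the
  completion below.\<close>

instantiation complex :: complex_vector
begin

definition scaleC_complex_def [simp]: "a *\<^sub>C x = a * (x :: complex)"

instance by standard (simp_all add: algebra_simps)

end

section \<open>Completion of a semi-inner product space by limit functionals\<close>

context semi_hilb
begin

definition cauchy_seq :: "(nat \<Rightarrow> 'a) \<Rightarrow> bool" where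
  "cauchy_seq s \<longleftrightarrow> (\<forall>k. s k \<in> vecs H) \<and> (\<forall>e>0. \<exists>N. \<forall>i\<ge>N. \<forall>j\<ge>N. hnorm H (s i - s j) < e)"

lemma cauchy_seq_in: "cauchy_seq s \<Longrightarrow> s k \<in> vecs H"
  by (simp add: cauchy_seq_def)

lemma cauchy_seqD:
  assumes "cauchy_seq s" "e > 0"
  obtains N where "\<And>i j. i \<ge> N \<Longrightarrow> j \<ge> N \<Longrightarrow> hnorm H (s i - s j) < e"
  using assms unfolding cauchy_seq_def by blast

lemma cauchy_seq_const: "p \<in> vecs H \<Longrightarrow> cauchy_seq (\<lambda>_. p)"
  by (simp add: cauchy_seq_def)

lemma cauchy_seq_scale:
  assumes s: "cauchy_seq s"
  shows "cauchy_seq (\<lambda>k. a *\<^sub>C s k)"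
  unfolding cauchy_seq_def
proof (intro conjI allI impI)
  fix e :: real assume "e > 0"
  then obtain N where N: "\<And>i j. i \<ge> N \<Longrightarrow> j \<ge> N \<Longrightarrow> hnorm H (s i - s j) < e / (cmod a + 1)"
    using cauchy_seqD[OF s, of "e / (cmod a + 1)"] by (auto simp: add_nonneg_pos)
  have "hnorm H (a *\<^sub>C s i - a *\<^sub>C s j) < e" if "i \<ge> N" "j \<ge> N" for i j
  proof -
    have "hnorm H (a *\<^sub>C (s i - s j)) = cmod a * hnorm H (s i - s j)"
      using cauchy_seq_in[OF s] by (intro hnorm_scale) auto
    also have "\<dots> \<le> (cmod a + 1) * hnorm H (s i - s j)"
      using cauchy_seq_in[OF s] by (intro mult_right_mono) auto
    also have "\<dots> < e"
      using N[OF that] by (simp add: pos_less_divide_eq add_nonneg_pos mult.commute)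
    finally show ?thesis by (simp add: cvs.scale_right_diff_distrib)
  qed
  then show "\<exists>N. \<forall>i\<ge>N. \<forall>j\<ge>N. hnorm H (a *\<^sub>C s i - a *\<^sub>C s j) < e" by blast
qed (use cauchy_seq_in[OF s] in simp)

lemma cauchy_seq_add:
  assumes s: "cauchy_seq s" and t: "cauchy_seq t"
  shows "cauchy_seq (\<lambda>k. s k + t k)"
  unfolding cauchy_seq_def
proof (intro conjI allI impI)
  fix e :: real assume "e > 0"
  then have "e / 2 > 0" by simp
  obtain M where M: "\<And>i j. i \<ge> M \<Longrightarrow> j \<ge> M \<Longrightarrow> hnorm H (s i - s j) < e / 2"
    using cauchy_seqD[OF s \<open>e / 2 > 0\<close>] by blast
  obtain N where N: "\<And>i j. i \<ge> N \<Longrightarrow> j \<ge> N \<Longrightarrow> hnorm H (t i - t j) < e / 2"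
    using cauchy_seqD[OF t \<open>e / 2 > 0\<close>] by blast
  have "hnorm H (s i + t i - (s j + t j)) < e" if "i \<ge> max M N" "j \<ge> max M N" for i j
  proof -
    have "hnorm H (s i + t i - (s j + t j)) \<le> hnorm H (s i - s j) + hnorm H (t i - t j)"
      using hnorm_triangle[of "s i - s j" "t i - t j"] cauchy_seq_in[OF s] cauchy_seq_in[OF t]
      by (simp add: algebra_simps)
    then show ?thesis using M[of i j] N[of i j] that by simp
  qed
  then show "\<exists>N. \<forall>i\<ge>N. \<forall>j\<ge>N. hnorm H (s i + t i - (s j + t j)) < e" by blast
qed (use cauchy_seq_in[OF s] cauchy_seq_in[OF t] in simp)

lemma cauchy_seq_diff:
  assumes "cauchy_seq s" "cauchy_seq t"
  shows "cauchy_seq (\<lambda>k. s k - t k)"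
  using cauchy_seq_add[OF assms(1) cauchy_seq_scale[OF assms(2), of "-1"]]
  by (simp add: cvs.scale_minus_left scaleC_one)

lemma cauchy_hnorm_convergent:
  assumes s: "cauchy_seq s"
  shows "convergent (\<lambda>k. hnorm H (s k))"
proof (rule Cauchy_convergent, rule CauchyI)
  fix e :: real assume "e > 0"
  obtain N where N: "\<And>i j. i \<ge> N \<Longrightarrow> j \<ge> N \<Longrightarrow> hnorm H (s i - s j) < e"
    using cauchy_seqD[OF s \<open>e > 0\<close>] by blast
  have "norm (hnorm H (s i) - hnorm H (s j)) < e" if "i \<ge> N" "j \<ge> N" for i j
    using hnorm_diff_abs[OF cauchy_seq_in[OF s] cauchy_seq_in[OF s], of i j] N[OF that]
    unfolding real_norm_def by (rule le_less_trans)
  then show "\<exists>M. \<forall>m\<ge>M. \<forall>n\<ge>M. norm (hnorm H (s m) - hnorm H (s n)) < e"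
    by blast
qed

lemma cauchy_seq_bounded:
  assumes s: "cauchy_seq s"
  obtains B where "B > 0" "\<And>k. hnorm H (s k) \<le> B"
  using convergent_imp_Bseq[OF cauchy_hnorm_convergent[OF s]] that
  unfolding Bseq_def by (auto simp: abs_le_iff)

text \<open>Polarization reduces this to convergence of the norms of Cauchy sequences.\<close>

lemma cauchy_ip_convergent:
  assumes s: "cauchy_seq s" and t: "cauchy_seq t"
  shows "convergent (\<lambda>k. ip H (s k) (t k))"
proof -
  have Re: "convergent (\<lambda>k. Re (ip H (u k) (t k)))" if u: "cauchy_seq u" for u
  proof -
    obtain a b where "(\<lambda>k. hnorm H (u k + t k)) \<longlonglongrightarrow> a" "(\<lambda>k. hnorm H (u k - t k)) \<longlonglongrightarrow> b"
      using cauchy_hnorm_convergent[OF cauchy_seq_add[OF u t]] cauchy_hnorm_convergent[OF cauchy_seq_diff[OF u t]]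
      unfolding convergent_def by blast
    then have "(\<lambda>k. ((hnorm H (u k + t k))\<^sup>2 - (hnorm H (u k - t k))\<^sup>2) / 4) \<longlonglongrightarrow> (a\<^sup>2 - b\<^sup>2) / 4"
      by (intro tendsto_intros) simp_all
    then show ?thesis
      unfolding polarization(1)[OF cauchy_seq_in[OF u] cauchy_seq_in[OF t]] by (rule convergentI)
  qed
  obtain a b where "(\<lambda>k. Re (ip H (s k) (t k))) \<longlonglongrightarrow> a" "(\<lambda>k. Im (ip H (s k) (t k))) \<longlonglongrightarrow> b"
    using Re[OF s] Re[OF cauchy_seq_scale[OF s, of "- \<i>"]]
    unfolding polarization(2)[OF cauchy_seq_in[OF s] cauchy_seq_in[OF t], symmetric] convergent_def by blast
  then have "(\<lambda>k. ip H (s k) (t k)) \<longlonglongrightarrow> Complex a b"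
    by (simp add: tendsto_complex_iff)
  then show ?thesis by (rule convergentI)
qed

text \<open>|d_k|^2 = <d_k, d_k - d_M> + <d_k, d_M>: for a fixed large M, boundedness and the Cauchy
  property control the first term, weak convergence the second. Consequently Cauchy sequences with
  equal limit functionals are equivalent.\<close>

lemma cauchy_weakly_null:
  assumes d: "cauchy_seq d" and weak: "\<And>q. q \<in> vecs H \<Longrightarrow> (\<lambda>k. ip H (d k) q) \<longlonglongrightarrow> 0"
  shows "(\<lambda>k. hnorm H (d k)) \<longlonglongrightarrow> 0"
proof -
  note in_H = cauchy_seq_in[OF d]
  obtain B where B: "B > 0" "\<And>k. hnorm H (d k) \<le> B" using cauchy_seq_bounded[OF d] by blast
  have "(\<lambda>k. (hnorm H (d k))\<^sup>2) \<longlonglongrightarrow> 0"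
  proof (rule LIMSEQ_I)
    fix e :: real assume "e > 0"
    then have e: "e / (2 * B) > 0" using B by simp
    obtain M where M: "\<And>i j. i \<ge> M \<Longrightarrow> j \<ge> M \<Longrightarrow> hnorm H (d i - d j) < e / (2 * B)"
      using cauchy_seqD[OF d e] by blast
    obtain N where N: "\<And>k. k \<ge> N \<Longrightarrow> cmod (ip H (d k) (d M)) < e / 2"
      using LIMSEQ_D[OF weak[OF in_H], of "e / 2"] \<open>e > 0\<close> by auto
    have "norm ((hnorm H (d k))\<^sup>2 - 0) < e" if "k \<ge> max M N" for k
    proof -
      have "(hnorm H (d k))\<^sup>2 = cmod (ip H (d k) (d k))"
        using in_H by (simp add: ip_self norm_power)
      also have "ip H (d k) (d k) = ip H (d k) (d k - d M) + ip H (d k) (d M)"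
        using in_H by simp
      also have "cmod \<dots> \<le> hnorm H (d k) * hnorm H (d k - d M) + cmod (ip H (d k) (d M))"
        using in_H by (intro norm_triangle_le add_mono Cauchy_Schwarz) auto
      also have "\<dots> < B * (e / (2 * B)) + e / 2"
        using B M[of k M] N[of k] that in_H
        by (intro add_le_less_mono mult_mono) (auto intro: less_imp_le)
      also have "\<dots> = e" using B by simp
      finally show ?thesis by simp
    qed
    then show "\<exists>no. \<forall>n\<ge>no. norm ((hnorm H (d n))\<^sup>2 - 0) < e" by blast
  qed
  then have "(\<lambda>k. sqrt ((hnorm H (d k))\<^sup>2)) \<longlonglongrightarrow> sqrt 0" by (rule tendsto_real_sqrt)
  then show ?thesis using in_H by simp
qed

lemma ip_null_seq:
  assumes d: "cauchy_seq d" and t: "cauchy_seq t" and lim: "(\<lambda>k. hnorm H (d k)) \<longlonglongrightarrow> 0"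
  shows "(\<lambda>k. ip H (d k) (t k)) \<longlonglongrightarrow> 0" "(\<lambda>k. ip H (t k) (d k)) \<longlonglongrightarrow> 0"
proof -
  note in_H = cauchy_seq_in[OF d] cauchy_seq_in[OF t]
  obtain B where B: "B > 0" "\<And>k. hnorm H (t k) \<le> B" using cauchy_seq_bounded[OF t] by blast
  have lim': "(\<lambda>k. hnorm H (d k) * B) \<longlonglongrightarrow> 0"
    using tendsto_mult_right[OF lim, of B] by simp
  have le: "cmod (ip H (d k) (t k)) \<le> hnorm H (d k) * B" for k
    using Cauchy_Schwarz[of "d k" "t k"] mult_left_mono[OF B(2), of "hnorm H (d k)" k] in_H
    by (auto intro: order_trans)
  have le': "cmod (ip H (t k) (d k)) \<le> hnorm H (d k) * B" for k
    using le[of k] ip_cnj[of "d k" "t k"] in_H by simp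
  show "(\<lambda>k. ip H (d k) (t k)) \<longlonglongrightarrow> 0"
    by (rule Lim_null_comparison[OF _ lim']) (use le in simp)
  show "(\<lambda>k. ip H (t k) (d k)) \<longlonglongrightarrow> 0"
    by (rule Lim_null_comparison[OF _ lim']) (use le' in simp)
qed

text \<open>The class of a Cauchy sequence is represented by the conjugate-linear functional q to
  lim <s_k, q>, which replaces a quotient construction. The value 0 off \<open>vecs H\<close> makes
  equal classes equal as functions.\<close>

definition lim_fun :: "(nat \<Rightarrow> 'a) \<Rightarrow> 'a \<Rightarrow> complex" where
  "lim_fun s = (\<lambda>q. if q \<in> vecs H then lim (\<lambda>k. ip H (s k) q) else 0)"

lemma lim_fun_tendsto:
  assumes "cauchy_seq s" "q \<in> vecs H"
  shows "(\<lambda>k. ip H (s k) q) \<longlonglongrightarrow> lim_fun s q"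
  using cauchy_ip_convergent[OF assms(1) cauchy_seq_const[OF assms(2)]] assms(2)
  by (simp add: lim_fun_def convergent_LIMSEQ_iff)

lemma lim_fun_eqI:
  assumes "cauchy_seq s" "\<And>q. q \<in> vecs H \<Longrightarrow> (\<lambda>k. ip H (s k) q) \<longlonglongrightarrow> f q"
    and "\<And>q. q \<notin> vecs H \<Longrightarrow> f q = 0"
  shows "lim_fun s = f"
proof
  fix q show "lim_fun s q = f q"
    using LIMSEQ_unique[OF lim_fun_tendsto[OF assms(1)] assms(2), of q] assms(3)
    by (cases "q \<in> vecs H") (simp_all add: lim_fun_def)
qed

lemma lim_fun_add:
  assumes s: "cauchy_seq s" and t: "cauchy_seq t"
  shows "lim_fun (\<lambda>k. s k + t k) = lim_fun s + lim_fun t"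
proof (rule lim_fun_eqI[OF cauchy_seq_add[OF s t]])
  fix q assume "q \<in> vecs H"
  then show "(\<lambda>k. ip H (s k + t k) q) \<longlonglongrightarrow> (lim_fun s + lim_fun t) q"
    using tendsto_add[OF lim_fun_tendsto[OF s] lim_fun_tendsto[OF t], of q q]
      cauchy_seq_in[OF s] cauchy_seq_in[OF t] by simp
qed (simp add: lim_fun_def)

lemma lim_fun_scale:
  assumes s: "cauchy_seq s"
  shows "lim_fun (\<lambda>k. a *\<^sub>C s k) = a *\<^sub>C lim_fun s"
proof (rule lim_fun_eqI[OF cauchy_seq_scale[OF s]])
  fix q assume "q \<in> vecs H"
  then show "(\<lambda>k. ip H (a *\<^sub>C s k) q) \<longlonglongrightarrow> (a *\<^sub>C lim_fun s) q"
    using tendsto_mult_left[OF lim_fun_tendsto[OF s], of q a] cauchy_seq_in[OF s]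
    by (simp add: scaleC_fun_def)
qed (simp add: lim_fun_def scaleC_fun_def)

lemma lim_fun_diff:
  assumes "cauchy_seq s" "cauchy_seq t"
  shows "lim_fun (\<lambda>k. s k - t k) = lim_fun s - lim_fun t"
  using lim_fun_add[OF assms(1) cauchy_seq_scale[OF assms(2), of "-1"]] lim_fun_scale[OF assms(2), of "-1"]
  by (simp add: cvs.scale_minus_left scaleC_one)

lemma lim_fun_eq_imp_null:
  assumes s: "cauchy_seq s" and t: "cauchy_seq t" and eq: "lim_fun s = lim_fun t"
  shows "(\<lambda>k. hnorm H (s k - t k)) \<longlonglongrightarrow> 0"
proof (rule cauchy_weakly_null[OF cauchy_seq_diff[OF s t]])
  fix q assume "q \<in> vecs H"
  then show "(\<lambda>k. ip H (s k - t k) q) \<longlonglongrightarrow> 0"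
    using lim_fun_tendsto[OF cauchy_seq_diff[OF s t]] by (simp add: lim_fun_diff[OF s t] eq)
qed

definition rep_seq :: "('a \<Rightarrow> complex) \<Rightarrow> nat \<Rightarrow> 'a" where
  "rep_seq f = (SOME s. cauchy_seq s \<and> lim_fun s = f)"

lemma rep_seq:
  assumes "cauchy_seq s"
  shows "cauchy_seq (rep_seq (lim_fun s))" "lim_fun (rep_seq (lim_fun s)) = lim_fun s"
  unfolding rep_seq_def
  using someI[of "\<lambda>t. cauchy_seq t \<and> lim_fun t = lim_fun s" s] assms by auto

definition completion :: "('a \<Rightarrow> complex) hilbert" where
  "completion = \<lparr>vecs = lim_fun ` Collect cauchy_seq,
     ip = \<lambda>f g. lim (\<lambda>k. ip H (rep_seq f k) (rep_seq g k))\<rparr>"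

text \<open>Independence of the chosen representatives: another choice changes each sequence by a
  norm-null one, which does not affect the limit of the inner products.\<close>

lemma completion_ip_tendsto:
  assumes s: "cauchy_seq s" and t: "cauchy_seq t"
  shows "(\<lambda>k. ip H (s k) (t k)) \<longlonglongrightarrow> ip completion (lim_fun s) (lim_fun t)"
proof -
  let ?s = "rep_seq (lim_fun s)" and ?t = "rep_seq (lim_fun t)"
  note s' = rep_seq[OF s] and t' = rep_seq[OF t]
  note in_H = cauchy_seq_in[OF s] cauchy_seq_in[OF t] cauchy_seq_in[OF s'(1)] cauchy_seq_in[OF t'(1)]
  have "(\<lambda>k. ip H (?s k) (?t k)) \<longlonglongrightarrow> ip completion (lim_fun s) (lim_fun t)"
    using cauchy_ip_convergent[OF s'(1) t'(1)] by (simp add: completion_def convergent_LIMSEQ_iff)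
  moreover have "(\<lambda>k. ip H (s k - ?s k) (?t k)) \<longlonglongrightarrow> 0"
    using s s' t' by (intro ip_null_seq cauchy_seq_diff lim_fun_eq_imp_null) auto
  moreover have "(\<lambda>k. ip H (s k) (t k - ?t k)) \<longlonglongrightarrow> 0"
    using s t s' t' by (intro ip_null_seq cauchy_seq_diff lim_fun_eq_imp_null) auto
  ultimately have "(\<lambda>k. ip H (?s k) (?t k) + ip H (s k - ?s k) (?t k) + ip H (s k) (t k - ?t k))
      \<longlonglongrightarrow> ip completion (lim_fun s) (lim_fun t) + 0 + 0"
    by (intro tendsto_add)
  then show ?thesis using in_H by simp
qed

lemma completion_hnorm_tendsto:
  assumes s: "cauchy_seq s"
  shows "(\<lambda>k. hnorm H (s k)) \<longlonglongrightarrow> hnorm completion (lim_fun s)"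
  unfolding hnorm_def by (intro tendsto_intros completion_ip_tendsto s)

lemma completion_dist_tendsto:
  assumes "cauchy_seq s" "cauchy_seq t"
  shows "(\<lambda>k. hnorm H (s k - t k)) \<longlonglongrightarrow> hnorm completion (lim_fun s - lim_fun t)"
  using completion_hnorm_tendsto[OF cauchy_seq_diff[OF assms]] by (simp add: lim_fun_diff assms)

lemma completion_vecs: "f \<in> vecs completion \<longleftrightarrow> (\<exists>s. cauchy_seq s \<and> f = lim_fun s)"
  by (auto simp: completion_def)

lemma lim_fun_in: "cauchy_seq s \<Longrightarrow> lim_fun s \<in> vecs completion"
  by (auto simp: completion_vecs)

lemma semi_hilbert_completion: "semi_hilbert completion"
  unfolding semi_hilbert_def
proof (intro conjI ballI allI)
  show "cvs.subspace (vecs completion)"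
  proof (rule cvs.subspaceI)
    have "lim_fun (\<lambda>_. 0) = 0"
      by (rule lim_fun_eqI) (auto intro: cauchy_seq_const)
    then show "0 \<in> vecs completion"
      using lim_fun_in[OF cauchy_seq_const[of 0]] by simp
    show "f + g \<in> vecs completion" if "f \<in> vecs completion" "g \<in> vecs completion" for f g
      using that cauchy_seq_add lim_fun_add unfolding completion_vecs by metis
    show "a *\<^sub>C f \<in> vecs completion" if "f \<in> vecs completion" for a f
      using that cauchy_seq_scale lim_fun_scale unfolding completion_vecs by metis
  qed
next
  fix f g h assume "f \<in> vecs completion" "g \<in> vecs completion" "h \<in> vecs completion"
  then obtain s t r where st: "cauchy_seq s" "f = lim_fun s" "cauchy_seq t" "g = lim_fun t"
    "cauchy_seq r" "h = lim_fun r" unfolding completion_vecs by blast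
  have "(\<lambda>k. ip H (s k + t k) (r k)) \<longlonglongrightarrow> ip completion f h + ip completion g h"
    using tendsto_add[OF completion_ip_tendsto[OF st(1,5)] completion_ip_tendsto[OF st(3,5)]]
      cauchy_seq_in st by simp
  then show "ip completion (f + g) h = ip completion f h + ip completion g h"
    using LIMSEQ_unique[OF completion_ip_tendsto[OF cauchy_seq_add[OF st(1,3)] st(5)]]
    by (simp add: lim_fun_add st)
next
  fix a f g assume "f \<in> vecs completion" "g \<in> vecs completion"
  then obtain s t where st: "cauchy_seq s" "f = lim_fun s" "cauchy_seq t" "g = lim_fun t"
    unfolding completion_vecs by blast
  have "(\<lambda>k. ip H (a *\<^sub>C s k) (t k)) \<longlonglongrightarrow> a * ip completion f g"
    using tendsto_mult_left[OF completion_ip_tendsto[OF st(1,3)], of a] cauchy_seq_in st by simp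
  then show "ip completion (a *\<^sub>C f) g = a * ip completion f g"
    using LIMSEQ_unique[OF completion_ip_tendsto[OF cauchy_seq_scale[OF st(1)] st(3)]]
    by (simp add: lim_fun_scale st)
next
  fix f g assume "f \<in> vecs completion" "g \<in> vecs completion"
  then obtain s t where st: "cauchy_seq s" "f = lim_fun s" "cauchy_seq t" "g = lim_fun t"
    unfolding completion_vecs by blast
  have "(\<lambda>k. cnj (ip H (s k) (t k))) \<longlonglongrightarrow> cnj (ip completion f g)"
    unfolding st by (intro tendsto_intros completion_ip_tendsto st)
  moreover have "cnj (ip H (s k) (t k)) = ip H (t k) (s k)" for k
    using ip_cnj[of "s k" "t k"] cauchy_seq_in st by simp
  ultimately show "ip completion g f = cnj (ip completion f g)"
    using LIMSEQ_unique[OF completion_ip_tendsto[OF st(3,1)]] st by simp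
next
  fix f assume "f \<in> vecs completion"
  then obtain s where s: "cauchy_seq s" "f = lim_fun s"
    unfolding completion_vecs by blast
  have "(\<lambda>k. Re (ip H (s k) (s k))) \<longlonglongrightarrow> Re (ip completion f f)"
    unfolding s by (intro tendsto_intros completion_ip_tendsto s)
  then show "0 \<le> Re (ip completion f f)"
    using ip_nonneg[OF cauchy_seq_in[OF s(1)]] by (simp add: LIMSEQ_le_const)
qed

text \<open>Definiteness: a norm-null sequence has limit functional 0 by Cauchy-Schwarz.
  Completeness is a diagonal argument: the k-th class is approximated within 1 / (k + 1) by a single
  vector \<open>p k\<close> of \<open>H\<close>, and the sequence \<open>p\<close> represents the
  limit.\<close>

lemma complex_hilbert_completion: "complex_hilbert completion"
proof -
  interpret C: semi_hilb completion by standard (rule semi_hilbert_completion)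
  have definite: "f = 0" if f: "f \<in> vecs completion" "hnorm completion f = 0" for f
  proof -
    obtain s where s: "cauchy_seq s" "f = lim_fun s"
      using f unfolding completion_vecs by blast
    have lim: "(\<lambda>k. hnorm H (s k)) \<longlonglongrightarrow> 0"
      using completion_hnorm_tendsto[OF s(1)] f s by simp
    have "lim_fun s = 0"
    proof (rule lim_fun_eqI[OF s(1)])
      fix q assume "q \<in> vecs H"
      then show "(\<lambda>k. ip H (s k) q) \<longlonglongrightarrow> 0 q"
        using ip_null_seq(1)[OF s(1) cauchy_seq_const lim] by simp
    qed simp
    then show ?thesis using s by simp
  qed
  have complete: "\<exists>f\<in>vecs completion. (\<lambda>k. hnorm completion (\<phi> k - f)) \<longlonglongrightarrow> 0"
    if \<phi>: "\<And>k. \<phi> k \<in> vecs completion"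
      and cauchy: "\<And>e. e > 0 \<Longrightarrow> \<exists>N. \<forall>i\<ge>N. \<forall>j\<ge>N. hnorm completion (\<phi> i - \<phi> j) < e"
    for \<phi> :: "nat \<Rightarrow> 'a \<Rightarrow> complex"
  proof -
    obtain s where s: "\<And>k. cauchy_seq (s k)" "\<And>k. \<phi> k = lim_fun (s k)"
      using \<phi> unfolding completion_vecs by metis
    have "\<exists>N. \<forall>j\<ge>N. hnorm H (s k j - s k N) < 1 / Suc k" for k
      using cauchy_seqD[OF s(1)[of k], of "1 / Suc k"] by (metis le_refl of_nat_0_less_iff zero_less_Suc zero_less_divide_1_iff)
    then obtain N where N: "\<And>k j. j \<ge> N k \<Longrightarrow> hnorm H (s k j - s k (N k)) < 1 / Suc k"
      by metis
    define p where "p k = s k (N k)" for k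
    have pH: "p k \<in> vecs H" for k using cauchy_seq_in[OF s(1)] by (simp add: p_def)
    define \<iota> where "\<iota> q = lim_fun (\<lambda>_. q)" for q
    have \<iota>: "\<iota> q \<in> vecs completion" if "q \<in> vecs H" for q
      using that by (simp add: \<iota>_def lim_fun_in cauchy_seq_const)
    have close: "hnorm completion (\<phi> k - \<iota> (p k)) \<le> 1 / Suc k" for k
    proof -
      have "(\<lambda>j. hnorm H (s k j - p k)) \<longlonglongrightarrow> hnorm completion (\<phi> k - \<iota> (p k))"
        unfolding s(2) \<iota>_def by (intro completion_dist_tendsto s cauchy_seq_const pH)
      then show ?thesis
        by (rule LIMSEQ_le_const2) (use N[of k] less_imp_le in \<open>auto simp: p_def intro!: exI[of _ "N k"]\<close>)
    qed
    have dist_p: "hnorm H (p i - p j) = hnorm completion (\<iota> (p i) - \<iota> (p j))" for i j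
      using completion_dist_tendsto[OF cauchy_seq_const[OF pH] cauchy_seq_const[OF pH], of i j]
      by (simp add: \<iota>_def LIMSEQ_const_iff)
    have "cauchy_seq p"
      unfolding cauchy_seq_def
    proof (intro conjI allI impI)
      fix e :: real assume "e > 0"
      obtain M where M: "\<And>i j. i \<ge> M \<Longrightarrow> j \<ge> M \<Longrightarrow> hnorm completion (\<phi> i - \<phi> j) < e / 3"
        using cauchy[of "e / 3"] \<open>e > 0\<close> by auto
      obtain K where K: "3 / e < real K" using reals_Archimedean2 by blast
      have small: "1 / Suc k < e / 3" if "k \<ge> K" for k
      proof -
        have "3 / e < real (Suc k)" using K that by linarith
        then show ?thesis using \<open>e > 0\<close> by (simp add: field_simps)
      qed
      have "hnorm H (p i - p j) < e" if "i \<ge> max M K" "j \<ge> max M K" for i j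
      proof -
        have "hnorm completion (\<iota> (p i) - \<iota> (p j)) \<le> hnorm completion (\<iota> (p i) - \<phi> i)
            + (hnorm completion (\<phi> i - \<phi> j) + hnorm completion (\<phi> j - \<iota> (p j)))"
          using C.hnorm_triangle_mid[of "\<iota> (p i)" "\<phi> i" "\<iota> (p j)"] C.hnorm_triangle_mid[of "\<phi> i" "\<phi> j" "\<iota> (p j)"]
            \<iota> pH \<phi> by force
        moreover have "hnorm completion (\<iota> (p i) - \<phi> i) = hnorm completion (\<phi> i - \<iota> (p i))"
          by (rule C.hnorm_diff_commute[OF \<iota>[OF pH] \<phi>])
        ultimately show ?thesis
          using close[of i] close[of j] small[of i] small[of j] M[of i j] that by (simp add: dist_p)
      qed
      then show "\<exists>N. \<forall>i\<ge>N. \<forall>j\<ge>N. hnorm H (p i - p j) < e" by blast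
    qed (rule pH)
    define f where "f = lim_fun p"
    have f: "f \<in> vecs completion" using \<open>cauchy_seq p\<close> by (simp add: f_def lim_fun_in)
    have "(\<lambda>k. hnorm completion (\<iota> (p k) - f)) \<longlonglongrightarrow> 0"
    proof (rule LIMSEQ_I)
      fix e :: real assume "e > 0"
      then obtain M where M: "\<And>i j. i \<ge> M \<Longrightarrow> j \<ge> M \<Longrightarrow> hnorm H (p i - p j) < e / 2"
        using cauchy_seqD[OF \<open>cauchy_seq p\<close>, of "e / 2"] by auto
      have "hnorm completion (\<iota> (p k) - f) \<le> e / 2" if "k \<ge> M" for k
      proof -
        have "(\<lambda>j. hnorm H (p k - p j)) \<longlonglongrightarrow> hnorm completion (\<iota> (p k) - f)"
          unfolding \<iota>_def f_def by (intro completion_dist_tendsto cauchy_seq_const pH \<open>cauchy_seq p\<close>)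
        then show ?thesis
          by (rule LIMSEQ_le_const2) (use M that less_imp_le in \<open>auto intro!: exI[of _ M]\<close>)
      qed
      then show "\<exists>no. \<forall>n\<ge>no. norm (hnorm completion (\<iota> (p n) - f) - 0) < e"
        using \<open>e > 0\<close> \<iota> pH f by (intro exI[of _ M]) force
    qed
    moreover have "(\<lambda>k. 1 / real (Suc k)) \<longlonglongrightarrow> 0"
      using LIMSEQ_inverse_real_of_nat by (simp add: inverse_eq_divide)
    ultimately have lim0: "(\<lambda>k. 1 / real (Suc k) + hnorm completion (\<iota> (p k) - f)) \<longlonglongrightarrow> 0"
      using tendsto_add[of "\<lambda>k. 1 / real (Suc k)" 0 sequentially "\<lambda>k. hnorm completion (\<iota> (p k) - f)" 0]
      by simp
    have "norm (hnorm completion (\<phi> k - f)) \<le> 1 / real (Suc k) + hnorm completion (\<iota> (p k) - f)" for k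
      using C.hnorm_triangle_mid[of "\<phi> k" "\<iota> (p k)" f] close[of k] \<phi>[of k] \<iota>[OF pH[of k]] f
      by simp
    then have "(\<lambda>k. hnorm completion (\<phi> k - f)) \<longlonglongrightarrow> 0"
      by (intro Lim_null_comparison[OF _ lim0]) simp
    then show ?thesis using f by blast
  qed
  show ?thesis
    by (rule complex_hilbertI[OF semi_hilbert_completion definite complete])
qed

text \<open>The last property is density of the image, in the form in which totality of a family is
  used later.\<close>

lemma completion_embedding:
  obtains \<iota> where "\<iota> \<in> bounded_ops H completion"
    "\<And>p q. p \<in> vecs H \<Longrightarrow> q \<in> vecs H \<Longrightarrow> ip completion (\<iota> p) (\<iota> q) = ip H p q"
    "\<And>f. f \<in> vecs completion \<Longrightarrow> (\<And>p. p \<in> vecs H \<Longrightarrow> ip completion f (\<iota> p) = 0) \<Longrightarrow> f = 0"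
proof -
  define \<iota> where "\<iota> q = lim_fun (\<lambda>_. q)" for q
  have ip: "ip completion (\<iota> p) (\<iota> q) = ip H p q" if "p \<in> vecs H" "q \<in> vecs H" for p q
    using completion_ip_tendsto[OF cauchy_seq_const[OF that(1)] cauchy_seq_const[OF that(2)]]
    by (simp add: \<iota>_def LIMSEQ_const_iff)
  have "\<iota> \<in> bounded_ops H completion"
  proof (rule bounded_opsI[where c = 1])
    show "\<iota> x \<in> vecs completion" if "x \<in> vecs H" for x
      using that by (simp add: \<iota>_def lim_fun_in cauchy_seq_const)
    show "\<iota> (x + y) = \<iota> x + \<iota> y" if "x \<in> vecs H" "y \<in> vecs H" for x y
      unfolding \<iota>_def using that by (intro lim_fun_add cauchy_seq_const)
    show "\<iota> (a *\<^sub>C x) = a *\<^sub>C \<iota> x" if "x \<in> vecs H" for a x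
      unfolding \<iota>_def using that by (intro lim_fun_scale cauchy_seq_const)
    show "hnorm completion (\<iota> x) \<le> 1 * hnorm H x" if "x \<in> vecs H" for x
      using ip[OF that that] by (simp add: hnorm_def)
  qed
  moreover have "f = 0" if f: "f \<in> vecs completion" and orth: "\<And>p. p \<in> vecs H \<Longrightarrow> ip completion f (\<iota> p) = 0" for f
  proof -
    obtain s where s: "cauchy_seq s" "f = lim_fun s"
      using f unfolding completion_vecs by blast
    have "lim_fun s = 0"
    proof (rule lim_fun_eqI[OF s(1)])
      fix q assume "q \<in> vecs H"
      then show "(\<lambda>k. ip H (s k) q) \<longlonglongrightarrow> 0 q"
        using completion_ip_tendsto[OF s(1) cauchy_seq_const[of q]] orth[of q] s by (simp add: \<iota>_def)
    qed simp
    then show ?thesis using s by simp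
  qed
  ultimately show thesis using that ip by blast
qed

end

section \<open>Kolmogorov decomposition of a positive kernel\<close>

lemma sum_fun_apply:
  fixes f :: "'i \<Rightarrow> 'b \<Rightarrow> 'c::comm_monoid_add"
  shows "sum f I x = (\<Sum>i\<in>I. f i x)"
  by (induction I rule: infinite_finite_induct) simp_all

text \<open>The finitely supported functions with the form \<open>gram_form L\<close> are a
  semi-inner product space in which the unit vectors have Gram matrix \<open>L\<close>; its
  completion is \<open>G\<close>. By the last property the \<gamma> j are total, so a vector is
  determined by its inner products with them.\<close>

lemma kolmogorov:
  fixes L :: "'j \<Rightarrow> 'j \<Rightarrow> complex"
  assumes psd: "psd J L" and herm: "\<And>i j. i \<in> J \<Longrightarrow> j \<in> J \<Longrightarrow> L j i = cnj (L i j)"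
  obtains G :: "(('j \<Rightarrow> complex) \<Rightarrow> complex) hilbert" and \<gamma>
  where "complex_hilbert G" "\<And>j. j \<in> J \<Longrightarrow> \<gamma> j \<in> vecs G"
    "\<And>i j. i \<in> J \<Longrightarrow> j \<in> J \<Longrightarrow> ip G (\<gamma> i) (\<gamma> j) = L i j"
    "\<And>f. f \<in> vecs G \<Longrightarrow> (\<And>j. j \<in> J \<Longrightarrow> ip G f (\<gamma> j) = 0) \<Longrightarrow> f = 0"
proof -
  define P where "P = \<lparr>vecs = fsupp J, ip = gram_form L\<rparr>"
  have [simp]: "vecs P = fsupp J" "ip P = gram_form L" by (simp_all add: P_def)
  have P: "semi_hilbert P"
    unfolding semi_hilbert_def
  proof (intro conjI ballI allI; simp only: \<open>vecs P = fsupp J\<close> \<open>ip P = gram_form L\<close>)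
    show "cvs.subspace (fsupp J)"
      by (rule cvs.subspaceI) (auto simp: fsupp_zero fsupp_add fsupp_mult[of _ J "\<lambda>_. _"] scaleC_fun_def)
  next
    fix c d e assume c: "c \<in> fsupp J" "d \<in> fsupp J" "e \<in> fsupp J"
    let ?I = "{j. c j \<noteq> 0} \<union> {j. d j \<noteq> 0} \<union> {j. e j \<noteq> 0}"
    have "finite ?I" using c by (simp add: fsupp_finite)
    then show "gram_form L (c + d) e = gram_form L c e + gram_form L d e"
      by (subst (1 2 3) gram_form_superset[of ?I]) (auto simp: distrib_right sum.distrib)
  next
    fix a c d assume c: "c \<in> fsupp J" "d \<in> fsupp J"
    let ?I = "{j. c j \<noteq> 0} \<union> {j. d j \<noteq> 0}"
    have "finite ?I" using c by (simp add: fsupp_finite)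
    then show "gram_form L (a *\<^sub>C c) d = a * gram_form L c d"
      by (subst (1 2) gram_form_superset[of ?I]) (auto simp: sum_distrib_left mult.assoc scaleC_fun_def)
  next
    fix c d assume c: "c \<in> fsupp J" "d \<in> fsupp J"
    have "cnj (gram_form L c d) = (\<Sum>i | c i \<noteq> 0. \<Sum>j | d j \<noteq> 0. d j * cnj (c i) * L j i)"
      unfolding gram_form_def cnj_sum
      by (intro sum.cong refl)
        (use herm[symmetric] fsupp_subset[OF c(1)] fsupp_subset[OF c(2)] in \<open>simp add: mult_ac\<close>)
    also have "\<dots> = gram_form L d c"
      unfolding gram_form_def by (subst sum.swap) simp
    finally show "gram_form L d c = cnj (gram_form L c d)" by simp
  next
    fix c assume "c \<in> fsupp J"
    then show "0 \<le> Re (gram_form L c c)" using psd by (simp add: psd_def)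
  qed
  interpret P: semi_hilb P by standard (rule P)
  interpret C: hilb P.completion by standard (rule P.complex_hilbert_completion)
  obtain \<iota> where \<iota>: "\<iota> \<in> bounded_ops P P.completion"
    "\<And>p q. p \<in> vecs P \<Longrightarrow> q \<in> vecs P \<Longrightarrow> ip P.completion (\<iota> p) (\<iota> q) = ip P p q"
    "\<And>f. f \<in> vecs P.completion \<Longrightarrow> (\<And>p. p \<in> vecs P \<Longrightarrow> ip P.completion f (\<iota> p) = 0) \<Longrightarrow> f = 0"
    using P.completion_embedding by blast
  define \<delta> :: "'j \<Rightarrow> 'j \<Rightarrow> complex" where "\<delta> j = (\<lambda>i. if i = j then 1 else 0)" for j
  have \<delta>: "\<delta> j \<in> vecs P" if "j \<in> J" for j
    using fsupp_single[OF that, of 1] by (simp add: \<delta>_def)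
  show thesis
  proof (rule that[of P.completion "\<lambda>j. \<iota> (\<delta> j)"])
    show "complex_hilbert P.completion" by (rule P.complex_hilbert_completion)
    show "\<iota> (\<delta> j) \<in> vecs P.completion" if "j \<in> J" for j
      using bounded_opsD(1)[OF \<iota>(1) \<delta>[OF that]] .
    show "ip P.completion (\<iota> (\<delta> i)) (\<iota> (\<delta> j)) = L i j" if "i \<in> J" "j \<in> J" for i j
    proof -
      have "gram_form L (\<delta> i) (\<delta> j) = L i j"
        by (simp add: gram_form_def \<delta>_def)
      then show ?thesis using \<iota>(2)[OF \<delta>[OF that(1)] \<delta>[OF that(2)]] by simp
    qed
    fix f assume f: "f \<in> vecs P.completion" and orth: "\<And>j. j \<in> J \<Longrightarrow> ip P.completion f (\<iota> (\<delta> j)) = 0"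
    show "f = 0"
    proof (rule \<iota>(3)[OF f])
      fix c assume "c \<in> vecs P"
      then have c: "c \<in> fsupp J" by simp
      have c_eq: "c = (\<Sum>j | c j \<noteq> 0. c j *\<^sub>C \<delta> j)"
      proof
        fix i
        have "(\<Sum>j | c j \<noteq> 0. c j *\<^sub>C \<delta> j) i = (\<Sum>j | c j \<noteq> 0. if i = j then c j else 0)"
          by (simp add: sum_fun_apply scaleC_fun_def \<delta>_def if_distrib cong: if_cong)
        then show "c i = (\<Sum>j | c j \<noteq> 0. c j *\<^sub>C \<delta> j) i"
          using fsupp_finite[OF c] by simp
      qed
      have in_P: "c j *\<^sub>C \<delta> j \<in> vecs P" if "c j \<noteq> 0" for j
        using \<delta>[OF fsupp_subset[OF c that]] by (rule P.scale_in)
      have "\<iota> c = (\<Sum>j | c j \<noteq> 0. \<iota> (c j *\<^sub>C \<delta> j))"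
        by (subst c_eq, rule bounded_ops_sum[OF \<iota>(1) P.semi_hilb_axioms]) (use in_P in auto)
      then have "ip P.completion f (\<iota> c) = (\<Sum>j | c j \<noteq> 0. ip P.completion f (\<iota> (c j *\<^sub>C \<delta> j)))"
        by (simp only:) (rule C.ip_sum_right[OF f], use in_P bounded_opsD(1)[OF \<iota>(1)] in blast)
      also have "\<dots> = 0"
      proof (intro sum.neutral ballI)
        fix j assume "j \<in> {j. c j \<noteq> 0}"
        then have j: "j \<in> J" using fsupp_subset[OF c] by simp
        show "ip P.completion f (\<iota> (c j *\<^sub>C \<delta> j)) = 0"
          unfolding bounded_opsD(3)[OF \<iota>(1) \<delta>[OF j]]
          using f orth[OF j] bounded_opsD(1)[OF \<iota>(1) \<delta>[OF j]] by (simp add: C.ip_scale_right)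
      qed
      finally show "ip P.completion f (\<iota> c) = 0" .
    qed
  qed
qed

section \<open>Positivity under multiplication by the kernel of exponent 1\<close>

lemma cmod_cdot_le: "cmod (cdot z w) \<le> norm z * norm w"
proof -
  have "cmod (cdot z w) \<le> (\<Sum>i\<in>UNIV. \<bar>norm (z $ i)\<bar> * \<bar>norm (w $ i)\<bar>)"
    unfolding cdot_def by (rule order_trans[OF norm_sum]) (simp add: norm_mult)
  also have "\<dots> \<le> norm z * norm w"
    unfolding norm_vec_def by (rule L2_set_mult_ineq)
  finally show ?thesis .
qed

lemma cmod_cdot_less_1:
  assumes "z \<in> unit_ball" "w \<in> unit_ball"
  shows "cmod (cdot z w) < 1"
proof -
  have "norm z * norm w < 1 * 1"
    using assms by (intro mult_strict_mono') auto
  then show ?thesis using cmod_cdot_le[of z w] by simp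
qed

text \<open>Geometric series: multiplication by <w_j, w_i> is a sum over coordinates of congruences,
  hence preserves positivity, and so do its iterates, their sums and the limit. The points stand in
  the order j, i because the inner product of the kernel functions at w_i and w_j is the kernel at
  (w_j, w_i).\<close>

lemma psd_szego_product:
  assumes psd: "psd J L" and w: "\<And>j. j \<in> J \<Longrightarrow> w j \<in> unit_ball"
  shows "psd J (\<lambda>i j. L i j / (1 - cdot (w j) (w i)))"
proof -
  have step: "psd J (\<lambda>i j. cdot (w j) (w i) * M i j)" if "psd J M" for M
  proof -
    have "psd J (\<lambda>i j. \<Sum>l\<in>UNIV. cnj (w i $ l) * cnj (cnj (w j $ l)) * M i j)"
      by (intro psd_sum psd_congruence that)
    then show ?thesis
      by (rule psd_cong) (simp add: cdot_def sum_distrib_left mult_ac)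
  qed
  have pow: "psd J (\<lambda>i j. cdot (w j) (w i) ^ n * L i j)" for n
  proof (induction n)
    case (Suc n)
    from step[OF this] show ?case by (simp add: mult_ac)
  qed (simp add: psd)
  show ?thesis
  proof (rule psd_limit)
    show "psd J (\<lambda>i j. \<Sum>k<n. cdot (w j) (w i) ^ k * L i j)" for n
      by (intro psd_sum pow)
    fix i j assume "i \<in> J" "j \<in> J"
    then have "(\<lambda>k. cdot (w j) (w i) ^ k) sums (1 / (1 - cdot (w j) (w i)))"
      by (intro geometric_sums cmod_cdot_less_1 w)
    then have "(\<lambda>k. cdot (w j) (w i) ^ k * L i j) sums (1 / (1 - cdot (w j) (w i)) * L i j)"
      by (rule sums_mult2)
    then show "(\<lambda>n. \<Sum>k<n. cdot (w j) (w i) ^ k * L i j) \<longlonglongrightarrow> L i j / (1 - cdot (w j) (w i))"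
      by (simp add: sums_def)
  qed
qed

section \<open>Direct sums\<close>

instantiation prod :: (complex_vector, complex_vector) complex_vector
begin

definition scaleC_prod_def: "a *\<^sub>C p = (a *\<^sub>C fst p, a *\<^sub>C snd p)"

instance
  by standard (simp_all add: scaleC_prod_def prod_eq_iff scaleC_add_right scaleC_add_left
      scaleC_scaleC scaleC_one)

end

lemma fst_scaleC [simp]: "fst (a *\<^sub>C p) = a *\<^sub>C fst p"
  and snd_scaleC [simp]: "snd (a *\<^sub>C p) = a *\<^sub>C snd p"
  by (simp_all add: scaleC_prod_def)

definition hsum :: "'a hilbert \<Rightarrow> 'b hilbert \<Rightarrow> ('a \<times> 'b) hilbert" where
  "hsum H K = \<lparr>vecs = vecs H \<times> vecs K, ip = \<lambda>p q. ip H (fst p) (fst q) + ip K (snd p) (snd q)\<rparr>"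

definition hpow :: "'a hilbert \<Rightarrow> ('n::finite \<Rightarrow> 'a) hilbert" where
  "hpow H = \<lparr>vecs = {f. \<forall>i. f i \<in> vecs H}, ip = \<lambda>f g. \<Sum>i\<in>UNIV. ip H (f i) (g i)\<rparr>"

lemma vecs_hsum [simp]: "p \<in> vecs (hsum H K) \<longleftrightarrow> fst p \<in> vecs H \<and> snd p \<in> vecs K"
  by (cases p) (simp add: hsum_def)

lemma ip_hsum [simp]: "ip (hsum H K) p q = ip H (fst p) (fst q) + ip K (snd p) (snd q)"
  by (simp add: hsum_def)

lemma vecs_hpow [simp]: "f \<in> vecs (hpow H) \<longleftrightarrow> (\<forall>i. f i \<in> vecs H)"
  by (simp add: hpow_def)

lemma ip_hpow [simp]: "ip (hpow H) f g = (\<Sum>i\<in>UNIV. ip H (f i) (g i))"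
  by (simp add: hpow_def)

lemma hnorm_hsum:
  assumes "semi_hilb H" "semi_hilb K" "fst p \<in> vecs H" "snd p \<in> vecs K"
  shows "hnorm (hsum H K) p = sqrt ((hnorm H (fst p))\<^sup>2 + (hnorm K (snd p))\<^sup>2)"
  using assms semi_hilb.hnorm_sq[of H] semi_hilb.hnorm_sq[of K] by (simp add: hnorm_def[of "hsum H K"])

lemma hnorm_hpow:
  assumes "semi_hilb H" "\<And>i. f i \<in> vecs H"
  shows "hnorm (hpow H) f = L2_set (\<lambda>i. hnorm H (f i)) UNIV"
  using assms semi_hilb.hnorm_sq[of H] by (simp add: hnorm_def[of "hpow H"] L2_set_def)

lemma hnorm_hsum_ge:
  assumes "semi_hilb H" "semi_hilb K" "fst p \<in> vecs H" "snd p \<in> vecs K"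
  shows "hnorm H (fst p) \<le> hnorm (hsum H K) p" "hnorm K (snd p) \<le> hnorm (hsum H K) p"
  unfolding hnorm_hsum[OF assms] by (auto intro!: real_le_rsqrt)

lemma hnorm_hpow_ge:
  assumes "semi_hilb H" "\<And>i. f i \<in> vecs H"
  shows "hnorm H (f i) \<le> hnorm (hpow H) f"
  unfolding hnorm_hpow[OF assms] by (rule member_le_L2_set) (auto simp: assms semi_hilb.hnorm_nonneg)

lemma hilb_hsum:
  assumes "hilb H" "hilb K"
  shows "hilb (hsum H K)"
proof -
  interpret H: hilb H by fact
  interpret K: hilb K by fact
  show ?thesis
  proof (rule hilb.intro, rule complex_hilbertI)
    show "semi_hilbert (hsum H K)"
      unfolding semi_hilbert_def
    proof (intro conjI ballI allI)
      show "cvs.subspace (vecs (hsum H K))"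
        by (rule cvs.subspaceI) auto
      show "ip (hsum H K) q p = cnj (ip (hsum H K) p q)"
        if "p \<in> vecs (hsum H K)" "q \<in> vecs (hsum H K)" for p q
        using that H.ip_cnj[of "fst p" "fst q"] K.ip_cnj[of "snd p" "snd q"] by simp
    qed (auto simp: distrib_left H.ip_nonneg K.ip_nonneg)
  next
    fix p :: "'a \<times> 'b" assume p: "p \<in> vecs (hsum H K)" "hnorm (hsum H K) p = 0"
    then have "(hnorm H (fst p))\<^sup>2 + (hnorm K (snd p))\<^sup>2 = 0"
      by (simp add: hnorm_hsum[OF H.semi_hilb_axioms K.semi_hilb_axioms])
    then show "p = 0"
      using p by (simp add: sum_power2_eq_zero_iff prod_eq_iff)
  next
    fix s :: "nat \<Rightarrow> 'a \<times> 'b"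
    assume s: "\<And>k. s k \<in> vecs (hsum H K)"
      and cauchy: "\<And>e. e > 0 \<Longrightarrow> \<exists>N. \<forall>i\<ge>N. \<forall>j\<ge>N. hnorm (hsum H K) (s i - s j) < e"
    have sH: "fst (s k) \<in> vecs H" and sK: "snd (s k) \<in> vecs K" for k using s[of k] by auto
    have norm_eq: "hnorm (hsum H K) (s i - p) =
        sqrt ((hnorm H (fst (s i) - fst p))\<^sup>2 + (hnorm K (snd (s i) - snd p))\<^sup>2)"
      if "fst p \<in> vecs H" "snd p \<in> vecs K" for i p
      using that sH sK hnorm_hsum[OF H.semi_hilb_axioms K.semi_hilb_axioms, of "s i - p"] by simp
    have le: "hnorm H (fst (s i) - fst (s j)) \<le> hnorm (hsum H K) (s i - s j)"
      "hnorm K (snd (s i) - snd (s j)) \<le> hnorm (hsum H K) (s i - s j)" for i j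
      using hnorm_hsum_ge[OF H.semi_hilb_axioms K.semi_hilb_axioms, of "s i - s j"] sH sK by auto
    obtain x where x: "x \<in> vecs H" "(\<lambda>k. hnorm H (fst (s k) - x)) \<longlonglongrightarrow> 0"
      by (rule H.complete[of "\<lambda>k. fst (s k)"]) (use sH cauchy le in \<open>meson le_less_trans\<close>)+
    obtain y where y: "y \<in> vecs K" "(\<lambda>k. hnorm K (snd (s k) - y)) \<longlonglongrightarrow> 0"
      by (rule K.complete[of "\<lambda>k. snd (s k)"]) (use sK cauchy le in \<open>meson le_less_trans\<close>)+
    have "(\<lambda>k. sqrt ((hnorm H (fst (s k) - x))\<^sup>2 + (hnorm K (snd (s k) - y))\<^sup>2)) \<longlonglongrightarrow> sqrt (0\<^sup>2 + 0\<^sup>2)"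
      by (intro tendsto_intros x y)
    then show "\<exists>p\<in>vecs (hsum H K). (\<lambda>k. hnorm (hsum H K) (s k - p)) \<longlonglongrightarrow> 0"
      using x y norm_eq[of "(x, y)"] by (intro bexI[of _ "(x, y)"]) auto
  qed
qed

lemma hilb_hpow:
  assumes "hilb H"
  shows "hilb (hpow H :: ('n::finite \<Rightarrow> _) hilbert)"
proof -
  interpret H: hilb H by fact
  show ?thesis
  proof (rule hilb.intro, rule complex_hilbertI)
    show "semi_hilbert (hpow H :: ('n \<Rightarrow> _) hilbert)"
      unfolding semi_hilbert_def
    proof (intro conjI ballI allI)
      show "cvs.subspace (vecs (hpow H :: ('n \<Rightarrow> _) hilbert))"
        by (rule cvs.subspaceI) (auto simp: scaleC_fun_def)
      show "ip (hpow H) g f = cnj (ip (hpow H) f g)"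
        if "f \<in> vecs (hpow H)" "g \<in> vecs (hpow H)" for f g :: "'n \<Rightarrow> 'a"
        using that unfolding ip_hpow cnj_sum by (intro sum.cong refl H.ip_cnj) auto
    qed (auto simp: sum.distrib sum_distrib_left scaleC_fun_def intro!: sum_nonneg H.ip_nonneg)
  next
    fix f :: "'n \<Rightarrow> 'a" assume f: "f \<in> vecs (hpow H)" "hnorm (hpow H) f = 0"
    then show "f = 0"
      using hnorm_hpow[OF H.semi_hilb_axioms, of f] L2_set_eq_0_iff[of UNIV "\<lambda>i. hnorm H (f i)"]
      by (simp add: fun_eq_iff)
  next
    fix s :: "nat \<Rightarrow> 'n \<Rightarrow> 'a"
    assume s: "\<And>k. s k \<in> vecs (hpow H)"
      and cauchy: "\<And>e. e > 0 \<Longrightarrow> \<exists>N. \<forall>i\<ge>N. \<forall>j\<ge>N. hnorm (hpow H) (s i - s j) < e"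
    have sH: "s k i \<in> vecs H" for k i using s[of k] by simp
    have norm_eq: "hnorm (hpow H) (s k - f) = L2_set (\<lambda>i. hnorm H (s k i - f i)) UNIV"
      if "\<And>i. f i \<in> vecs H" for k f
      using that sH hnorm_hpow[OF H.semi_hilb_axioms, of "s k - f"] by simp
    have le: "hnorm H (s k i - s l i) \<le> hnorm (hpow H) (s k - s l)" for k l i
      using hnorm_hpow_ge[OF H.semi_hilb_axioms, of "s k - s l" i] sH by simp
    have "\<exists>x. x \<in> vecs H \<and> (\<lambda>k. hnorm H (s k i - x)) \<longlonglongrightarrow> 0" for i
    proof -
      obtain x where "x \<in> vecs H" "(\<lambda>k. hnorm H (s k i - x)) \<longlonglongrightarrow> 0"
        by (rule H.complete[of "\<lambda>k. s k i"]) (use sH cauchy le in \<open>meson le_less_trans\<close>)+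
      then show ?thesis by blast
    qed
    then obtain f where f: "\<And>i. f i \<in> vecs H" "\<And>i. (\<lambda>k. hnorm H (s k i - f i)) \<longlonglongrightarrow> 0"
      by metis
    have "(\<lambda>k. L2_set (\<lambda>i. hnorm H (s k i - f i)) UNIV) \<longlonglongrightarrow> L2_set (\<lambda>i::'n. 0) UNIV"
      unfolding L2_set_def by (intro tendsto_intros f)
    then show "\<exists>f\<in>vecs (hpow H). (\<lambda>k. hnorm (hpow H) (s k - f)) \<longlonglongrightarrow> 0"
      using f norm_eq[of f] by (intro bexI[of _ f]) (auto simp: L2_set_def)
  qed
qed

section \<open>Contractions and their adjoints\<close>

lemma hadj_eqI:
  assumes H: "hilb H" and K: "semi_hilb K" and T: "T \<in> bounded_ops H K" and y: "y \<in> vecs K"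
    and x: "x \<in> vecs H" "\<And>u. u \<in> vecs H \<Longrightarrow> ip K (T u) y = ip H u x"
  shows "hadj H K T y = x"
proof -
  interpret H: hilb H by fact
  have "ip H u (hadj H K T y) = ip H u x" if "u \<in> vecs H" for u
    using ip_hadj[OF H K T y that] x that by simp
  then show ?thesis
    using hadj_in[OF H K T y] x(1) H.ip_cnj by (intro H.vec_eqI) metis+
qed

lemma hadj_contraction_bounded_ops:
  assumes H: "hilb H" and K: "semi_hilb K" and T: "T \<in> bounded_ops H K"
    and contr: "\<And>x. x \<in> vecs H \<Longrightarrow> hnorm K (T x) \<le> hnorm H x"
  shows "hadj H K T \<in> bounded_ops K H"
  by (rule bounded_opsI[where c = 1])
    (use hadj_in[OF H K T] bounded_ops_hadj[OF H K T] hadj_contraction[OF H K T _ contr] in auto)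

lemma bounded_ops_lin_comb:
  assumes T: "T \<in> bounded_ops H K" and H: "semi_hilb H" and c: "c \<in> fsupp J"
    and a: "\<And>j. j \<in> J \<Longrightarrow> a j \<in> vecs H"
  shows "T (lin_comb a c) = lin_comb (\<lambda>j. T (a j)) c"
proof -
  have "T (lin_comb a c) = (\<Sum>j | c j \<noteq> 0. T (c j *\<^sub>C a j))"
    unfolding lin_comb_def
    by (rule bounded_ops_sum[OF T H]) (use a fsupp_subset[OF c] semi_hilb.scale_in[OF H] in blast)
  also have "\<dots> = lin_comb (\<lambda>j. T (a j)) c"
    unfolding lin_comb_def
    by (intro sum.cong refl bounded_opsD(3)[OF T]) (use a fsupp_subset[OF c] in blast)
  finally show ?thesis .
qed

text \<open>This is I - T T^* \<ge> 0 tested on finite combinations of the \<open>a j\<close>. It is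
  the converse of \<open>contraction_from_gram\<close>, the \<open>b j\<close> of that lemma being
  T^* a_j.\<close>

lemma psd_contraction:
  assumes H: "hilb H" and K: "semi_hilb K" and T: "T \<in> bounded_ops H K"
    and contr: "\<And>x. x \<in> vecs H \<Longrightarrow> hnorm K (T x) \<le> hnorm H x"
    and a: "\<And>j. j \<in> J \<Longrightarrow> a j \<in> vecs K"
  shows "psd J (\<lambda>i j. ip K (a i) (a j) - ip H (hadj H K T (a i)) (hadj H K T (a j)))"
  unfolding psd_def gram_form_diff
proof
  interpret H: hilb H by fact
  interpret K: semi_hilb K by fact
  let ?b = "\<lambda>j. hadj H K T (a j)"
  fix c assume c: "c \<in> fsupp J"
  note adj = hadj_contraction_bounded_ops[OF H K T contr]
  have b: "?b j \<in> vecs H" if "j \<in> J" for j using bounded_opsD(1)[OF adj a[OF that]] .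
  have y: "lin_comb a c \<in> vecs K" using a c by (rule K.lin_comb_in[rotated])
  have "hnorm H (lin_comb ?b c) \<le> hnorm K (lin_comb a c)"
    using hadj_contraction[OF H K T y contr] bounded_ops_lin_comb[OF adj K c a] by simp
  then have "(hnorm H (lin_comb ?b c))\<^sup>2 \<le> (hnorm K (lin_comb a c))\<^sup>2"
    using H.lin_comb_in[OF c b] by (intro power_mono) auto
  then show "0 \<le> Re (gram_form (\<lambda>i j. ip K (a i) (a j)) c c - gram_form (\<lambda>i j. ip H (?b i) (?b j)) c c)"
    using H.ip_lin_comb[OF c c b b] K.ip_lin_comb[OF c c a a] H.lin_comb_in[OF c b] y
    by (simp add: H.hnorm_sq K.hnorm_sq)
qed

section \<open>Algebra of bounded operators and row operators\<close>

lemma bounded_ops_compose: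
  assumes T: "T \<in> bounded_ops H K" and S: "S \<in> bounded_ops K L" and K: "semi_hilb H" "semi_hilb K"
  shows "(\<lambda>x. S (T x)) \<in> bounded_ops H L"
proof -
  obtain c where c: "c \<ge> 0" "\<And>x. x \<in> vecs H \<Longrightarrow> hnorm K (T x) \<le> c * hnorm H x"
    using bounded_ops_bound[OF T K(1)] by blast
  obtain d where d: "d \<ge> 0" "\<And>x. x \<in> vecs K \<Longrightarrow> hnorm L (S x) \<le> d * hnorm K x"
    using bounded_ops_bound[OF S K(2)] by blast
  show ?thesis
  proof (rule bounded_opsI[where c = "d * c"])
    fix x assume x: "x \<in> vecs H"
    show "hnorm L (S (T x)) \<le> d * c * hnorm H x"
      using d(2)[OF bounded_opsD(1)[OF T x]] mult_left_mono[OF c(2)[OF x] d(1)] by (simp add: mult.assoc)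
  qed (use bounded_opsD[OF T] bounded_opsD[OF S] in auto)
qed

lemma bounded_ops_add:
  assumes T: "T \<in> bounded_ops H K" and S: "S \<in> bounded_ops H K" and K: "semi_hilb H" "semi_hilb K"
  shows "(\<lambda>x. T x + S x) \<in> bounded_ops H K"
proof -
  interpret K: semi_hilb K by fact
  obtain c where c: "\<And>x. x \<in> vecs H \<Longrightarrow> hnorm K (T x) \<le> c * hnorm H x"
    using bounded_ops_bound[OF T K(1)] by blast
  obtain d where d: "\<And>x. x \<in> vecs H \<Longrightarrow> hnorm K (S x) \<le> d * hnorm H x"
    using bounded_ops_bound[OF S K(1)] by blast
  note in_K = bounded_opsD(1)[OF T] bounded_opsD(1)[OF S]
  show ?thesis
  proof (rule bounded_opsI[where c = "c + d"])
    fix x assume x: "x \<in> vecs H"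
    show "hnorm K (T x + S x) \<le> (c + d) * hnorm H x"
      using K.hnorm_triangle[OF in_K(1)[OF x] in_K(2)[OF x]] c[OF x] d[OF x] by (simp add: distrib_right)
  qed (use in_K bounded_opsD(2,3)[OF T] bounded_opsD(2,3)[OF S] in \<open>auto simp: scaleC_add_right\<close>)
qed

lemma bounded_ops_scale:
  assumes T: "T \<in> bounded_ops H K" and K: "semi_hilb H" "semi_hilb K"
  shows "(\<lambda>x. a *\<^sub>C T x) \<in> bounded_ops H K"
proof -
  interpret K: semi_hilb K by fact
  obtain c where c: "\<And>x. x \<in> vecs H \<Longrightarrow> hnorm K (T x) \<le> c * hnorm H x"
    using bounded_ops_bound[OF T K(1)] by blast
  show ?thesis
  proof (rule bounded_opsI[where c = "cmod a * c"])
    fix x assume x: "x \<in> vecs H"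
    show "hnorm K (a *\<^sub>C T x) \<le> cmod a * c * hnorm H x"
      using mult_left_mono[OF c[OF x], of "cmod a"] bounded_opsD(1)[OF T x] by (simp add: mult.assoc)
  qed (use bounded_opsD[OF T] in \<open>auto simp: scaleC_add_right scaleC_scaleC mult.commute\<close>)
qed

lemma bounded_ops_0: "semi_hilb H \<Longrightarrow> semi_hilb K \<Longrightarrow> (\<lambda>x. 0) \<in> bounded_ops H K"
  by (rule bounded_opsI[where c = 0]) (auto intro: semi_hilb.zero_in simp: semi_hilb.hnorm_zero)

lemma bounded_ops_sum_fun:
  assumes "semi_hilb H" "semi_hilb K" "\<And>i. i \<in> I \<Longrightarrow> T i \<in> bounded_ops H K"
  shows "(\<lambda>x. \<Sum>i\<in>I. T i x) \<in> bounded_ops H K"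
  using assms(3)
proof (induction I rule: infinite_finite_induct)
  case (insert i I)
  then show ?case
    using bounded_ops_add[of "T i" H K "\<lambda>x. \<Sum>i\<in>I. T i x"] assms(1,2) by simp
qed (use bounded_ops_0 assms in auto)

lemma bounded_ops_id: "semi_hilb H \<Longrightarrow> (\<lambda>x. x) \<in> bounded_ops H H"
  by (rule bounded_opsI[where c = 1]) auto

lemma direct_sum_bounded_ops:
  assumes "semi_hilb H" "semi_hilb K"
  shows "(\<lambda>x. (x, 0)) \<in> bounded_ops H (hsum H K)" "(\<lambda>y. (0, y)) \<in> bounded_ops K (hsum H K)"
    and "fst \<in> bounded_ops (hsum H K) H" "snd \<in> bounded_ops (hsum H K) K"
    and "(\<lambda>f. f i) \<in> bounded_ops (hpow H) H"
proof -
  interpret H: semi_hilb H by fact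
  interpret K: semi_hilb K by fact
  show "(\<lambda>x. (x, 0)) \<in> bounded_ops H (hsum H K)" "(\<lambda>y. (0, y)) \<in> bounded_ops K (hsum H K)"
    "fst \<in> bounded_ops (hsum H K) H" "snd \<in> bounded_ops (hsum H K) K"
    "(\<lambda>f. f i) \<in> bounded_ops (hpow H) H"
    by (rule bounded_opsI[where c = 1];
        simp add: scaleC_prod_def scaleC_fun_def hnorm_hsum[OF assms] hnorm_hsum_ge[OF assms]
          hnorm_hpow_ge[OF assms(1)])+
qed

text \<open>The operator z D of the overview: the row z applied to the column of the operators
  \<open>D i\<close>.\<close>

definition row_op :: "('n::finite \<Rightarrow> 'a \<Rightarrow> 'b::complex_vector) \<Rightarrow> complex ^ 'n \<Rightarrow> 'a \<Rightarrow> 'b" where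
  "row_op D z x = (\<Sum>i\<in>UNIV. z $ i *\<^sub>C D i x)"

lemma row_op_bounded_ops:
  assumes "semi_hilb H" "semi_hilb K" "\<And>i. D i \<in> bounded_ops H K"
  shows "row_op D z \<in> bounded_ops H K"
  unfolding row_op_def[abs_def] by (intro bounded_ops_sum_fun bounded_ops_scale assms)

text \<open>Cauchy-Schwarz over the coordinates. The constant 1 matters: it is what makes z D a
  strict contraction at every point of the open ball.\<close>

lemma hnorm_row_le:
  assumes "semi_hilb K" "\<And>i. f i \<in> vecs K"
  shows "hnorm K (\<Sum>i\<in>UNIV. z $ i *\<^sub>C f i) \<le> norm z * hnorm (hpow K) f"
proof -
  interpret K: semi_hilb K by fact
  have "hnorm K (\<Sum>i\<in>UNIV. z $ i *\<^sub>C f i) \<le> (\<Sum>i\<in>UNIV. \<bar>norm (z $ i)\<bar> * \<bar>hnorm K (f i)\<bar>)"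
    using assms(2) by (intro order_trans[OF K.hnorm_sum_le]) auto
  also have "\<dots> \<le> norm z * hnorm (hpow K) f"
    unfolding norm_vec_def hnorm_hpow[OF assms] by (rule L2_set_mult_ineq)
  finally show ?thesis .
qed

text \<open>A crude constant, the sum of bounds of the \<open>D i\<close>; it serves the derivative
  estimates.\<close>

lemma row_op_bound:
  assumes "semi_hilb H" "semi_hilb K" "\<And>i. D i \<in> bounded_ops H K"
  obtains d where "d \<ge> 0" "\<And>z x. x \<in> vecs H \<Longrightarrow> hnorm K (row_op D z x) \<le> d * norm z * hnorm H x"
proof -
  interpret H: semi_hilb H by fact
  interpret K: semi_hilb K by fact
  have "\<exists>c. c \<ge> 0 \<and> (\<forall>x\<in>vecs H. hnorm K (D i x) \<le> c * hnorm H x)" for i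
    using bounded_ops_bound[OF assms(3) assms(1), of i] by metis
  then obtain c where c: "\<And>i. c i \<ge> 0" "\<And>i x. x \<in> vecs H \<Longrightarrow> hnorm K (D i x) \<le> c i * hnorm H x"
    by metis
  show thesis
  proof (rule that[of "sum c UNIV"])
    show "sum c UNIV \<ge> 0" using c(1) by (simp add: sum_nonneg)
    fix z x assume x: "x \<in> vecs H"
    have Dx: "D i x \<in> vecs K" for i using bounded_opsD(1)[OF assms(3) x] .
    have "hnorm K (row_op D z x) \<le> norm z * L2_set (\<lambda>i. hnorm K (D i x)) UNIV"
      unfolding row_op_def using hnorm_row_le[OF assms(2), of "\<lambda>i. D i x" z] hnorm_hpow[OF assms(2), of "\<lambda>i. D i x"] Dx
      by simp
    also have "\<dots> \<le> norm z * (\<Sum>i\<in>UNIV. hnorm K (D i x))"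
      using Dx by (intro mult_left_mono L2_set_le_sum) auto
    also have "\<dots> \<le> norm z * (\<Sum>i\<in>UNIV. c i * hnorm H x)"
      by (intro mult_left_mono sum_mono c(2) x) simp
    finally show "hnorm K (row_op D z x) \<le> sum c UNIV * norm z * hnorm H x"
      by (simp add: sum_distrib_left mult_ac)
  qed
qed

section \<open>Holomorphy with quadratic remainder\<close>

text \<open>Differentiability with a quadratic remainder, stated vector by vector with a uniform
  constant. In this form the estimates compose by plain inequalities, and the infimum
  \<open>op_norm\<close> enters only at the passage to \<open>holomorphic_op\<close>.\<close>

definition qdiff_at ::
    "'a::complex_vector hilbert \<Rightarrow> 'b::complex_vector hilbert \<Rightarrow> (complex ^ 'n \<Rightarrow> 'a \<Rightarrow> 'b) \<Rightarrow>
     complex ^ 'n \<Rightarrow> ('n \<Rightarrow> 'a \<Rightarrow> 'b) \<Rightarrow> real \<Rightarrow> real \<Rightarrow> bool" where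
  "qdiff_at E F \<Phi> z D c r \<longleftrightarrow> (\<forall>i. D i \<in> bounded_ops E F) \<and> 0 \<le> c \<and> 0 < r \<and>
     (\<forall>h x. norm h < r \<longrightarrow> x \<in> vecs E \<longrightarrow> z + h \<in> unit_ball \<longrightarrow>
        hnorm F (\<Phi> (z + h) x - \<Phi> z x - row_op D h x) \<le> c * (norm h)\<^sup>2 * hnorm E x)"

definition qdiff ::
    "'a::complex_vector hilbert \<Rightarrow> 'b::complex_vector hilbert \<Rightarrow> (complex ^ 'n \<Rightarrow> 'a \<Rightarrow> 'b) \<Rightarrow> bool" where
  "qdiff E F \<Phi> \<longleftrightarrow>
     (\<forall>z\<in>unit_ball. \<Phi> z \<in> bounded_ops E F \<and> (\<exists>D c r. qdiff_at E F \<Phi> z D c r))"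

lemma qdiff_bounded_ops: "qdiff E F \<Phi> \<Longrightarrow> z \<in> unit_ball \<Longrightarrow> \<Phi> z \<in> bounded_ops E F"
  by (simp add: qdiff_def)

lemma qdiff_atD:
  assumes "qdiff_at E F \<Phi> z D c r"
  shows "D i \<in> bounded_ops E F" "0 \<le> c" "0 < r"
    and "norm h < r \<Longrightarrow> x \<in> vecs E \<Longrightarrow> z + h \<in> unit_ball \<Longrightarrow>
      hnorm F (\<Phi> (z + h) x - \<Phi> z x - row_op D h x) \<le> c * (norm h)\<^sup>2 * hnorm E x"
  using assms by (simp_all add: qdiff_at_def)

lemma qdiffD:
  fixes \<Phi> :: "complex ^ 'n \<Rightarrow> 'a::complex_vector \<Rightarrow> 'b::complex_vector"
  assumes "qdiff E F \<Phi>" "z \<in> unit_ball"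
  obtains D c r where "qdiff_at E F \<Phi> z D c r" "r \<le> 1" "\<And>h. norm h < r \<Longrightarrow> z + h \<in> unit_ball"
proof -
  obtain D c r where D: "qdiff_at E F \<Phi> z D c r"
    using assms unfolding qdiff_def by blast
  \<comment> \<open>The radius is cut to 1 - |z| so that z + h stays in the ball. It is then at most
    1, which \<open>qdiff_compose\<close> uses to absorb higher powers of |h|.\<close>
  show thesis
  proof (rule that[of D c "min r (1 - norm z)"])
    show "qdiff_at E F \<Phi> z D c (min r (1 - norm z))"
      using D assms(2) by (auto simp: qdiff_at_def)
    show "z + h \<in> unit_ball" if "norm h < min r (1 - norm z)" for h
      using that norm_triangle_ineq[of z h] by simp
  qed (auto simp: min.coboundedI2)
qed

lemma op_norm_nonneg:
  assumes "T \<in> bounded_ops H K" "semi_hilb H"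
  shows "0 \<le> op_norm H K T"
  unfolding op_norm_def
proof (rule cInf_greatest)
  obtain c where "c \<ge> 0" "\<And>x. x \<in> vecs H \<Longrightarrow> hnorm K (T x) \<le> c * hnorm H x"
    by (rule bounded_ops_bound[OF assms]) blast
  then show "{c. 0 \<le> c \<and> (\<forall>x\<in>vecs H. hnorm K (T x) \<le> c * hnorm H x)} \<noteq> {}"
    by blast
qed simp

lemma op_norm_le:
  assumes "0 \<le> c" "\<And>x. x \<in> vecs H \<Longrightarrow> hnorm K (T x) \<le> c * hnorm H x"
  shows "op_norm H K T \<le> c"
  unfolding op_norm_def by (rule cInf_lower) (use assms in \<open>auto intro: bdd_belowI\<close>)

lemma quadratic_remainder_tendsto:
  fixes h :: "'a::real_normed_vector"
  assumes "0 < r" and "\<And>h :: 'a. norm h < r \<Longrightarrow> 0 \<le> g h" "\<And>h. norm h < r \<Longrightarrow> g h \<le> c * (norm h)\<^sup>2"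
  shows "((\<lambda>h. g h / norm h) \<longlongrightarrow> 0) (at 0)"
proof (rule Lim_null_comparison)
  show "((\<lambda>h :: 'a. c * norm h) \<longlongrightarrow> 0) (at 0)"
    by (rule tendsto_eq_intros refl | simp)+
  have "norm (g h / norm h) \<le> c * norm h" if "h \<noteq> 0" "norm h < r" for h :: 'a
    using assms(2,3)[OF that(2)] that(1) by (simp add: field_simps power2_eq_square)
  then show "\<forall>\<^sub>F h :: 'a in at 0. norm (g h / norm h) \<le> c * norm h"
    using \<open>0 < r\<close> unfolding eventually_at by (auto intro!: exI[of _ r])
qed

lemma qdiff_holomorphic_op:
  fixes \<Phi> :: "complex ^ 'n \<Rightarrow> 'a::complex_vector \<Rightarrow> 'b::complex_vector"
  assumes "hilb E" "hilb F" "qdiff E F \<Phi>"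
  shows "holomorphic_op E F \<Phi>"
  unfolding holomorphic_ball_def
proof (intro conjI ballI)
  interpret E: hilb E by fact
  interpret F: hilb F by fact
  fix z :: "complex ^ 'n" assume z: "z \<in> unit_ball"
  show "\<Phi> z \<in> bounded_ops E F" using qdiff_bounded_ops[OF assms(3) z] .
  obtain D c r where Dat: "qdiff_at E F \<Phi> z D c r"
      and ball: "\<And>h. norm h < r \<Longrightarrow> z + h \<in> unit_ball"
    using qdiffD[OF assms(3) z] by metis
  note D = qdiff_atD[OF Dat]
  have eq: "(\<Phi> (z + h) - \<Phi> z - (\<Sum>i\<in>UNIV. h $ i *\<^sub>C D i)) x = \<Phi> (z + h) x - \<Phi> z x - row_op D h x" for h x
    by (simp add: sum_fun_apply scaleC_fun_def row_op_def)
  have "((\<lambda>h. op_norm E F (\<Phi> (z + h) - \<Phi> z - (\<Sum>i\<in>UNIV. h $ i *\<^sub>C D i)) / norm h) \<longlongrightarrow> 0) (at 0)"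
  proof (rule quadratic_remainder_tendsto[OF D(3)])
    fix h :: "complex ^ 'n" assume h: "norm h < r"
    note zh = ball[OF h]
    \<comment> \<open>The infimum defining \<open>op_norm\<close> is known to be nonnegative once
      some bound exists, so the remainder is first shown to be a bounded operator.\<close>
    have "(\<lambda>x. \<Phi> (z + h) x + ((- 1) *\<^sub>C \<Phi> z x + (- 1) *\<^sub>C row_op D h x)) \<in> bounded_ops E F"
      by (intro bounded_ops_add bounded_ops_scale qdiff_bounded_ops[OF assms(3)] z zh row_op_bounded_ops D
          E.semi_hilb_axioms F.semi_hilb_axioms)
    also have "(\<lambda>x. \<Phi> (z + h) x + ((- 1) *\<^sub>C \<Phi> z x + (- 1) *\<^sub>C row_op D h x))
        = \<Phi> (z + h) - \<Phi> z - (\<Sum>i\<in>UNIV. h $ i *\<^sub>C D i)"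
      by (rule ext) (simp only: eq, simp add: scaleC_one cvs.scale_minus_left)
    finally show "0 \<le> op_norm E F (\<Phi> (z + h) - \<Phi> z - (\<Sum>i\<in>UNIV. h $ i *\<^sub>C D i))"
      by (rule op_norm_nonneg[OF _ E.semi_hilb_axioms])
    show "op_norm E F (\<Phi> (z + h) - \<Phi> z - (\<Sum>i\<in>UNIV. h $ i *\<^sub>C D i)) \<le> c * (norm h)\<^sup>2"
      by (rule op_norm_le) (use D(2) D(4)[OF h _ zh] eq in simp_all)
  qed
  then show "\<exists>D. (\<forall>i. D i \<in> bounded_ops E F) \<and>
      ((\<lambda>h. op_norm E F (\<Phi> (z + h) - \<Phi> z - (\<Sum>i\<in>UNIV. h $ i *\<^sub>C D i)) / norm h) \<longlongrightarrow> 0) (at 0)"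
    using D(1) by blast
qed

lemma qdiff_holomorphic_vec:
  fixes \<Phi> :: "complex ^ 'n \<Rightarrow> 'a::complex_vector \<Rightarrow> 'b::complex_vector"
  assumes "hilb E" "hilb F" "qdiff E F \<Phi>" and x: "x \<in> vecs E"
  shows "holomorphic_vec F (\<lambda>z. \<Phi> z x)"
  unfolding holomorphic_ball_def
proof (intro conjI ballI)
  interpret E: hilb E by fact
  interpret F: hilb F by fact
  fix z :: "complex ^ 'n" assume z: "z \<in> unit_ball"
  show "\<Phi> z x \<in> vecs F" using bounded_opsD(1)[OF qdiff_bounded_ops[OF assms(3) z] x] .
  obtain D c r where Dat: "qdiff_at E F \<Phi> z D c r"
      and ball: "\<And>h. norm h < r \<Longrightarrow> z + h \<in> unit_ball"
    using qdiffD[OF assms(3) z] by metis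
  note D = qdiff_atD[OF Dat]
  have "((\<lambda>h. hnorm F (\<Phi> (z + h) x - \<Phi> z x - (\<Sum>i\<in>UNIV. h $ i *\<^sub>C D i x)) / norm h) \<longlongrightarrow> 0) (at 0)"
  proof (rule quadratic_remainder_tendsto[OF D(3)])
    fix h :: "complex ^ 'n" assume h: "norm h < r"
    note zh = ball[OF h]
    have "\<Phi> (z + h) x \<in> vecs F" "\<Phi> z x \<in> vecs F" "D i x \<in> vecs F" for i
      using bounded_opsD(1)[OF qdiff_bounded_ops[OF assms(3)] x] z zh bounded_opsD(1)[OF D(1) x] by auto
    then show "0 \<le> hnorm F (\<Phi> (z + h) x - \<Phi> z x - (\<Sum>i\<in>UNIV. h $ i *\<^sub>C D i x))"
      by (intro F.hnorm_nonneg F.diff_in F.sum_in F.scale_in)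
    show "hnorm F (\<Phi> (z + h) x - \<Phi> z x - (\<Sum>i\<in>UNIV. h $ i *\<^sub>C D i x)) \<le> (c * hnorm E x) * (norm h)\<^sup>2"
      using D(4)[OF h x zh] by (simp add: row_op_def mult_ac)
  qed
  then show "\<exists>D. (\<forall>i. D i \<in> vecs F) \<and>
      ((\<lambda>h. hnorm F (\<Phi> (z + h) x - \<Phi> z x - (\<Sum>i\<in>UNIV. h $ i *\<^sub>C D i)) / norm h) \<longlongrightarrow> 0) (at 0)"
    using bounded_opsD(1)[OF D(1) x] by (intro exI[of _ "\<lambda>i. D i x"]) blast
qed

lemma qdiff_const:
  assumes "hilb E" "hilb F" "T \<in> bounded_ops E F"
  shows "qdiff E F (\<lambda>_. T)"
proof -
  interpret E: hilb E by fact
  interpret F: hilb F by fact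
  show ?thesis
    unfolding qdiff_def qdiff_at_def
    by (intro ballI conjI assms exI[of _ "\<lambda>_ _. 0"] exI[of _ 0] exI[of _ 1])
      (auto simp: bounded_ops_0 E.semi_hilb_axioms F.semi_hilb_axioms row_op_def)
qed

lemma qdiff_row_op:
  assumes "hilb E" "hilb F" "\<And>i. B i \<in> bounded_ops E F"
  shows "qdiff E F (row_op B)"
proof -
  interpret E: hilb E by fact
  interpret F: hilb F by fact
  show ?thesis
    unfolding qdiff_def qdiff_at_def
    by (intro ballI conjI row_op_bounded_ops assms exI[of _ B] exI[of _ 0] exI[of _ 1]
        E.semi_hilb_axioms F.semi_hilb_axioms)
      (use assms(3) in \<open>auto simp: row_op_def scaleC_add_left sum.distrib\<close>)
qed

lemma qdiff_add:
  fixes \<Phi> :: "complex ^ 'n \<Rightarrow> 'a::complex_vector \<Rightarrow> 'b::complex_vector"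
  assumes "hilb E" "hilb F" and \<Phi>: "qdiff E F \<Phi>" and \<Psi>: "qdiff E F \<Psi>"
  shows "qdiff E F (\<lambda>z x. \<Phi> z x + \<Psi> z x)"
proof -
  interpret E: hilb E by fact
  interpret F: hilb F by fact
  show ?thesis
    unfolding qdiff_def
  proof (intro ballI conjI)
    fix z :: "complex ^ 'n" assume z: "z \<in> unit_ball"
    show "(\<lambda>x. \<Phi> z x + \<Psi> z x) \<in> bounded_ops E F"
      by (intro bounded_ops_add qdiff_bounded_ops[OF \<Phi>] qdiff_bounded_ops[OF \<Psi>] z
          E.semi_hilb_axioms F.semi_hilb_axioms)
    obtain D c r where Dat: "qdiff_at E F \<Phi> z D c r"
        and ball: "\<And>h. norm h < r \<Longrightarrow> z + h \<in> unit_ball"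
      using qdiffD[OF \<Phi> z] by metis
    note D = qdiff_atD[OF Dat]
    obtain D' c' r' where Dat': "qdiff_at E F \<Psi> z D' c' r'"
      using qdiffD[OF \<Psi> z] by metis
    note D' = qdiff_atD[OF Dat']
    let ?D = "\<lambda>i x. D i x + D' i x"
    have "hnorm F (\<Phi> (z + h) x + \<Psi> (z + h) x - (\<Phi> z x + \<Psi> z x) - row_op ?D h x)
        \<le> (c + c') * (norm h)\<^sup>2 * hnorm E x"
      if h: "norm h < min r r'" and x: "x \<in> vecs E" and zh: "z + h \<in> unit_ball" for h x
    proof -
      have row: "row_op T h x \<in> vecs F" if "\<And>i. T i \<in> bounded_ops E F" for T
        using bounded_opsD(1)[OF row_op_bounded_ops[OF E.semi_hilb_axioms F.semi_hilb_axioms that] x] .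
      have in_F: "\<Phi> (z + h) x - \<Phi> z x - row_op D h x \<in> vecs F" "\<Psi> (z + h) x - \<Psi> z x - row_op D' h x \<in> vecs F"
        by (intro F.diff_in bounded_opsD(1)[OF qdiff_bounded_ops[OF \<Phi>] x]
            bounded_opsD(1)[OF qdiff_bounded_ops[OF \<Psi>] x] z zh row D(1) D'(1))+
      have eq: "\<Phi> (z + h) x + \<Psi> (z + h) x - (\<Phi> z x + \<Psi> z x) - row_op ?D h x
          = (\<Phi> (z + h) x - \<Phi> z x - row_op D h x) + (\<Psi> (z + h) x - \<Psi> z x - row_op D' h x)"
        by (simp add: row_op_def scaleC_add_right sum.distrib algebra_simps)
      show ?thesis
        unfolding eq using F.hnorm_triangle[OF in_F] D(4)[OF _ x zh] D'(4)[OF _ x zh] h by (simp add: distrib_right)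
    qed
    moreover have "?D i \<in> bounded_ops E F" for i
      by (intro bounded_ops_add D D' E.semi_hilb_axioms F.semi_hilb_axioms)
    ultimately have "qdiff_at E F (\<lambda>z x. \<Phi> z x + \<Psi> z x) z ?D (c + c') (min r r')"
      using D(2,3) D'(2,3) unfolding qdiff_at_def by auto
    then show "\<exists>D c r. qdiff_at E F (\<lambda>z x. \<Phi> z x + \<Psi> z x) z D c r" by blast
  qed
qed

text \<open>Product rule with derivative \<Psi>(z) D_i + D'_i \<Phi>(z). Let u, u' and u'' be the
  value, the derivative term and the remainder of \<Phi>, and v = u + u' + u''. The total remainder
  is \<Psi>(z) u'' + D'_h (v - u) + w, where w is the remainder of \<Psi> at v.\<close>

lemma qdiff_compose:
  fixes \<Phi> :: "complex ^ 'n \<Rightarrow> 'a::complex_vector \<Rightarrow> 'b::complex_vector"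
    and \<Psi> :: "complex ^ 'n \<Rightarrow> 'b \<Rightarrow> 'c::complex_vector"
  assumes "hilb E" "hilb F" "hilb G" and \<Phi>: "qdiff E F \<Phi>" and \<Psi>: "qdiff F G \<Psi>"
  shows "qdiff E G (\<lambda>z x. \<Psi> z (\<Phi> z x))"
proof -
  interpret E: hilb E by fact
  interpret F: hilb F by fact
  interpret G: hilb G by fact
  note E = E.semi_hilb_axioms and F = F.semi_hilb_axioms and G = G.semi_hilb_axioms
  show ?thesis
    unfolding qdiff_def
  proof (intro ballI conjI)
    fix z :: "complex ^ 'n" assume z: "z \<in> unit_ball"
    note \<Phi>z = qdiff_bounded_ops[OF \<Phi> z] and \<Psi>z = qdiff_bounded_ops[OF \<Psi> z]
    show "(\<lambda>x. \<Psi> z (\<Phi> z x)) \<in> bounded_ops E G"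
      by (intro bounded_ops_compose[OF \<Phi>z \<Psi>z] E F)
    obtain D c r where Dat: "qdiff_at E F \<Phi> z D c r" and r_le: "r \<le> 1"
        and ball: "\<And>h. norm h < r \<Longrightarrow> z + h \<in> unit_ball"
      using qdiffD[OF \<Phi> z] by metis
    note D = qdiff_atD[OF Dat]
    obtain D' c' r' where Dat': "qdiff_at F G \<Psi> z D' c' r'"
      using qdiffD[OF \<Psi> z] by metis
    note D' = qdiff_atD[OF Dat']
    obtain a where a: "a \<ge> 0" "\<And>x. x \<in> vecs E \<Longrightarrow> hnorm F (\<Phi> z x) \<le> a * hnorm E x"
      using bounded_ops_bound[OF \<Phi>z E] by blast
    obtain b where b: "b \<ge> 0" "\<And>x. x \<in> vecs F \<Longrightarrow> hnorm G (\<Psi> z x) \<le> b * hnorm F x"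
      using bounded_ops_bound[OF \<Psi>z F] by blast
    obtain d where d: "d \<ge> 0" "\<And>h x. x \<in> vecs E \<Longrightarrow> hnorm F (row_op D h x) \<le> d * norm h * hnorm E x"
      by (rule row_op_bound[OF E F D(1)], rule that)
    obtain d' where d': "d' \<ge> 0" "\<And>h x. x \<in> vecs F \<Longrightarrow> hnorm G (row_op D' h x) \<le> d' * norm h * hnorm F x"
      by (rule row_op_bound[OF F G D'(1)], rule that)
    let ?D = "\<lambda>i x. \<Psi> z (D i x) + D' i (\<Phi> z x)"
    \<comment> \<open>One summand for each of the three pieces of the remainder: d + c is the
      constant for v - u, which is linear in |h|, and a + d + c the constant for v. Both use |h|
      \<le> 1.\<close>
    let ?C = "b * c + d' * (d + c) + c' * (a + d + c)"
    have "hnorm G (\<Psi> (z + h) (\<Phi> (z + h) x) - \<Psi> z (\<Phi> z x) - row_op ?D h x) \<le> ?C * (norm h)\<^sup>2 * hnorm E x"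
      if h: "norm h < min r r'" and x: "x \<in> vecs E" and zh: "z + h \<in> unit_ball" for h x
    proof -
      define u where "u = \<Phi> z x"
      define u' where "u' = row_op D h x"
      define v where "v = \<Phi> (z + h) x"
      define u'' where "u'' = v - u - u'"
      have in_F: "u \<in> vecs F" "v \<in> vecs F" "u' \<in> vecs F" "u'' \<in> vecs F"
        unfolding u_def v_def u'_def u''_def
        by (intro F.diff_in bounded_opsD(1)[OF qdiff_bounded_ops[OF \<Phi>] x] z zh
            bounded_opsD(1)[OF row_op_bounded_ops[OF E F D(1)] x])+
      have row': "row_op D' h \<in> bounded_ops F G" by (intro row_op_bounded_ops F G D')
      define w where "w = \<Psi> (z + h) v - \<Psi> z v - row_op D' h v"
      have in_G: "\<Psi> z u'' \<in> vecs G" "row_op D' h (v - u) \<in> vecs G" "w \<in> vecs G"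
        unfolding w_def
        by (intro G.diff_in bounded_opsD(1)[OF \<Psi>z] bounded_opsD(1)[OF row'] F.diff_in
            bounded_opsD(1)[OF qdiff_bounded_ops[OF \<Psi> zh]] in_F)+
      have nh: "norm h \<le> 1" "(norm h)\<^sup>2 \<le> norm h"
        using h r_le by (auto simp: power2_eq_square intro: mult_left_le_one_le)
      have N: "0 \<le> hnorm E x" using x by simp
      have "row_op ?D h x = \<Psi> z u' + row_op D' h u"
      proof -
        have Dx: "h $ i *\<^sub>C D i x \<in> vecs F" "D i x \<in> vecs F" for i
          using bounded_opsD(1)[OF D(1) x] by auto
        have "\<Psi> z u' = (\<Sum>i\<in>UNIV. h $ i *\<^sub>C \<Psi> z (D i x))"
          unfolding u'_def row_op_def
          by (subst bounded_ops_sum[OF \<Psi>z F Dx(1)]) (use Dx bounded_opsD(3)[OF \<Psi>z] in auto)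
        then show ?thesis
          by (simp add: row_op_def u_def scaleC_add_right sum.distrib)
      qed
      moreover have "\<Psi> z v = \<Psi> z u + \<Psi> z u' + \<Psi> z u''"
      proof -
        have "v = u + u' + u''" by (simp add: u''_def)
        then show ?thesis
          using bounded_opsD(2)[OF \<Psi>z] in_F by simp
      qed
      moreover have "row_op D' h v = row_op D' h u + row_op D' h (v - u)"
        using bounded_ops_diff[OF row' F in_F(2,1)] by simp
      ultimately have eq: "\<Psi> (z + h) (\<Phi> (z + h) x) - \<Psi> z (\<Phi> z x) - row_op ?D h x
          = \<Psi> z u'' + row_op D' h (v - u) + w"
        by (simp add: w_def v_def[symmetric] u_def[symmetric])
      have n_u'': "hnorm F u'' \<le> c * (norm h)\<^sup>2 * hnorm E x"
        using D(4)[OF _ x zh] h by (simp add: u''_def u'_def u_def v_def)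
      have n_u': "hnorm F u' \<le> d * norm h * hnorm E x"
        using d(2)[OF x] by (simp add: u'_def)
      have "c * (norm h)\<^sup>2 * hnorm E x \<le> c * norm h * hnorm E x"
        using nh D(2) N by (intro mult_right_mono mult_left_mono) auto
      then have n_diff: "hnorm F (v - u) \<le> (d + c) * norm h * hnorm E x"
        using F.hnorm_triangle[OF in_F(3,4)] n_u' n_u'' by (simp add: u''_def distrib_right)
      have "(d + c) * norm h * hnorm E x \<le> (d + c) * 1 * hnorm E x"
        using nh D(2) d(1) N by (intro mult_right_mono mult_left_mono) auto
      then have n_v: "hnorm F v \<le> (a + d + c) * hnorm E x"
        using F.hnorm_triangle[of u "v - u"] in_F n_diff a(2)[OF x] by (simp add: u_def distrib_right)
      have "hnorm G (\<Psi> z u'') \<le> b * (c * (norm h)\<^sup>2 * hnorm E x)"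
        using b(2)[OF in_F(4)] mult_left_mono[OF n_u'' b(1)] by simp
      moreover have "hnorm G (row_op D' h (v - u)) \<le> d' * norm h * ((d + c) * norm h * hnorm E x)"
        using d'(2)[of "v - u" h] mult_left_mono[OF n_diff, of "d' * norm h"] d'(1) in_F by (simp add: order_trans)
      moreover have "hnorm G w \<le> c' * (norm h)\<^sup>2 * ((a + d + c) * hnorm E x)"
        using D'(4)[OF _ in_F(2) zh] mult_left_mono[OF n_v, of "c' * (norm h)\<^sup>2"] D'(2) h in_F
        by (simp add: w_def order_trans)
      ultimately have "hnorm G (\<Psi> z u'' + row_op D' h (v - u) + w) \<le> b * (c * (norm h)\<^sup>2 * hnorm E x)
          + d' * norm h * ((d + c) * norm h * hnorm E x) + c' * (norm h)\<^sup>2 * ((a + d + c) * hnorm E x)"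
        using G.hnorm_triangle[of "\<Psi> z u'' + row_op D' h (v - u)" w]
          G.hnorm_triangle[of "\<Psi> z u''" "row_op D' h (v - u)"] in_G by force
      also have "\<dots> = ?C * (norm h)\<^sup>2 * hnorm E x"
        by (simp add: algebra_simps power2_eq_square)
      finally show ?thesis unfolding eq .
    qed
    moreover have "?D i \<in> bounded_ops E G" for i
      by (intro bounded_ops_add bounded_ops_compose[OF D(1) \<Psi>z] bounded_ops_compose[OF \<Phi>z D'(1)] E F G)
    ultimately have "qdiff_at E G (\<lambda>z x. \<Psi> z (\<Phi> z x)) z ?D ?C (min r r')"
      using D(2,3) D'(2,3) a b d d' unfolding qdiff_at_def by auto
    then show "\<exists>D c r. qdiff_at E G (\<lambda>z x. \<Psi> z (\<Phi> z x)) z D c r" by blast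
  qed
qed

section \<open>Contractive colligations\<close>

locale strict_contraction = hilb +
  fixes T r
  assumes T: "T \<in> bounded_ops H H" and r: "0 \<le> r" "r < 1"
    and strict: "\<And>x. x \<in> vecs H \<Longrightarrow> hnorm H (T x) \<le> r * hnorm H x"
begin

text \<open>This is (1 - T)^{-1}, specified by its fixed point equation; identities then follow from
  uniqueness of fixed points rather than from a Neumann series.\<close>

definition resolvent :: "'a \<Rightarrow> 'a" where
  "resolvent x = (SOME y. y \<in> vecs H \<and> y = x + T y)"

lemma fixed_point_bound:
  assumes "x \<in> vecs H" "y \<in> vecs H" "y = x + T y"
  shows "hnorm H y \<le> hnorm H x / (1 - r)"
proof -
  have "hnorm H (x + T y) \<le> hnorm H x + hnorm H (T y)"
    using hnorm_triangle[OF assms(1) bounded_opsD(1)[OF T assms(2)]] .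
  then have "hnorm H y \<le> hnorm H x + r * hnorm H y"
    using strict[OF assms(2)] unfolding assms(3)[symmetric] by simp
  then show ?thesis using r by (simp add: field_simps)
qed

lemma fixed_point_unique:
  assumes "y \<in> vecs H" "y' \<in> vecs H" "y = x + T y" "y' = x + T y'"
  shows "y = y'"
proof -
  have "y - y' = 0 + T (y - y')"
    using bounded_ops_diff[OF T semi_hilb_axioms assms(1,2)] assms(3,4) by (metis add_diff_cancel_left add_0)
  then have "hnorm H (y - y') \<le> 0"
    using fixed_point_bound[of 0 "y - y'"] assms(1,2) by simp
  then have "hnorm H (y - y') = 0"
    using hnorm_nonneg[OF diff_in[OF assms(1,2)]] by linarith
  then show ?thesis
    using assms(1,2) by simp
qed

lemma fixed_point_exists:
  assumes x: "x \<in> vecs H"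
  obtains y where "y \<in> vecs H" "y = x + T y"
proof -
  \<comment> \<open>\<open>Metric_space\<close> demands nonnegativity and symmetry of all arguments,
    also off the carrier; the default value 0 supplies them.\<close>
  define d where "d u v = (if u \<in> vecs H \<and> v \<in> vecs H then hnorm H (u - v) else 0)" for u v
  interpret M: Metric_space "vecs H" d
    by standard (auto simp: d_def hnorm_diff_commute hnorm_triangle_mid)
  have mcomplete: M.mcomplete
    unfolding M.mcomplete_def
  proof (intro allI impI)
    fix s assume s: "M.MCauchy s"
    then have sH: "s k \<in> vecs H" for k by (auto simp: M.MCauchy_def)
    have cauchy: "\<exists>N. \<forall>i\<ge>N. \<forall>j\<ge>N. hnorm H (s i - s j) < e" if "e > 0" for e
      using s sH that by (simp add: M.MCauchy_def d_def)
    obtain y where y: "y \<in> vecs H" "(\<lambda>k. hnorm H (s k - y)) \<longlonglongrightarrow> 0"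
      by (rule complete[OF sH cauchy]) (assumption | rule that)+
    have "\<exists>N. \<forall>k\<ge>N. d (s k) y < e" if "e > 0" for e
      using LIMSEQ_D[OF y(2) that] y(1) sH by (simp add: d_def)
    then show "\<exists>y. limitin M.mtopology s y sequentially"
      by (intro exI[of _ y]) (simp add: M.limit_metric_sequentially y(1) sH)
  qed
  have Tx: "x + T y \<in> vecs H" if "y \<in> vecs H" for y
    using x bounded_opsD(1)[OF T that] by simp
  have "d (x + T u) (x + T v) \<le> r * d u v" if "u \<in> vecs H" "v \<in> vecs H" for u v
    using that Tx strict[of "u - v"] bounded_ops_diff[OF T semi_hilb_axioms that] by (simp add: d_def)
  then obtain y where "y \<in> vecs H" "x + T y = y"
    using M.Banach_fixedpoint_thm[OF mcomplete, of "\<lambda>y. x + T y" r] r x Tx by blast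
  then show thesis using that by metis
qed

lemma resolvent:
  assumes "x \<in> vecs H"
  shows resolvent_in: "resolvent x \<in> vecs H"
    and resolvent_eq: "resolvent x = x + T (resolvent x)"
proof -
  have "\<exists>y. y \<in> vecs H \<and> y = x + T y" using fixed_point_exists[OF assms] by metis
  then have "resolvent x \<in> vecs H \<and> resolvent x = x + T (resolvent x)"
    unfolding resolvent_def by (rule someI_ex)
  then show "resolvent x \<in> vecs H" "resolvent x = x + T (resolvent x)" by auto
qed

lemma resolvent_unique:
  assumes "x \<in> vecs H" "y \<in> vecs H" "y = x + T y"
  shows "resolvent x = y"
  by (rule fixed_point_unique[OF resolvent_in[OF assms(1)] assms(2) resolvent_eq[OF assms(1)] assms(3)])

lemma resolvent_bound: "x \<in> vecs H \<Longrightarrow> hnorm H (resolvent x) \<le> 1 / (1 - r) * hnorm H x"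
  using fixed_point_bound[OF _ resolvent_in resolvent_eq, of x] by simp

lemma resolvent_bounded_ops: "resolvent \<in> bounded_ops H H"
proof (rule bounded_opsI[where c = "1 / (1 - r)"])
  fix x y assume xy: "x \<in> vecs H" "y \<in> vecs H"
  note R = resolvent[OF xy(1)] resolvent[OF xy(2)]
  have T_add: "T (resolvent x + resolvent y) = T (resolvent x) + T (resolvent y)"
    by (rule bounded_opsD(2)[OF T R(1,3)])
  have "resolvent x + resolvent y = (x + T (resolvent x)) + (y + T (resolvent y))"
    using R(2,4) by simp
  also have "\<dots> = x + y + T (resolvent x + resolvent y)"
    unfolding T_add by (simp add: add_ac)
  finally show "resolvent (x + y) = resolvent x + resolvent y"
    by (intro resolvent_unique) (use xy R(1,3) in auto)
next
  fix a x assume x: "x \<in> vecs H"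
  note R = resolvent[OF x]
  have "a *\<^sub>C resolvent x = a *\<^sub>C x + T (a *\<^sub>C resolvent x)"
    unfolding bounded_opsD(3)[OF T R(1)] by (subst R(2)) (rule scaleC_add_right)
  then show "resolvent (a *\<^sub>C x) = a *\<^sub>C resolvent x"
    by (intro resolvent_unique scale_in x R(1))
qed (use resolvent_in resolvent_bound in auto)

text \<open>In \<open>resolvent_eq\<close> the operator T stands to the left of the resolvent, here
  to the right. \<open>transfer_psd\<close> needs this order to split C g off C (1 - z D)^{-1}
  g.\<close>

lemma resolvent_commute:
  assumes x: "x \<in> vecs H"
  shows "resolvent x = x + resolvent (T x)"
proof (rule resolvent_unique[OF x])
  have Tx: "T x \<in> vecs H" using bounded_opsD(1)[OF T x] .
  show "x + resolvent (T x) \<in> vecs H" using x resolvent_in[OF Tx] by simp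
  show "x + resolvent (T x) = x + T (x + resolvent (T x))"
    using resolvent_eq[OF Tx] bounded_opsD(2)[OF T x resolvent_in[OF Tx]] by simp
qed

end

section \<open>Colligations, transfer functions and realization\<close>

locale colligation = E: hilb E + F: hilb F + G: hilb G
  for E :: "'e::complex_vector hilbert" and F :: "'f::complex_vector hilbert"
    and G :: "'g::complex_vector hilbert" +
  fixes U :: "'e \<times> 'g \<Rightarrow> 'f \<times> ('n::finite \<Rightarrow> 'g)"
  assumes U: "U \<in> bounded_ops (hsum E G) (hsum F (hpow G))"
    and contr: "\<And>p. p \<in> vecs (hsum E G) \<Longrightarrow> hnorm (hsum F (hpow G)) (U p) \<le> hnorm (hsum E G) p"
begin

text \<open>Blocks of \<open>U\<close>: A maps inputs to outputs, B inputs to states, C states to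
  outputs, D states to states. B and D are columns with entries indexed by i, because the target
  carries n copies of the state space.\<close>

definition "opA e = fst (U (e, 0))"
definition "opB i e = snd (U (e, 0)) i"
definition "opC g = fst (U (0, g))"
definition "opD i g = snd (U (0, g)) i"

sublocale P: hilb "hpow G :: ('n \<Rightarrow> 'g) hilbert"
  by (rule hilb_hpow[OF G.hilb_axioms])

sublocale S: hilb "hsum F (hpow G :: ('n \<Rightarrow> 'g) hilbert)"
  by (rule hilb_hsum[OF F.hilb_axioms P.hilb_axioms])

sublocale T: hilb "hsum E G"
  by (rule hilb_hsum[OF E.hilb_axioms G.hilb_axioms])

lemma hnorm_pair [simp]:
  "e \<in> vecs E \<Longrightarrow> hnorm (hsum E G) (e, 0) = hnorm E e"
  "g \<in> vecs G \<Longrightarrow> hnorm (hsum E G) (0, g) = hnorm G g"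
  by (simp_all add: hnorm_hsum[OF E.semi_hilb_axioms G.semi_hilb_axioms])

lemma U_eq:
  assumes "e \<in> vecs E" "g \<in> vecs G"
  shows "U (e, g) = (opA e + opC g, \<lambda>i. opB i e + opD i g)"
  using bounded_opsD(2)[OF U, of "(e, 0)" "(0, g)"] assms
  by (simp add: opA_def opB_def opC_def opD_def prod_eq_iff fun_eq_iff)

lemma opA: "opA \<in> bounded_ops E F" and opB: "opB i \<in> bounded_ops E G"
  and opC: "opC \<in> bounded_ops G F" and opD: "opD i \<in> bounded_ops G G"
proof -
  note hilbs = E.semi_hilb_axioms F.semi_hilb_axioms G.semi_hilb_axioms P.semi_hilb_axioms
    S.semi_hilb_axioms T.semi_hilb_axioms
  note ops = direct_sum_bounded_ops[OF hilbs(1,3)] direct_sum_bounded_ops[OF hilbs(2,4)]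
    direct_sum_bounded_ops(5)[OF hilbs(3,3)]
  show "opA \<in> bounded_ops E F" "opB i \<in> bounded_ops E G" "opC \<in> bounded_ops G F" "opD i \<in> bounded_ops G G"
    unfolding opA_def[abs_def] opB_def[abs_def] opC_def[abs_def] opD_def[abs_def]
    using bounded_ops_compose[OF bounded_ops_compose[OF ops(1) U] ops(8)]
      bounded_ops_compose[OF bounded_ops_compose[OF bounded_ops_compose[OF ops(1) U] ops(9)] ops(11)]
      bounded_ops_compose[OF bounded_ops_compose[OF ops(2) U] ops(8)]
      bounded_ops_compose[OF bounded_ops_compose[OF bounded_ops_compose[OF ops(2) U] ops(9)] ops(11)] hilbs
    by blast+
qed

lemma row_B: "row_op opB z \<in> bounded_ops E G"
  and row_D: "row_op opD z \<in> bounded_ops G G"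
  by (intro row_op_bounded_ops opB opD E.semi_hilb_axioms G.semi_hilb_axioms)+

text \<open>The adjoint of the row z sends y to the column with entries cnj z_l y.\<close>

lemma ip_row_op:
  assumes "e \<in> vecs E" "g \<in> vecs G" "y \<in> vecs G"
  shows "(\<Sum>l\<in>UNIV. ip G (opB l e + opD l g) (cnj (z $ l) *\<^sub>C y)) = ip G (row_op opB z e + row_op opD z g) y"
proof -
  have "opB l e + opD l g \<in> vecs G" for l
    using bounded_opsD(1)[OF opB assms(1)] bounded_opsD(1)[OF opD assms(2)] by simp
  moreover have "row_op opB z e + row_op opD z g = (\<Sum>l\<in>UNIV. z $ l *\<^sub>C (opB l e + opD l g))"
    by (simp add: row_op_def scaleC_add_right sum.distrib)
  ultimately show ?thesis
    using assms(3) by (simp add: G.ip_sum_left[OF assms(3)])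
qed

text \<open>The column D is a corner of \<open>U\<close> and therefore a contraction into the n-fold
  power of \<open>G\<close>; the row z contributes the factor |z|.\<close>

lemma row_D_le:
  assumes "g \<in> vecs G"
  shows "hnorm G (row_op opD z g) \<le> norm z * hnorm G g"
proof -
  have p: "(0, g) \<in> vecs (hsum E G)" using assms by simp
  have Up: "fst (U (0, g)) \<in> vecs F" "snd (U (0, g)) \<in> vecs (hpow G)"
    using bounded_opsD(1)[OF U p] by simp_all
  have "hnorm (hpow G) (snd (U (0, g))) \<le> hnorm G g"
    using hnorm_hsum_ge(2)[OF F.semi_hilb_axioms P.semi_hilb_axioms Up] contr[OF p] assms by simp
  then have "norm z * hnorm (hpow G) (snd (U (0, g))) \<le> norm z * hnorm G g"
    by (intro mult_left_mono) auto
  then show ?thesis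
    using hnorm_row_le[OF G.semi_hilb_axioms, of "\<lambda>i. opD i g" z] Up(2)
    by (simp add: row_op_def opD_def)
qed

lemma strict_contraction_row_D: "z \<in> unit_ball \<Longrightarrow> strict_contraction G (row_op opD z) (norm z)"
  by (intro strict_contraction.intro G.hilb_axioms strict_contraction_axioms.intro row_D row_D_le) simp_all

definition "res z = strict_contraction.resolvent G (row_op opD z)"

lemmas res_in = strict_contraction.resolvent_in[OF strict_contraction_row_D, folded res_def]
  and res_eq = strict_contraction.resolvent_eq[OF strict_contraction_row_D, folded res_def]
  and res_unique = strict_contraction.resolvent_unique[OF strict_contraction_row_D, folded res_def]
  and res_bound = strict_contraction.resolvent_bound[OF strict_contraction_row_D, folded res_def]
  and res_bounded_ops = strict_contraction.resolvent_bounded_ops[OF strict_contraction_row_D, folded res_def]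
  and res_commute = strict_contraction.resolvent_commute[OF strict_contraction_row_D, folded res_def]

lemma row_op_add: "row_op D (z + h) x = row_op D z x + row_op D h x"
  by (simp add: row_op_def scaleC_add_left sum.distrib)

text \<open>The resolvent identity: with \<open>res z x\<close> moved to the right, both sides solve
  the same fixed point equation at z + h.\<close>

lemma res_diff:
  assumes z: "z \<in> unit_ball" and zh: "z + h \<in> unit_ball" and x: "x \<in> vecs G"
  shows "res (z + h) x - res z x = res (z + h) (row_op opD h (res z x))"
proof -
  have Rx: "res z x \<in> vecs G" using res_in[OF z x] .
  have y: "row_op opD h (res z x) \<in> vecs G" using bounded_opsD(1)[OF row_D Rx] .
  have "res (z + h) x = res z x + res (z + h) (row_op opD h (res z x))"
  proof (rule res_unique[OF zh x])
    show "res z x + res (z + h) (row_op opD h (res z x)) \<in> vecs G"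
      using Rx res_in[OF zh y] by simp
    have "x + row_op opD (z + h) (res z x + res (z + h) (row_op opD h (res z x)))
        = (x + row_op opD z (res z x)) + (row_op opD h (res z x) + row_op opD (z + h) (res (z + h) (row_op opD h (res z x))))"
      by (simp add: bounded_opsD(2)[OF row_D Rx res_in[OF zh y]] row_op_add[of _ _ _ "res z x"] add.assoc)
    then show "res z x + res (z + h) (row_op opD h (res z x)) =
        x + row_op opD (z + h) (res z x + res (z + h) (row_op opD h (res z x)))"
      using res_eq[OF z x] res_eq[OF zh y] by simp
  qed
  then show ?thesis by simp
qed

text \<open>Two uses of the resolvent identity leave the remainder R(z + h) (h D) R(z) (h D) R(z) x,
  which is visibly quadratic in h.\<close>

lemma qdiff_res: "qdiff G G res"
  unfolding qdiff_def
proof (intro ballI conjI)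
  fix z :: "complex ^ 'n" assume z: "z \<in> unit_ball"
  show Rz: "res z \<in> bounded_ops G G" using res_bounded_ops[OF z] .
  \<comment> \<open>Bounds the resolvents at all z + h with |h| < (1 - |z|) / 2, since there 1 - |z
    + h| \<ge> (1 - |z|) / 2.\<close>
  define M where "M = 2 / (1 - norm z)"
  have M: "M > 0" using z by (simp add: M_def)
  obtain d where d: "d \<ge> 0" "\<And>h x. x \<in> vecs G \<Longrightarrow> hnorm G (row_op opD h x) \<le> d * norm h * hnorm G x"
    by (rule row_op_bound[OF G.semi_hilb_axioms G.semi_hilb_axioms opD], rule that)
  let ?D = "\<lambda>i x. res z (opD i (res z x))"
  have R_le: "hnorm G (res (z + h) x) \<le> M * hnorm G x"
    if h: "norm h < (1 - norm z) / 2" and x: "x \<in> vecs G" for h x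
  proof -
    have zh: "norm (z + h) \<le> (1 + norm z) / 2" using norm_triangle_ineq[of z h] h by (simp add: field_simps)
    then have "z + h \<in> unit_ball" using z by simp
    then have "hnorm G (res (z + h) x) \<le> 1 / (1 - norm (z + h)) * hnorm G x"
      by (rule res_bound[OF _ x])
    also have "\<dots> \<le> M * hnorm G x"
    proof (rule mult_right_mono)
      have "1 / (1 - norm (z + h)) \<le> 1 / ((1 - norm z) / 2)"
        using zh z by (intro divide_left_mono) (auto intro!: mult_pos_pos)
      then show "1 / (1 - norm (z + h)) \<le> M" by (simp add: M_def)
    qed (use x in simp)
    finally show ?thesis .
  qed
  have "hnorm G (res (z + h) x - res z x - row_op ?D h x) \<le> (M * (d * (M * (d * M)))) * (norm h)\<^sup>2 * hnorm G x"
    if h: "norm h < (1 - norm z) / 2" and x: "x \<in> vecs G" and zh: "z + h \<in> unit_ball" for h x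
  proof -
    have Rx: "res z x \<in> vecs G" using res_in[OF z x] .
    define y where "y = row_op opD h (res z x)"
    have y: "y \<in> vecs G" unfolding y_def using bounded_opsD(1)[OF row_D Rx] .
    have Ry: "res z y \<in> vecs G" using res_in[OF z y] .
    define v where "v = row_op opD h (res z y)"
    have v: "v \<in> vecs G" unfolding v_def using bounded_opsD(1)[OF row_D Ry] .
    have Dx: "h $ i *\<^sub>C opD i (res z x) \<in> vecs G" "opD i (res z x) \<in> vecs G" for i
      using bounded_opsD(1)[OF opD Rx] by auto
    have "row_op ?D h x = res z y"
      unfolding y_def row_op_def
      by (subst bounded_ops_sum[OF Rz G.semi_hilb_axioms Dx(1)]) (use Dx bounded_opsD(3)[OF Rz] in auto)
    then have eq: "res (z + h) x - res z x - row_op ?D h x = res (z + h) v"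
      using res_diff[OF z zh x] res_diff[OF z zh y] by (simp add: y_def v_def)
    have R0: "hnorm G (res z u) \<le> M * hnorm G u" if "u \<in> vecs G" for u
      using R_le[of 0 u] z that by simp
    have n: "0 \<le> d * norm h" "0 \<le> M" using d M by auto
    have "hnorm G (res (z + h) v) \<le> M * hnorm G v" by (rule R_le[OF h v])
    also have "\<dots> \<le> M * (d * norm h * hnorm G (res z y))"
      unfolding v_def by (intro mult_left_mono d(2)[OF Ry] n)
    also have "\<dots> \<le> M * (d * norm h * (M * hnorm G y))"
      by (intro mult_left_mono R0[OF y] n)
    also have "\<dots> \<le> M * (d * norm h * (M * (d * norm h * hnorm G (res z x))))"
      unfolding y_def by (intro mult_left_mono d(2)[OF Rx] n)
    also have "\<dots> \<le> M * (d * norm h * (M * (d * norm h * (M * hnorm G x))))"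
      by (intro mult_left_mono R0[OF x] n)
    finally show ?thesis unfolding eq by (simp add: mult_ac power2_eq_square)
  qed
  moreover have "?D i \<in> bounded_ops G G" for i
    by (intro bounded_ops_compose[OF bounded_ops_compose[OF Rz opD] Rz] G.semi_hilb_axioms)
  ultimately have "qdiff_at G G res z ?D (M * (d * (M * (d * M)))) ((1 - norm z) / 2)"
    using d(1) M z unfolding qdiff_at_def by auto
  then show "\<exists>D c r. qdiff_at G G res z D c r" by blast
qed

definition "transfer z e = opA e + opC (res z (row_op opB z e))"

lemma qdiff_observation: "qdiff G F (\<lambda>z g. opC (res z g))"
  by (rule qdiff_compose[OF G.hilb_axioms G.hilb_axioms F.hilb_axioms qdiff_res
      qdiff_const[OF G.hilb_axioms F.hilb_axioms opC]])

lemma qdiff_transfer: "qdiff E F transfer"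
  unfolding transfer_def[abs_def]
  by (intro qdiff_add qdiff_const opA E.hilb_axioms F.hilb_axioms
      qdiff_compose[OF E.hilb_axioms G.hilb_axioms F.hilb_axioms _ qdiff_observation]
      qdiff_row_op[OF E.hilb_axioms G.hilb_axioms opB])

text \<open>With \<open>\<eta> = (C (1 - z D)\<^sup>-\<^sup>1)\<^sup>* x\<close>, the adjoint of the colligation maps \<open>(x, z\<^sup>* \<eta>)\<close> to
  \<open>(\<Phi>(z)\<^sup>* x, \<eta>)\<close>, where \<open>\<Phi>\<close> is the transfer function.\<close>

lemma transfer_psd:
  assumes x: "\<And>j. j \<in> J \<Longrightarrow> x j \<in> vecs F" and w: "\<And>j. j \<in> J \<Longrightarrow> w j \<in> unit_ball"
  shows "psd J (\<lambda>i j. (ip F (x i) (x j) - ip E (hadj E F (transfer (w i)) (x i)) (hadj E F (transfer (w j)) (x j)))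
      / (1 - cdot (w j) (w i)))"
proof -
  define t where "t j = hadj E F (transfer (w j)) (x j)" for j
  define \<eta> where "\<eta> j = hadj G F (\<lambda>g. opC (res (w j) g)) (x j)" for j
  define a where "a j = (x j, \<lambda>l. cnj (w j $ l) *\<^sub>C \<eta> j)" for j
  have tr: "transfer (w j) \<in> bounded_ops E F" and ob: "(\<lambda>g. opC (res (w j) g)) \<in> bounded_ops G F"
    if "j \<in> J" for j
    using qdiff_bounded_ops[OF qdiff_transfer w[OF that]] qdiff_bounded_ops[OF qdiff_observation w[OF that]] .
  have t: "t j \<in> vecs E" and \<eta>: "\<eta> j \<in> vecs G" if "j \<in> J" for j
    unfolding t_def \<eta>_def
    using hadj_in[OF E.hilb_axioms F.semi_hilb_axioms tr x] hadj_in[OF G.hilb_axioms F.semi_hilb_axioms ob x] that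
    by auto
  have a: "a j \<in> vecs (hsum F (hpow G))" if "j \<in> J" for j
    using x \<eta> that by (simp add: a_def)
  have adj: "hadj (hsum E G) (hsum F (hpow G)) U (a j) = (t j, \<eta> j)" if j: "j \<in> J" for j
  proof (rule hadj_eqI[OF T.hilb_axioms S.semi_hilb_axioms U a[OF j]])
    show "(t j, \<eta> j) \<in> vecs (hsum E G)" using t \<eta> j by simp
    fix u assume "u \<in> vecs (hsum E G)"
    then obtain e g where u: "u = (e, g)" and e: "e \<in> vecs E" and g: "g \<in> vecs G" by (cases u) auto
    let ?z = "w j" and ?R = "res (w j)"
    note in_G = bounded_opsD(1)[OF row_B e, of ?z] bounded_opsD(1)[OF row_D g, of ?z]
    have "(\<Sum>l\<in>UNIV. ip G (opB l e + opD l g) (cnj (?z $ l) *\<^sub>C \<eta> j))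
        = ip G (row_op opB ?z e + row_op opD ?z g) (\<eta> j)"
      by (rule ip_row_op[OF e g \<eta>[OF j]])
    also have "\<dots> = ip F (opC (?R (row_op opB ?z e + row_op opD ?z g))) (x j)"
      unfolding \<eta>_def using in_G
      by (intro ip_hadj[OF G.hilb_axioms F.semi_hilb_axioms ob[OF j] x[OF j], symmetric]) auto
    finally have "ip (hsum F (hpow G)) (U u) (a j) =
        ip F (opA e + opC g) (x j) + ip F (opC (?R (row_op opB ?z e + row_op opD ?z g))) (x j)"
      by (simp add: u U_eq[OF e g] a_def)
    also have "\<dots> = ip F (opA e + opC g + opC (?R (row_op opB ?z e + row_op opD ?z g))) (x j)"
      by (intro F.ip_add_left[symmetric] x j F.add_in bounded_opsD(1)[OF opA e] bounded_opsD(1)[OF opC g]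
          bounded_opsD(1)[OF ob[OF j]] G.add_in in_G)
    also have "opA e + opC g + opC (?R (row_op opB ?z e + row_op opD ?z g)) = transfer ?z e + opC (?R g)"
    proof -
      have "opC (?R (row_op opB ?z e + row_op opD ?z g)) = opC (?R (row_op opB ?z e)) + opC (?R (row_op opD ?z g))"
        by (rule bounded_opsD(2)[OF ob[OF j] in_G])
      moreover have "opC (?R g) = opC g + opC (?R (row_op opD ?z g))"
        by (subst res_commute[OF w[OF j] g])
          (rule bounded_opsD(2)[OF opC g res_in[OF w[OF j] in_G(2)]])
      ultimately show ?thesis by (simp add: transfer_def)
    qed
    also have "ip F (transfer ?z e + opC (?R g)) (x j) = ip F (transfer ?z e) (x j) + ip F (opC (?R g)) (x j)"
      by (intro F.ip_add_left x j bounded_opsD(1)[OF tr[OF j] e] bounded_opsD(1)[OF ob[OF j] g])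
    also have "\<dots> = ip E e (t j) + ip G g (\<eta> j)"
      unfolding t_def \<eta>_def
      using ip_hadj[OF E.hilb_axioms F.semi_hilb_axioms tr[OF j] x[OF j] e]
        ip_hadj[OF G.hilb_axioms F.semi_hilb_axioms ob[OF j] x[OF j] g] by simp
    finally show "ip (hsum F (hpow G)) (U u) (a j) = ip (hsum E G) u (t j, \<eta> j)"
      by (simp add: u)
  qed
  let ?S = "hadj (hsum E G) (hsum F (hpow G)) U"
  have "psd J (\<lambda>i j. ip (hsum F (hpow G)) (a i) (a j) - ip (hsum E G) (?S (a i)) (?S (a j)))"
    by (rule psd_contraction[OF T.hilb_axioms S.semi_hilb_axioms U contr a])
  then have "psd J (\<lambda>i j. ip F (x i) (x j) - ip E (t i) (t j) - (1 - cdot (w j) (w i)) * ip G (\<eta> i) (\<eta> j))"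
  proof (rule psd_cong)
    fix i j assume ij: "i \<in> J" "j \<in> J"
    have "ip (hsum F (hpow G)) (a i) (a j) = ip F (x i) (x j) + cdot (w j) (w i) * ip G (\<eta> i) (\<eta> j)"
      using \<eta> ij by (simp add: a_def cdot_def sum_distrib_left mult_ac)
    then show "ip (hsum F (hpow G)) (a i) (a j) - ip (hsum E G) (?S (a i)) (?S (a j))
        = ip F (x i) (x j) - ip E (t i) (t j) - (1 - cdot (w j) (w i)) * ip G (\<eta> i) (\<eta> j)"
      unfolding adj[OF ij(1)] adj[OF ij(2)] by (simp add: algebra_simps)
  qed
  \<comment> \<open>Division by 1 - <w_j, w_i> preserves positivity and turns the state term into
    minus the Gram kernel of the \<eta> j, which is itself positive and can be added back.\<close>
  then have "psd J (\<lambda>i j. (ip F (x i) (x j) - ip E (t i) (t j) - (1 - cdot (w j) (w i)) * ip G (\<eta> i) (\<eta> j))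
      / (1 - cdot (w j) (w i)))"
    by (rule psd_szego_product[OF _ w])
  then have "psd J (\<lambda>i j. (ip F (x i) (x j) - ip E (t i) (t j) - (1 - cdot (w j) (w i)) * ip G (\<eta> i) (\<eta> j))
      / (1 - cdot (w j) (w i)) + ip G (\<eta> i) (\<eta> j))"
    using \<eta> by (intro psd_add G.psd_ip)
  then show ?thesis
  proof (rule psd_cong)
    fix i j assume "i \<in> J" "j \<in> J"
    then have "1 - cdot (w j) (w i) \<noteq> 0"
      using cmod_cdot_less_1[OF w w, of j i] by auto
    then show "(ip F (x i) (x j) - ip E (t i) (t j) - (1 - cdot (w j) (w i)) * ip G (\<eta> i) (\<eta> j))
        / (1 - cdot (w j) (w i)) + ip G (\<eta> i) (\<eta> j) =
        (ip F (x i) (x j) - ip E (hadj E F (transfer (w i)) (x i)) (hadj E F (transfer (w j)) (x j)))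
        / (1 - cdot (w j) (w i))"
      by (simp add: t_def diff_divide_distrib)
  qed
qed

end

text \<open>Lurking isometry: by the Gram identity the vectors a_j, formed from \<alpha> j and the
  column with entries cnj w_l \<gamma> j at the point w of j, have the same inner products as the
  pairs (\<beta> j, \<gamma> j). So there is a contraction \<open>U\<close> with U^* a_j = (\<beta>
  j, \<gamma> j); the second conclusion is this equation paired with (e, g).\<close>

lemma realization:
  fixes w :: "'j \<Rightarrow> complex ^ 'n"
  assumes E: "hilb E" and F: "hilb F" and G: "hilb G"
    and \<alpha>: "\<And>j. j \<in> J \<Longrightarrow> \<alpha> j \<in> vecs F" and \<beta>: "\<And>j. j \<in> J \<Longrightarrow> \<beta> j \<in> vecs E"
    and \<gamma>: "\<And>j. j \<in> J \<Longrightarrow> \<gamma> j \<in> vecs G"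
    and gram: "\<And>i j. i \<in> J \<Longrightarrow> j \<in> J \<Longrightarrow>
      ip F (\<alpha> i) (\<alpha> j) + cdot (w j) (w i) * ip G (\<gamma> i) (\<gamma> j) = ip E (\<beta> i) (\<beta> j) + ip G (\<gamma> i) (\<gamma> j)"
  obtains U :: "'e::complex_vector \<times> 'g::complex_vector \<Rightarrow> 'f::complex_vector \<times> ('n \<Rightarrow> 'g)"
  where "colligation E F G U"
    "\<And>e g j. e \<in> vecs E \<Longrightarrow> g \<in> vecs G \<Longrightarrow> j \<in> J \<Longrightarrow>
      ip F (colligation.opA U e + colligation.opC U g) (\<alpha> j)
        + ip G (row_op (colligation.opB U) (w j) e + row_op (colligation.opD U) (w j) g) (\<gamma> j)
      = ip E e (\<beta> j) + ip G g (\<gamma> j)"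
proof -
  interpret E: hilb E by fact
  interpret F: hilb F by fact
  interpret G: hilb G by fact
  interpret S: hilb "hsum F (hpow G :: ('n \<Rightarrow> 'g) hilbert)" by (intro hilb_hsum hilb_hpow F G)
  interpret T: hilb "hsum E G" by (intro hilb_hsum E G)
  define a where "a j = (\<alpha> j, \<lambda>l. cnj (w j $ l) *\<^sub>C \<gamma> j)" for j
  have a: "a j \<in> vecs (hsum F (hpow G))" if "j \<in> J" for j using \<alpha> \<gamma> that by (simp add: a_def)
  have b: "(\<beta> j, \<gamma> j) \<in> vecs (hsum E G)" if "j \<in> J" for j using \<beta> \<gamma> that by simp
  have psd: "psd J (\<lambda>i j. ip (hsum F (hpow G)) (a i) (a j) - ip (hsum E G) (\<beta> i, \<gamma> i) (\<beta> j, \<gamma> j))"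
  proof (rule psd_eq_0I)
    fix i j assume ij: "i \<in> J" "j \<in> J"
    have "ip (hsum F (hpow G)) (a i) (a j) = ip F (\<alpha> i) (\<alpha> j) + cdot (w j) (w i) * ip G (\<gamma> i) (\<gamma> j)"
      using \<gamma> ij by (simp add: a_def cdot_def sum_distrib_left mult_ac)
    then show "ip (hsum F (hpow G)) (a i) (a j) - ip (hsum E G) (\<beta> i, \<gamma> i) (\<beta> j, \<gamma> j) = 0"
      using gram[OF ij] by simp
  qed
  obtain U where U_props: "U \<in> bounded_ops (hsum E G) (hsum F (hpow G))"
    "\<And>p. p \<in> vecs (hsum E G) \<Longrightarrow> hnorm (hsum F (hpow G)) (U p) \<le> hnorm (hsum E G) p"
    "\<And>p j. p \<in> vecs (hsum E G) \<Longrightarrow> j \<in> J \<Longrightarrow> ip (hsum F (hpow G)) (U p) (a j) = ip (hsum E G) p (\<beta> j, \<gamma> j)"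
    by (rule contraction_from_gram[OF S.hilb_axioms T.semi_hilb_axioms, of J a "\<lambda>j. (\<beta> j, \<gamma> j)"])
      (rule psd | rule that | rule a | rule b | assumption)+
  interpret colligation E F G U by standard (use U_props in auto)
  show thesis
  proof (rule that[OF colligation_axioms])
    fix e g j assume e: "e \<in> vecs E" and g: "g \<in> vecs G" and j: "j \<in> J"
    have "ip G (row_op opB (w j) e + row_op opD (w j) g) (\<gamma> j)
        = (\<Sum>l\<in>UNIV. ip G (opB l e + opD l g) (cnj (w j $ l) *\<^sub>C \<gamma> j))"
      by (rule ip_row_op[OF e g \<gamma>[OF j], symmetric])
    then show "ip F (opA e + opC g) (\<alpha> j) + ip G (row_op opB (w j) e + row_op opD (w j) g) (\<gamma> j)
        = ip E e (\<beta> j) + ip G g (\<gamma> j)"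
      using U_props(3)[of "(e, g)" j] e g j by (simp add: U_eq[OF e g] a_def)
  qed
qed

section \<open>The spaces with kernel \<open>(1 - \<langle>z,w\<rangle>)\<^sup>-\<^sup>m I\<close>\<close>

lemma bounded_ops_cong:
  assumes T: "T \<in> bounded_ops H K" and H: "semi_hilb H" and eq: "\<And>x. x \<in> vecs H \<Longrightarrow> T x = S x"
  shows "S \<in> bounded_ops H K"
proof -
  interpret semi_hilb H by fact
  have "S (x + y) = S x + S y" if "x \<in> vecs H" "y \<in> vecs H" for x y
    using bounded_opsD(2)[OF T that] eq that by simp
  moreover have "S (a *\<^sub>C x) = a *\<^sub>C S x" if "x \<in> vecs H" for a x
    using bounded_opsD(3)[OF T that] eq that by simp
  moreover obtain c where "\<And>x. x \<in> vecs H \<Longrightarrow> hnorm K (T x) \<le> c * hnorm H x"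
    by (rule bounded_ops_bound[OF T H]) blast
  ultimately show ?thesis
    using bounded_opsD(1)[OF T] eq by (intro bounded_opsI[where c = c]) auto
qed

lemma qdiff_cong:
  fixes \<Phi> :: "complex ^ 'n \<Rightarrow> 'a::complex_vector \<Rightarrow> 'b::complex_vector"
  assumes \<Phi>: "qdiff E F \<Phi>" and E: "semi_hilb E"
    and eq: "\<And>z x. z \<in> unit_ball \<Longrightarrow> x \<in> vecs E \<Longrightarrow> \<Phi> z x = \<Psi> z x"
  shows "qdiff E F \<Psi>"
  unfolding qdiff_def
proof (intro ballI conjI)
  fix z :: "complex ^ 'n" assume z: "z \<in> unit_ball"
  show "\<Psi> z \<in> bounded_ops E F"
    by (rule bounded_ops_cong[OF qdiff_bounded_ops[OF \<Phi> z] E eq[OF z]])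
  obtain D c r where "qdiff_at E F \<Phi> z D c r"
    using qdiffD[OF \<Phi> z] by metis
  then have "qdiff_at E F \<Psi> z D c r"
    using eq z by (simp add: qdiff_at_def)
  then show "\<exists>D c r. qdiff_at E F \<Psi> z D c r" by blast
qed

lemma cnj_cdot: "cnj (cdot z w) = cdot w z"
  by (simp add: cdot_def mult.commute)

text \<open>The inner product of a model space \<open>G\<close> is moved along \<tau> to functions.
  The vectors \<gamma> w y stand for the kernel functions: \<open>rep\<close> and
  \<open>gram\<close> identify their images with \<open>kernel_fun\<close>, and \<open>total\<close>
  makes \<tau> injective.\<close>

lemma is_rkhs_transport:
  fixes \<tau> :: "'g::complex_vector \<Rightarrow> complex ^ 'n \<Rightarrow> 'a::complex_vector"
    and \<gamma> :: "complex ^ 'n \<Rightarrow> 'a \<Rightarrow> 'g"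
  assumes E: "hilb E" and G: "hilb G"
    and q: "qdiff G E (\<lambda>z \<phi>. \<tau> \<phi> z)" and off: "\<And>\<phi> z. z \<notin> unit_ball \<Longrightarrow> \<tau> \<phi> z = 0"
    and \<gamma>: "\<And>w y. w \<in> unit_ball \<Longrightarrow> y \<in> vecs E \<Longrightarrow> \<gamma> w y \<in> vecs G"
    and rep: "\<And>\<phi> w y. \<phi> \<in> vecs G \<Longrightarrow> w \<in> unit_ball \<Longrightarrow> y \<in> vecs E \<Longrightarrow> ip E (\<tau> \<phi> w) y = ip G \<phi> (\<gamma> w y)"
    and total: "\<And>\<phi>. \<phi> \<in> vecs G \<Longrightarrow>
      (\<And>w y. w \<in> unit_ball \<Longrightarrow> y \<in> vecs E \<Longrightarrow> ip G \<phi> (\<gamma> w y) = 0) \<Longrightarrow> \<phi> = 0"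
    and gram: "\<And>w y z x. w \<in> unit_ball \<Longrightarrow> y \<in> vecs E \<Longrightarrow> z \<in> unit_ball \<Longrightarrow> x \<in> vecs E \<Longrightarrow>
      ip G (\<gamma> w y) (\<gamma> z x) = 1 / (1 - cdot z w) ^ m * ip E y x"
  shows "\<exists>H :: (complex ^ 'n \<Rightarrow> 'a) hilbert. is_rkhs m E H \<and> qdiff H E (\<lambda>z f. f z)"
proof -
  interpret E: hilb E by fact
  interpret G: hilb G by fact
  note \<tau>_op = qdiff_bounded_ops[OF q]
  have \<tau>_in: "\<tau> \<phi> z \<in> vecs E" if "\<phi> \<in> vecs G" "z \<in> unit_ball" for \<phi> z
    using bounded_opsD(1)[OF \<tau>_op that(1)] that(2) by blast
  have \<tau>_add: "\<tau> (\<phi> + \<psi>) = \<tau> \<phi> + \<tau> \<psi>" if "\<phi> \<in> vecs G" "\<psi> \<in> vecs G" for \<phi> \<psi>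
  proof
    fix z show "\<tau> (\<phi> + \<psi>) z = (\<tau> \<phi> + \<tau> \<psi>) z"
      using bounded_opsD(2)[OF \<tau>_op that, of z] off by (cases "z \<in> unit_ball") auto
  qed
  have \<tau>_scale: "\<tau> (a *\<^sub>C \<phi>) = a *\<^sub>C \<tau> \<phi>" if "\<phi> \<in> vecs G" for a \<phi>
  proof
    fix z show "\<tau> (a *\<^sub>C \<phi>) z = (a *\<^sub>C \<tau> \<phi>) z"
      using bounded_opsD(3)[OF \<tau>_op that, of z] off by (cases "z \<in> unit_ball") (auto simp: scaleC_fun_def)
  qed
  have \<tau>_diff: "\<tau> (\<phi> - \<psi>) = \<tau> \<phi> - \<tau> \<psi>" if "\<phi> \<in> vecs G" "\<psi> \<in> vecs G" for \<phi> \<psi>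
    using \<tau>_add[of "\<phi> - \<psi>" \<psi>] that by simp
  have \<tau>_0: "\<tau> 0 = 0" using \<tau>_scale[of 0 0] by simp
  have inj: "inj_on \<tau> (vecs G)"
  proof (rule inj_onI)
    fix \<phi> \<psi> assume \<phi>: "\<phi> \<in> vecs G" "\<psi> \<in> vecs G" "\<tau> \<phi> = \<tau> \<psi>"
    have "\<phi> - \<psi> = 0"
    proof (rule total)
      fix w :: "complex ^ 'n" and y assume "w \<in> unit_ball" "y \<in> vecs E"
      then show "ip G (\<phi> - \<psi>) (\<gamma> w y) = 0"
        using rep[of "\<phi> - \<psi>" w y] \<phi> by (simp add: \<tau>_diff)
    qed (use \<phi> in auto)
    then show "\<phi> = \<psi>" by simp
  qed
  define \<sigma> where "\<sigma> = inv_into (vecs G) \<tau>"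
  have \<sigma>: "\<sigma> (\<tau> \<phi>) = \<phi>" if "\<phi> \<in> vecs G" for \<phi>
    unfolding \<sigma>_def by (rule inv_into_f_f[OF inj that])
  \<comment> \<open>The value 0 off the image is the one prescribed by the last conjunct of
    \<open>is_rkhs\<close>.\<close>
  define H where "H = \<lparr>vecs = \<tau> ` vecs G,
    ip = \<lambda>f g. if f \<in> \<tau> ` vecs G \<and> g \<in> \<tau> ` vecs G then ip G (\<sigma> f) (\<sigma> g) else 0\<rparr>"
  have vecs_H: "vecs H = \<tau> ` vecs G" by (simp add: H_def)
  have ip_H: "ip H (\<tau> \<phi>) (\<tau> \<psi>) = ip G \<phi> \<psi>" if "\<phi> \<in> vecs G" "\<psi> \<in> vecs G" for \<phi> \<psi>
    using that by (simp add: H_def \<sigma>)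
  have norm_H: "hnorm H (\<tau> \<phi>) = hnorm G \<phi>" if "\<phi> \<in> vecs G" for \<phi>
    using ip_H[OF that that] by (simp add: hnorm_def)
  have H: "complex_hilbert H"
  proof (rule complex_hilbertI)
    show "semi_hilbert H"
      unfolding semi_hilbert_def vecs_H
    proof (intro conjI ballI allI; (elim imageE)?)
      show "cvs.subspace (\<tau> ` vecs G)"
      proof (rule cvs.subspaceI)
        show "0 \<in> \<tau> ` vecs G" using \<tau>_0 by (intro image_eqI[of _ _ 0]) auto
        show "f + g \<in> \<tau> ` vecs G" if "f \<in> \<tau> ` vecs G" "g \<in> \<tau> ` vecs G" for f g
          using that by (auto simp: \<tau>_add[symmetric])
        show "a *\<^sub>C f \<in> \<tau> ` vecs G" if "f \<in> \<tau> ` vecs G" for a f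
          using that by (auto simp: \<tau>_scale[symmetric])
      qed
      show "ip H g f = cnj (ip H f g)"
        if "f = \<tau> \<phi>" "\<phi> \<in> vecs G" "g = \<tau> \<psi>" "\<psi> \<in> vecs G" for f g \<phi> \<psi>
        using that G.ip_cnj[of \<phi> \<psi>] by (simp add: ip_H)
    qed (auto simp: \<tau>_add[symmetric] \<tau>_scale[symmetric] ip_H G.ip_nonneg)
    show "f = 0" if "f \<in> vecs H" "hnorm H f = 0" for f
      using that by (auto simp: vecs_H norm_H \<tau>_0)
    fix s :: "nat \<Rightarrow> complex ^ 'n \<Rightarrow> 'a"
    assume s: "\<And>k. s k \<in> vecs H"
      and cauchy: "\<And>e. e > 0 \<Longrightarrow> \<exists>N. \<forall>i\<ge>N. \<forall>j\<ge>N. hnorm H (s i - s j) < e"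
    obtain t where t: "\<And>k. t k \<in> vecs G" "\<And>k. s k = \<tau> (t k)"
      using s unfolding vecs_H image_iff by metis
    have "hnorm H (s i - s j) = hnorm G (t i - t j)" for i j
      using t norm_H[of "t i - t j"] by (simp add: \<tau>_diff)
    then obtain \<phi> where \<phi>: "\<phi> \<in> vecs G" "(\<lambda>k. hnorm G (t k - \<phi>)) \<longlonglongrightarrow> 0"
      using G.complete[of t] t(1) cauchy by metis
    have "hnorm H (s k - \<tau> \<phi>) = hnorm G (t k - \<phi>)" for k
      using t \<phi> norm_H[of "t k - \<phi>"] by (simp add: \<tau>_diff)
    then show "\<exists>f\<in>vecs H. (\<lambda>k. hnorm H (s k - f)) \<longlonglongrightarrow> 0"
      using \<phi> by (intro bexI[of _ "\<tau> \<phi>"]) (auto simp: vecs_H)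
  qed
  then interpret H: hilb H by (rule hilb.intro)
  \<comment> \<open>Evaluation on \<open>H\<close> is evaluation on \<open>G\<close> preceded by the
    isometry \<sigma>, so it inherits \<open>qdiff\<close>.\<close>
  have "\<sigma> \<in> bounded_ops H G"
  proof (rule bounded_opsI[where c = 1])
    show "\<sigma> f \<in> vecs G" if "f \<in> vecs H" for f using that by (auto simp: vecs_H \<sigma>)
    show "\<sigma> (f + g) = \<sigma> f + \<sigma> g" if "f \<in> vecs H" "g \<in> vecs H" for f g
      using that by (auto simp: vecs_H \<sigma> \<tau>_add[symmetric])
    show "\<sigma> (a *\<^sub>C f) = a *\<^sub>C \<sigma> f" if "f \<in> vecs H" for a f
      using that by (auto simp: vecs_H \<sigma> \<tau>_scale[symmetric])
    show "hnorm G (\<sigma> f) \<le> 1 * hnorm H f" if "f \<in> vecs H" for f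
      using that by (auto simp: vecs_H \<sigma> norm_H)
  qed
  then have "qdiff H E (\<lambda>z f. \<tau> (\<sigma> f) z)"
    by (rule qdiff_compose[OF H.hilb_axioms G E qdiff_const[OF H.hilb_axioms G] q])
  then have ev: "qdiff H E (\<lambda>z f. f z)"
    by (rule qdiff_cong[OF _ H.semi_hilb_axioms]) (auto simp: vecs_H \<sigma>)
  have kernel: "\<tau> (\<gamma> w x) = kernel_fun m w x" if w: "w \<in> unit_ball" and x: "x \<in> vecs E" for w x
  proof
    fix z show "\<tau> (\<gamma> w x) z = kernel_fun m w x z"
    proof (cases "z \<in> unit_ball")
      case True
      have "\<tau> (\<gamma> w x) z = (1 / (1 - cdot z w) ^ m) *\<^sub>C x"
      proof (rule E.vec_eqI)
        show "\<tau> (\<gamma> w x) z \<in> vecs E" using \<tau>_in[OF \<gamma>[OF w x] True] .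
        show "(1 / (1 - cdot z w) ^ m) *\<^sub>C x \<in> vecs E" using x by simp
        show "ip E (\<tau> (\<gamma> w x) z) u = ip E ((1 / (1 - cdot z w) ^ m) *\<^sub>C x) u" if "u \<in> vecs E" for u
          using rep[OF \<gamma>[OF w x] True that] gram[OF w x True that] x that by simp
      qed
      then show ?thesis using True by (simp add: kernel_fun_def)
    qed (simp add: off kernel_fun_def)
  qed
  have "is_rkhs m E H"
    unfolding is_rkhs_def
  proof (intro conjI ballI allI impI)
    show "complex_hilbert H" by fact
    show "holomorphic_vec E f" if "f \<in> vecs H" for f
      using qdiff_holomorphic_vec[OF H.hilb_axioms E ev that] .
    show "f z = 0" if "f \<in> vecs H" "z \<notin> unit_ball" for f z
      using that by (auto simp: vecs_H off)
    fix w :: "complex ^ 'n" and x assume w: "w \<in> unit_ball" and x: "x \<in> vecs E"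
    show "kernel_fun m w x \<in> vecs H"
      using kernel[OF w x] \<gamma>[OF w x] by (metis vecs_H image_eqI)
    show "ip H f (kernel_fun m w x) = ip E (f w) x" if "f \<in> vecs H" for f
      using that kernel[OF w x, symmetric] \<gamma>[OF w x] rep w x by (auto simp: vecs_H ip_H)
  next
    show "ip H f g = 0" if "f \<notin> vecs H \<or> g \<notin> vecs H" for f g
      using that by (auto simp: H_def)
  qed
  with ev show ?thesis by blast
qed

section \<open>Uniqueness of the reproducing kernel space\<close>

lemma is_rkhsD:
  assumes "is_rkhs m E H"
  shows "hilb H"
    and "f \<in> vecs H \<Longrightarrow> z \<in> unit_ball \<Longrightarrow> f z \<in> vecs E"
    and "f \<in> vecs H \<Longrightarrow> z \<notin> unit_ball \<Longrightarrow> f z = 0"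
    and "w \<in> unit_ball \<Longrightarrow> x \<in> vecs E \<Longrightarrow> kernel_fun m w x \<in> vecs H"
    and "w \<in> unit_ball \<Longrightarrow> x \<in> vecs E \<Longrightarrow> f \<in> vecs H \<Longrightarrow> ip H f (kernel_fun m w x) = ip E (f w) x"
    and "f \<notin> vecs H \<or> g \<notin> vecs H \<Longrightarrow> ip H f g = 0"
  using assms unfolding is_rkhs_def holomorphic_ball_def hilb_def by blast+

lemma is_rkhs_gram:
  assumes H: "is_rkhs m E H" and E: "hilb E"
    and "w \<in> unit_ball" "x \<in> vecs E" "z \<in> unit_ball" "y \<in> vecs E"
  shows "ip H (kernel_fun m w x) (kernel_fun m z y) = 1 / (1 - cdot z w) ^ m * ip E x y"
proof -
  interpret hilb E by fact
  show ?thesis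
    using is_rkhsD(5)[OF H assms(5,6) is_rkhsD(4)[OF H assms(3,4)]] assms
    by (simp add: kernel_fun_def)
qed

lemma is_rkhs_eqI:
  fixes H K :: "(complex ^ 'n \<Rightarrow> 'a::complex_vector) hilbert"
  assumes H: "is_rkhs m E H" and K: "is_rkhs p E K" and E: "hilb E" and f: "f \<in> vecs H" and g: "g \<in> vecs K"
    and eq: "\<And>w x. w \<in> unit_ball \<Longrightarrow> x \<in> vecs E \<Longrightarrow> ip E (f w) x = ip E (g w) x"
  shows "f = g"
proof
  interpret hilb E by fact
  fix z show "f z = g z"
  proof (cases "z \<in> unit_ball")
    case True
    then show ?thesis
      using is_rkhsD(2)[OF H f] is_rkhsD(2)[OF K g] eq by (intro vec_eqI) auto
  next
    case False
    then show ?thesis using is_rkhsD(3)[OF H f] is_rkhsD(3)[OF K g] by simp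
  qed
qed

text \<open>The kernel functions have the same Gram matrix in both spaces, so
  \<open>contraction_from_gram\<close> gives a contraction from \<open>H\<close> to \<open>K\<close>
  that preserves inner products with them; the reproducing property forces it to fix every
  function.\<close>

lemma is_rkhs_contained:
  fixes H K :: "(complex ^ 'n \<Rightarrow> 'a::complex_vector) hilbert"
  assumes H: "is_rkhs m E H" and K: "is_rkhs m E K" and E: "hilb E" and f: "f \<in> vecs H"
  shows "f \<in> vecs K \<and> hnorm K f \<le> hnorm H f"
proof -
  interpret H: hilb H using is_rkhsD(1)[OF H] .
  interpret K: hilb K using is_rkhsD(1)[OF K] .
  define J :: "((complex ^ 'n) \<times> 'a) set" where "J = unit_ball \<times> vecs E"
  define k where "k = (\<lambda>(w, x). kernel_fun m w x :: complex ^ 'n \<Rightarrow> 'a)"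
  have k: "k j \<in> vecs H" "k j \<in> vecs K" if "j \<in> J" for j
    using that is_rkhsD(4)[OF H] is_rkhsD(4)[OF K] by (auto simp: J_def k_def)
  have psd: "psd J (\<lambda>i j. ip K (k i) (k j) - ip H (k i) (k j))"
    by (rule psd_eq_0I) (use is_rkhs_gram[OF H E] is_rkhs_gram[OF K E] in \<open>auto simp: J_def k_def\<close>)
  obtain U where U: "U \<in> bounded_ops H K" "\<And>f. f \<in> vecs H \<Longrightarrow> hnorm K (U f) \<le> hnorm H f"
    "\<And>f j. f \<in> vecs H \<Longrightarrow> j \<in> J \<Longrightarrow> ip K (U f) (k j) = ip H f (k j)"
    by (rule contraction_from_gram[OF K.hilb_axioms H.semi_hilb_axioms, of J k k])
      (rule psd | rule that | rule k | assumption)+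
  have Uf: "U f \<in> vecs K" using bounded_opsD(1)[OF U(1) f] .
  have "U f = f"
  proof (rule is_rkhs_eqI[OF K H E Uf f])
    fix w :: "complex ^ 'n" and x assume "w \<in> unit_ball" "x \<in> vecs E"
    then show "ip E (U f w) x = ip E (f w) x"
      using U(3)[OF f, of "(w, x)"] is_rkhsD(5)[OF H _ _ f] is_rkhsD(5)[OF K _ _ Uf]
      by (simp add: J_def k_def)
  qed
  then show ?thesis using Uf U(2)[OF f] by simp
qed

text \<open>Containment in both directions gives equal vectors and norms, polarization equal inner
  products. Off the vectors the last conjunct of \<open>is_rkhs\<close> decides, so even the records
  agree.\<close>

lemma is_rkhs_unique:
  fixes H K :: "(complex ^ 'n \<Rightarrow> 'a::complex_vector) hilbert"
  assumes H: "is_rkhs m E H" and K: "is_rkhs m E K" and E: "hilb E"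
  shows "H = K"
proof -
  interpret H: hilb H using is_rkhsD(1)[OF H] .
  interpret K: hilb K using is_rkhsD(1)[OF K] .
  have vecs: "vecs H = vecs K"
    using is_rkhs_contained[OF H K E] is_rkhs_contained[OF K H E] by blast
  have norm: "hnorm H f = hnorm K f" if "f \<in> vecs H" for f
    using is_rkhs_contained[OF H K E that] is_rkhs_contained[OF K H E] by (simp add: order_antisym)
  have Re_eq: "Re (ip H f g) = Re (ip K f g)" if "f \<in> vecs H" "g \<in> vecs H" for f g
    using H.polarization(1)[OF that] K.polarization(1)[of f g] that vecs
      norm[OF H.add_in[OF that]] norm[OF H.diff_in[OF that]] by simp
  have "ip H f g = ip K f g" for f g
  proof (cases "f \<in> vecs H \<and> g \<in> vecs H")
    case True
    then have fg: "f \<in> vecs H" "g \<in> vecs H" "f \<in> vecs K" "g \<in> vecs K" using vecs by auto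
    show ?thesis
      using Re_eq[OF fg(1,2)] Re_eq[OF H.scale_in[OF fg(1)] fg(2), of "- \<i>"]
        H.polarization(2)[OF fg(1,2)] K.polarization(2)[OF fg(3,4)] by (intro complex_eqI) simp_all
  next
    case False
    then show ?thesis using is_rkhsD(6)[OF H, of f g] is_rkhsD(6)[OF K, of f g] vecs by auto
  qed
  then show ?thesis using vecs by (intro hilbert.equality) auto
qed

section \<open>Existence of the reproducing kernel space, by induction on the exponent\<close>

lemma is_rkhs_0_exists:
  fixes E :: "'a::complex_vector hilbert"
  assumes E: "hilb E"
  shows "\<exists>H :: (complex ^ 'n \<Rightarrow> 'a) hilbert. is_rkhs 0 E H \<and> qdiff H E (\<lambda>z f. f z)"
proof -
  interpret hilb E by fact
  \<comment> \<open>For exponent 0 the kernel is constant and the space consists of the functions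
    constant on the ball, so \<open>E\<close> itself is the model.\<close>
  have q: "qdiff E E (\<lambda>z x. if z \<in> unit_ball then x else 0)"
    by (rule qdiff_cong[OF qdiff_const[OF E E bounded_ops_id[OF semi_hilb_axioms]] semi_hilb_axioms]) simp
  show ?thesis
  proof (rule is_rkhs_transport[OF E E, of "\<lambda>x z. if z \<in> unit_ball then x else 0" "\<lambda>_ y. y"])
    fix x assume x: "x \<in> vecs E"
      and orth: "\<And>(w :: complex ^ 'n) y. w \<in> unit_ball \<Longrightarrow> y \<in> vecs E \<Longrightarrow> ip E x y = 0"
    show "x = 0" using orth[of 0 x] x by (intro ip_self_eq_0) simp_all
  qed (use q in auto)
qed

text \<open>Since \<open>k\<^sub>m\<^sub>+\<^sub>1 = k\<^sub>m + \<langle>z,w\<rangle> k\<^sub>m\<^sub>+\<^sub>1\<close>, the lurking isometry argument represents the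
  functions with kernel \<open>k\<^sub>m\<^sub>+\<^sub>1\<close> as \<open>z \<mapsto> (C (1 - z D)\<^sup>-\<^sup>1 \<phi>)(z)\<close> where \<open>C\<close> takes values in the space with
  kernel \<open>k\<^sub>m\<close>. This makes them holomorphic.\<close>

lemma is_rkhs_Suc_exists:
  fixes E :: "'a::complex_vector hilbert" and F :: "(complex ^ 'n \<Rightarrow> 'a) hilbert"
  assumes E: "hilb E" and F: "is_rkhs m E F" and evF: "qdiff F E (\<lambda>z f. f z)"
  shows "\<exists>H :: (complex ^ 'n \<Rightarrow> 'a) hilbert. is_rkhs (Suc m) E H \<and> qdiff H E (\<lambda>z f. f z)"
proof -
  interpret E: hilb E by fact
  interpret F: hilb F using is_rkhsD(1)[OF F] .
  define J :: "((complex ^ 'n) \<times> 'a) set" where "J = unit_ball \<times> vecs E"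
  define L where "L = (\<lambda>i j :: (complex ^ 'n) \<times> 'a.
    1 / (1 - cdot (fst j) (fst i)) ^ Suc m * ip E (snd i) (snd j))"
  define k where "k j = (kernel_fun m (fst j) (snd j) :: complex ^ 'n \<Rightarrow> 'a)" for j
  have k: "k j \<in> vecs F" if "j \<in> J" for j
    using that is_rkhsD(4)[OF F] by (auto simp: J_def k_def)
  have k_gram: "ip F (k i) (k j) = 1 / (1 - cdot (fst j) (fst i)) ^ m * ip E (snd i) (snd j)"
    if "i \<in> J" "j \<in> J" for i j
    using that is_rkhs_gram[OF F E] by (auto simp: J_def k_def)
  have "psd J (\<lambda>i j. ip F (k i) (k j) / (1 - cdot (fst j) (fst i)))"
    by (rule psd_szego_product[OF F.psd_ip[OF k]]) (auto simp: J_def)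
  then have psd: "psd J L"
    by (rule psd_cong) (simp add: k_gram L_def)
  have herm: "L j i = cnj (L i j)" if "i \<in> J" "j \<in> J" for i j
    using that E.ip_cnj[of "snd i" "snd j"] by (auto simp: L_def J_def cnj_cdot)
  obtain G :: "(((complex ^ 'n) \<times> 'a \<Rightarrow> complex) \<Rightarrow> complex) hilbert" and \<gamma>
    where G: "complex_hilbert G" and \<gamma>: "\<And>j. j \<in> J \<Longrightarrow> \<gamma> j \<in> vecs G"
      "\<And>i j. i \<in> J \<Longrightarrow> j \<in> J \<Longrightarrow> ip G (\<gamma> i) (\<gamma> j) = L i j"
      "\<And>f. f \<in> vecs G \<Longrightarrow> (\<And>j. j \<in> J \<Longrightarrow> ip G f (\<gamma> j) = 0) \<Longrightarrow> f = 0"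
    using kolmogorov[OF psd herm] by metis
  interpret G: hilb G by (rule hilb.intro[OF G])
  have nonzero: "1 - cdot z w \<noteq> 0" if "z \<in> unit_ball" "w \<in> unit_ball" for z w :: "complex ^ 'n"
    using cmod_cdot_less_1[OF that] by auto
  have gram: "ip F (k i) (k j) + cdot (fst j) (fst i) * ip G (\<gamma> i) (\<gamma> j) = ip F 0 0 + ip G (\<gamma> i) (\<gamma> j)"
    if "i \<in> J" "j \<in> J" for i j
    using that nonzero[of "fst j" "fst i"]
    by (auto simp: k_gram \<gamma>(2) L_def J_def field_simps)
  \<comment> \<open>The kernel identity has no input term, so all input vectors are 0 and
    \<open>F\<close> fills the input slot.\<close>
  obtain U where col: "colligation F F G U"
    and real: "\<And>e g j. e \<in> vecs F \<Longrightarrow> g \<in> vecs G \<Longrightarrow> j \<in> J \<Longrightarrow>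
      ip F (colligation.opA U e + colligation.opC U g) (k j)
        + ip G (row_op (colligation.opB U) (fst j) e + row_op (colligation.opD U) (fst j) g) (\<gamma> j)
      = ip F e 0 + ip G g (\<gamma> j)"
    by (rule realization[OF F.hilb_axioms F.hilb_axioms G.hilb_axioms,
          where J = J and \<alpha> = k and \<beta> = "\<lambda>_. 0" and \<gamma> = \<gamma> and w = fst])
      (rule k | rule F.zero_in | rule \<gamma>(1) | rule gram | rule that | assumption)+
  interpret colligation F F G U by (rule col)
  define \<tau> where "\<tau> \<phi> = (\<lambda>z. if z \<in> unit_ball then opC (res z \<phi>) z else 0)" for \<phi>
  show ?thesis
  proof (rule is_rkhs_transport[OF E G.hilb_axioms, of \<tau> "\<lambda>w y. \<gamma> (w, y)"])
    show "qdiff G E (\<lambda>z \<phi>. \<tau> \<phi> z)"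
      by (rule qdiff_cong[OF qdiff_compose[OF G.hilb_axioms F.hilb_axioms E qdiff_observation evF] G.semi_hilb_axioms])
        (simp add: \<tau>_def)
    fix \<phi> y and w :: "complex ^ 'n" assume \<phi>: "\<phi> \<in> vecs G" and w: "w \<in> unit_ball" and y: "y \<in> vecs E"
    have j: "(w, y) \<in> J" using w y by (simp add: J_def)
    define g where "g = res w \<phi>"
    have g: "g \<in> vecs G" and g_eq: "g = \<phi> + row_op opD w g"
      unfolding g_def using res_in[OF w \<phi>] res_eq[OF w \<phi>] by auto
    have Dg: "row_op opD w g \<in> vecs G" using bounded_opsD(1)[OF row_D g] .
    have zero: "opA 0 = 0" "row_op opB w 0 = 0"
      using bounded_ops_zero[OF opA F.semi_hilb_axioms] bounded_ops_zero[OF row_B F.semi_hilb_axioms] by auto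
    \<comment> \<open>With input 0 and state g = (1 - w D)^{-1} \<phi> the state terms of
      \<open>real\<close> cancel up to \<phi>; hence C g has the same inner products with the kernel
      functions of \<open>F\<close> as \<phi> has with the \<gamma> j.\<close>
    have "ip G g (\<gamma> (w, y)) = ip G \<phi> (\<gamma> (w, y)) + ip G (row_op opD w g) (\<gamma> (w, y))"
      using \<phi> Dg \<gamma>(1)[OF j] by (subst g_eq) simp
    then have "ip F (opC g) (k (w, y)) = ip G \<phi> (\<gamma> (w, y))"
      using real[OF F.zero_in g j] by (simp add: zero)
    then show "ip E (\<tau> \<phi> w) y = ip G \<phi> (\<gamma> (w, y))"
      using is_rkhsD(5)[OF F w y bounded_opsD(1)[OF opC g]] w by (simp add: \<tau>_def g_def k_def)
  next
    fix \<phi> assume \<phi>: "\<phi> \<in> vecs G" "\<And>(w :: complex ^ 'n) y. w \<in> unit_ball \<Longrightarrow> y \<in> vecs E \<Longrightarrow> ip G \<phi> (\<gamma> (w, y)) = 0"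
    then show "\<phi> = 0" by (intro \<gamma>(3)) (auto simp: J_def)
  qed (auto simp: \<tau>_def \<gamma> J_def L_def)
qed

text \<open>Existence by induction together with uniqueness makes the definite description denote,
  so \<open>rkhs\<close> inherits the properties of \<open>is_rkhs\<close>.\<close>

lemma rkhs:
  fixes E :: "'a::complex_vector hilbert"
  assumes E: "hilb E"
  shows is_rkhs_rkhs: "is_rkhs m E (rkhs m E :: (complex ^ 'n \<Rightarrow> 'a) hilbert)"
    and qdiff_rkhs: "qdiff (rkhs m E :: (complex ^ 'n \<Rightarrow> 'a) hilbert) E (\<lambda>z f. f z)"
proof -
  have "\<exists>H :: (complex ^ 'n \<Rightarrow> 'a) hilbert. is_rkhs m E H \<and> qdiff H E (\<lambda>z f. f z)"
  proof (induction m)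
    case 0
    show ?case by (rule is_rkhs_0_exists[OF E])
  next
    case (Suc m)
    then show ?case using is_rkhs_Suc_exists[OF E] by blast
  qed
  then obtain H :: "(complex ^ 'n \<Rightarrow> 'a) hilbert" where H: "is_rkhs m E H" "qdiff H E (\<lambda>z f. f z)"
    by blast
  have "rkhs m E = H"
    unfolding rkhs_def using H(1) is_rkhs_unique[OF _ H(1) E] by (rule the_equality)
  with H show "is_rkhs m E (rkhs m E :: (complex ^ 'n \<Rightarrow> 'a) hilbert)"
    "qdiff (rkhs m E :: (complex ^ 'n \<Rightarrow> 'a) hilbert) E (\<lambda>z f. f z)" by auto
qed

section \<open>Multipliers\<close>

lemma multiplierD:
  assumes "\<Phi> \<in> contractive_multipliers m E p F"
  shows "z \<in> unit_ball \<Longrightarrow> \<Phi> z \<in> bounded_ops E F"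
    and "f \<in> vecs (rkhs m E) \<Longrightarrow> mult_op \<Phi> f \<in> vecs (rkhs p F)"
    and "f \<in> vecs (rkhs m E) \<Longrightarrow> hnorm (rkhs p F) (mult_op \<Phi> f) \<le> hnorm (rkhs m E) f"
    and "holomorphic_op E F \<Phi>"
  using assms by (auto simp: contractive_multipliers_def holomorphic_ball_def)

lemma mult_op_bounded_ops:
  fixes \<Phi> :: "complex ^ 'n \<Rightarrow> 'a::complex_vector \<Rightarrow> 'b::complex_vector"
  assumes E: "hilb E" and \<Phi>: "\<Phi> \<in> contractive_multipliers m E p F"
  shows "mult_op \<Phi> \<in> bounded_ops (rkhs m E) (rkhs p F)"
proof (rule bounded_opsI[where c = 1])
  note val = is_rkhsD(2)[OF is_rkhs_rkhs[OF E]]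
  show "mult_op \<Phi> (f + g) = mult_op \<Phi> f + mult_op \<Phi> g"
    if "f \<in> vecs (rkhs m E)" "g \<in> vecs (rkhs m E)" for f g
    using bounded_opsD(2)[OF multiplierD(1)[OF \<Phi>] val[OF that(1)] val[OF that(2)]]
    by (simp add: mult_op_def fun_eq_iff)
  show "mult_op \<Phi> (a *\<^sub>C f) = a *\<^sub>C mult_op \<Phi> f" if "f \<in> vecs (rkhs m E)" for a f
    using bounded_opsD(3)[OF multiplierD(1)[OF \<Phi>] val[OF that]]
    by (simp add: mult_op_def scaleC_fun_def fun_eq_iff)
qed (use multiplierD(2,3)[OF \<Phi>] in simp_all)

text \<open>Paired with f, both sides give <\<Phi>(w) f(w), y>. All kernel computations with
  multipliers rest on this formula.\<close>

lemma hadj_mult_op: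
  fixes \<Phi> :: "complex ^ 'n \<Rightarrow> 'a::complex_vector \<Rightarrow> 'b::complex_vector"
  assumes E: "hilb E" and F: "hilb F" and \<Phi>: "\<Phi> \<in> contractive_multipliers m E p F"
    and w: "w \<in> unit_ball" and y: "y \<in> vecs F"
  shows "hadj (rkhs m E) (rkhs p F) (mult_op \<Phi>) (kernel_fun p w y) = kernel_fun m w (hadj E F (\<Phi> w) y)"
proof -
  interpret E: hilb E by fact
  interpret F: hilb F by fact
  note RE = is_rkhs_rkhs[where ?'n = 'n, OF E, of m] and RF = is_rkhs_rkhs[where ?'n = 'n, OF F, of p]
  interpret RE: hilb "rkhs m E :: (complex ^ 'n \<Rightarrow> 'a) hilbert" by (rule is_rkhsD(1)[OF RE])
  interpret RF: hilb "rkhs p F :: (complex ^ 'n \<Rightarrow> 'b) hilbert" by (rule is_rkhsD(1)[OF RF])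
  have adj: "hadj E F (\<Phi> w) y \<in> vecs E"
    by (rule hadj_in[OF E F.semi_hilb_axioms multiplierD(1)[OF \<Phi> w] y])
  show ?thesis
  proof (rule hadj_eqI[OF RE.hilb_axioms RF.semi_hilb_axioms mult_op_bounded_ops[OF E \<Phi>] is_rkhsD(4)[OF RF w y]
        is_rkhsD(4)[OF RE w adj]])
    fix f assume f: "f \<in> vecs (rkhs m E :: (complex ^ 'n \<Rightarrow> 'a) hilbert)"
    show "ip (rkhs p F) (mult_op \<Phi> f) (kernel_fun p w y) = ip (rkhs m E) f (kernel_fun m w (hadj E F (\<Phi> w) y))"
      using is_rkhsD(5)[OF RF w y multiplierD(2)[OF \<Phi> f]] is_rkhsD(5)[OF RE w adj f]
        ip_hadj[OF E F.semi_hilb_axioms multiplierD(1)[OF \<Phi> w] y is_rkhsD(2)[OF RE f w]] w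
      by (simp add: mult_op_def)
  qed
qed

text \<open>The kernel k_p I - k_m \<Phi>(z) \<Phi>(w)^* as a scalar kernel on pairs of a point and
  a vector, with w the point of i and z that of j. For a contractive multiplier it is the form of I
  - M M^* on kernel functions.\<close>

definition multiplier_defect ::
    "nat \<Rightarrow> 'a::complex_vector hilbert \<Rightarrow> nat \<Rightarrow> 'b::complex_vector hilbert \<Rightarrow>
     (complex ^ 'n \<Rightarrow> 'a \<Rightarrow> 'b) \<Rightarrow> (complex ^ 'n) \<times> 'b \<Rightarrow> (complex ^ 'n) \<times> 'b \<Rightarrow> complex" where
  "multiplier_defect m E p F \<Phi> i j = 1 / (1 - cdot (fst j) (fst i)) ^ p * ip F (snd i) (snd j)
     - 1 / (1 - cdot (fst j) (fst i)) ^ m *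
       ip E (hadj E F (\<Phi> (fst i)) (snd i)) (hadj E F (\<Phi> (fst j)) (snd j))"

text \<open>\<open>contraction_from_gram\<close> yields a contraction U whose adjoint sends the
  kernel function of w and y to that of w and \<Phi>(w)^* y. Pairing U f with kernel functions gives
  (U f)(z) = \<Phi>(z) f(z), so membership of \<Phi> f in the target and the norm bound come with
  U.\<close>

lemma multiplier_criterion:
  fixes \<Phi> :: "complex ^ 'n \<Rightarrow> 'a::complex_vector \<Rightarrow> 'b::complex_vector"
  assumes E: "hilb E" and F: "hilb F" and \<Phi>: "holomorphic_op E F \<Phi>"
    and psd: "psd (unit_ball \<times> vecs F) (multiplier_defect m E p F \<Phi>)"
  shows "\<Phi> \<in> contractive_multipliers m E p F"
proof -
  interpret E: hilb E by fact
  interpret F: hilb F by fact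
  note RE = is_rkhs_rkhs[where ?'n = 'n, OF E, of m] and RF = is_rkhs_rkhs[where ?'n = 'n, OF F, of p]
  interpret RE: hilb "rkhs m E :: (complex ^ 'n \<Rightarrow> 'a) hilbert" by (rule is_rkhsD(1)[OF RE])
  interpret RF: hilb "rkhs p F :: (complex ^ 'n \<Rightarrow> 'b) hilbert" by (rule is_rkhsD(1)[OF RF])
  have op: "\<Phi> z \<in> bounded_ops E F" if "z \<in> unit_ball" for z
    using \<Phi> that by (simp add: holomorphic_ball_def)
  define J :: "((complex ^ 'n) \<times> 'b) set" where "J = unit_ball \<times> vecs F"
  define t where "t j = hadj E F (\<Phi> (fst j)) (snd j)" for j
  have t: "t j \<in> vecs E" if "j \<in> J" for j
    using that hadj_in[OF E F.semi_hilb_axioms op] by (auto simp: t_def J_def)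
  define a where "a j = (kernel_fun p (fst j) (snd j) :: complex ^ 'n \<Rightarrow> 'b)" for j
  define b where "b j = (kernel_fun m (fst j) (t j) :: complex ^ 'n \<Rightarrow> 'a)" for j
  have a: "a j \<in> vecs (rkhs p F)" and b: "b j \<in> vecs (rkhs m E)" if "j \<in> J" for j
    using that is_rkhsD(4)[OF RF] is_rkhsD(4)[OF RE] t[OF that] by (auto simp: a_def b_def J_def)
  have psd': "psd J (\<lambda>i j. ip (rkhs p F) (a i) (a j) - ip (rkhs m E) (b i) (b j))"
    using psd unfolding J_def[symmetric]
  proof (rule psd_cong)
    fix i j assume ij: "i \<in> J" "j \<in> J"
    then have "fst i \<in> unit_ball" "snd i \<in> vecs F" "fst j \<in> unit_ball" "snd j \<in> vecs F"
      by (auto simp: J_def)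
    then show "multiplier_defect m E p F \<Phi> i j = ip (rkhs p F) (a i) (a j) - ip (rkhs m E) (b i) (b j)"
      unfolding a_def b_def multiplier_defect_def t_def[symmetric] using is_rkhs_gram[OF RF F] is_rkhs_gram[OF RE E] t ij by simp
  qed
  obtain U where U: "U \<in> bounded_ops (rkhs m E) (rkhs p F)"
    "\<And>f. f \<in> vecs (rkhs m E) \<Longrightarrow> hnorm (rkhs p F) (U f) \<le> hnorm (rkhs m E) f"
    "\<And>f j. f \<in> vecs (rkhs m E) \<Longrightarrow> j \<in> J \<Longrightarrow> ip (rkhs p F) (U f) (a j) = ip (rkhs m E) f (b j)"
    by (rule contraction_from_gram[OF RF.hilb_axioms RE.semi_hilb_axioms, of J a b])
      (rule psd' | rule that | rule a | rule b | assumption)+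
  have "U f = mult_op \<Phi> f" if f: "f \<in> vecs (rkhs m E)" for f
  proof
    fix z
    show "U f z = mult_op \<Phi> f z"
    proof (cases "z \<in> unit_ball")
      case True
      have Uf: "U f \<in> vecs (rkhs p F)" using bounded_opsD(1)[OF U(1) f] .
      have fz: "f z \<in> vecs E" using is_rkhsD(2)[OF RE f True] .
      have "U f z = \<Phi> z (f z)"
      proof (rule F.vec_eqI)
        show "U f z \<in> vecs F" using is_rkhsD(2)[OF RF Uf True] .
        show "\<Phi> z (f z) \<in> vecs F" using bounded_opsD(1)[OF op[OF True] fz] .
        fix y assume y: "y \<in> vecs F"
        then have j: "(z, y) \<in> J" using True by (simp add: J_def)
        show "ip F (U f z) y = ip F (\<Phi> z (f z)) y"
          using U(3)[OF f j] is_rkhsD(5)[OF RF True y Uf] is_rkhsD(5)[OF RE True t[OF j] f]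
            ip_hadj[OF E F.semi_hilb_axioms op[OF True] y fz]
          by (simp add: a_def b_def t_def)
      qed
      then show ?thesis using True by (simp add: mult_op_def)
    next
      case False
      then show ?thesis
        using is_rkhsD(3)[OF RF bounded_opsD(1)[OF U(1) f]] by (simp add: mult_op_def)
    qed
  qed
  then have "mult_op \<Phi> f \<in> vecs (rkhs p F) \<and> hnorm (rkhs p F) (mult_op \<Phi> f) \<le> hnorm (rkhs m E) f"
    if "f \<in> vecs (rkhs m E)" for f
    using bounded_opsD(1)[OF U(1) that] U(2)[OF that] that by simp
  then show ?thesis
    using \<Phi> by (simp add: contractive_multipliers_def)
qed

text \<open>M M^* = I tested between two kernel functions.\<close>

lemma coisometric_multiplier_kernel:
  fixes \<Phi> :: "complex ^ 'n \<Rightarrow> 'a::complex_vector \<Rightarrow> 'b::complex_vector"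
  assumes E: "hilb E" and F: "hilb F" and \<Phi>: "\<Phi> \<in> coisometric_multipliers m E p F"
    and w: "w \<in> unit_ball" and y: "y \<in> vecs F" and z: "z \<in> unit_ball" and x: "x \<in> vecs F"
  shows "1 / (1 - cdot z w) ^ m * ip E (hadj E F (\<Phi> w) y) (hadj E F (\<Phi> z) x)
    = 1 / (1 - cdot z w) ^ p * ip F y x"
proof -
  interpret E: hilb E by fact
  interpret F: hilb F by fact
  note RE = is_rkhs_rkhs[where ?'n = 'n, OF E, of m] and RF = is_rkhs_rkhs[where ?'n = 'n, OF F, of p]
  interpret RE: hilb "rkhs m E :: (complex ^ 'n \<Rightarrow> 'a) hilbert" by (rule is_rkhsD(1)[OF RE])
  interpret RF: hilb "rkhs p F :: (complex ^ 'n \<Rightarrow> 'b) hilbert" by (rule is_rkhsD(1)[OF RF])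
  have cm: "\<Phi> \<in> contractive_multipliers m E p F"
    and coiso: "coisometric (rkhs m E) (rkhs p F) (mult_op \<Phi>)"
    using \<Phi> by (auto simp: coisometric_multipliers_def)
  note T = mult_op_bounded_ops[OF E cm]
  let ?k = "kernel_fun p w y :: complex ^ 'n \<Rightarrow> 'b" and ?l = "kernel_fun p z x :: complex ^ 'n \<Rightarrow> 'b"
  let ?T = "hadj (rkhs m E) (rkhs p F) (mult_op \<Phi>)"
  note k = is_rkhsD(4)[OF RF w y] and l = is_rkhsD(4)[OF RF z x]
  have "ip (rkhs m E) (?T ?k) (?T ?l) = ip (rkhs p F) (mult_op \<Phi> (?T ?k)) ?l"
    by (rule ip_hadj[OF RE.hilb_axioms RF.semi_hilb_axioms T l hadj_in[OF RE.hilb_axioms RF.semi_hilb_axioms T k],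
          symmetric])
  also have "mult_op \<Phi> (?T ?k) = ?k"
    using coiso k by (simp add: coisometric_def)
  also have "ip (rkhs p F) ?k ?l = 1 / (1 - cdot z w) ^ p * ip F y x"
    by (rule is_rkhs_gram[OF RF F w y z x])
  finally show ?thesis
    unfolding hadj_mult_op[OF E F cm w y] hadj_mult_op[OF E F cm z x]
      is_rkhs_gram[OF RE E w hadj_in[OF E F.semi_hilb_axioms multiplierD(1)[OF cm w] y] z
        hadj_in[OF E F.semi_hilb_axioms multiplierD(1)[OF cm z] x]] .
qed

section \<open>From a factorization to the multiplier condition\<close>

lemma unit_ball_nonzero:
  assumes "z \<in> unit_ball" "w \<in> unit_ball"
  shows "1 - cdot z w \<noteq> 0"
  using cmod_cdot_less_1[OF assms] by auto

lemma factors_through_imp_multiplier: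
  fixes \<Phi> :: "complex ^ 'n \<Rightarrow> 'e::complex_vector \<Rightarrow> 'g::complex_vector"
    and F :: "'f::complex_vector hilbert"
  assumes E: "hilb E" and E': "hilb E'" and pm: "p > m"
    and \<Phi>: "holomorphic_op E E' \<Phi>" and fac: "factors_through m E p E' F \<Phi>"
  shows "\<Phi> \<in> contractive_multipliers 1 E (p - m + 1) E'"
proof -
  have F: "hilb F" using fac by (simp add: factors_through_def hilb_def)
  obtain \<Phi>1 \<Phi>2 where \<Phi>1: "\<Phi>1 \<in> contractive_multipliers 1 E 1 F"
    and \<Phi>2: "\<Phi>2 \<in> coisometric_multipliers m F p E'"
    and eq: "\<And>z x. z \<in> unit_ball \<Longrightarrow> x \<in> vecs E \<Longrightarrow> \<Phi> z x = \<Phi>2 z (\<Phi>1 z x)"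
    using fac unfolding factors_through_def schur_agler_def by blast
  have hol2: "holomorphic_op F E' \<Phi>2"
    using \<Phi>2 by (simp add: coisometric_multipliers_def contractive_multipliers_def)
  have "\<Phi>2 \<in> contractive_multipliers 1 F (p - m + 1) E'"
  proof (rule multiplier_criterion[OF F E' hol2])
    show "psd (unit_ball \<times> vecs E') (multiplier_defect 1 F (p - m + 1) E' \<Phi>2)"
    proof (rule psd_eq_0I)
      fix i j :: "(complex ^ 'n) \<times> 'g" assume "i \<in> unit_ball \<times> vecs E'" "j \<in> unit_ball \<times> vecs E'"
      then have ij: "fst i \<in> unit_ball" "snd i \<in> vecs E'" "fst j \<in> unit_ball" "snd j \<in> vecs E'" by auto
      let ?c = "1 - cdot (fst j) (fst i)"
      have c: "?c \<noteq> 0" by (rule unit_ball_nonzero[OF ij(3,1)])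
      \<comment> \<open>Cancelling k_m leaves the kernel of exponent p - m exactly, so for exponents
        1 and p - m + 1 the defect vanishes instead of being merely positive.\<close>
      have "?c ^ p = ?c ^ m * ?c ^ (p - m)" using pm by (simp add: power_add[symmetric])
      then have "ip F (hadj F E' (\<Phi>2 (fst i)) (snd i)) (hadj F E' (\<Phi>2 (fst j)) (snd j))
          = 1 / ?c ^ (p - m) * ip E' (snd i) (snd j)"
        using coisometric_multiplier_kernel[OF F E' \<Phi>2 ij] c by (simp add: field_simps)
      then show "multiplier_defect 1 F (p - m + 1) E' \<Phi>2 i j = 0"
        by (simp add: multiplier_defect_def)
    qed
  qed
  note \<Phi>2' = multiplierD[OF this]
  \<comment> \<open>The factorization is given on \<open>vecs E\<close>, and all values of f lie
    there.\<close>
  have "mult_op \<Phi> f = mult_op \<Phi>2 (mult_op \<Phi>1 f)" if "f \<in> vecs (rkhs 1 E)" for f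
    using eq is_rkhsD(2)[OF is_rkhs_rkhs[OF E] that] by (auto simp: mult_op_def)
  then have "mult_op \<Phi> f \<in> vecs (rkhs (p - m + 1) E') \<and>
      hnorm (rkhs (p - m + 1) E') (mult_op \<Phi> f) \<le> hnorm (rkhs 1 E) f" if "f \<in> vecs (rkhs 1 E)" for f
    using multiplierD(2,3)[OF \<Phi>1 that] \<Phi>2'(2,3)[of "mult_op \<Phi>1 f"] that by auto
  then show ?thesis
    using \<Phi> by (simp add: contractive_multipliers_def)
qed

section \<open>Construction of the factorization\<close>

lemma hadj_evaluation:
  fixes E :: "'a::complex_vector hilbert"
  assumes E: "hilb E" and w: "w \<in> unit_ball" and y: "y \<in> vecs E"
  shows "hadj (rkhs m E :: (complex ^ 'n \<Rightarrow> 'a) hilbert) E (\<lambda>f. f w) y = kernel_fun m w y"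
proof -
  note RE = is_rkhs_rkhs[where ?'n = 'n, OF E, of m]
  interpret E: hilb E by fact
  show ?thesis
    by (rule hadj_eqI[OF is_rkhsD(1)[OF RE] E.semi_hilb_axioms qdiff_bounded_ops[OF qdiff_rkhs[OF E] w] y
          is_rkhsD(4)[OF RE w y]])
      (rule is_rkhsD(5)[OF RE w y, symmetric])
qed

text \<open>Adjoints of evaluations produce the kernel of exponent p - m, whose product with k_m is
  k_p, so the defect vanishes. M M^* fixes the kernel functions; being self-adjoint, it sends every
  h to a function with the same inner products against them, that is, to h.\<close>

lemma coisometric_evaluation:
  fixes E :: "'a::complex_vector hilbert"
  assumes E: "hilb E" and pm: "p \<ge> m"
  shows "(\<lambda>z f. f z) \<in> coisometric_multipliers m (rkhs (p - m) E :: (complex ^ 'n \<Rightarrow> 'a) hilbert) p E"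
proof -
  define F where "F = (rkhs (p - m) E :: (complex ^ 'n \<Rightarrow> 'a) hilbert)"
  define ev where "ev = (\<lambda>(z :: complex ^ 'n) (f :: complex ^ 'n \<Rightarrow> 'a). f z)"
  have F: "hilb F" unfolding F_def by (rule is_rkhsD(1)[OF is_rkhs_rkhs[OF E]])
  have hol: "holomorphic_op F E ev"
    unfolding F_def ev_def by (rule qdiff_holomorphic_op[OF is_rkhsD(1)[OF is_rkhs_rkhs[OF E]] E qdiff_rkhs[OF E]])
  have adj: "hadj F E (ev w) y = kernel_fun (p - m) w y" if "w \<in> unit_ball" "y \<in> vecs E" for w y
    unfolding F_def ev_def by (rule hadj_evaluation[OF E that])
  have gram: "1 / (1 - cdot z w) ^ m * ip F (hadj F E (ev w) y) (hadj F E (ev z) x) = 1 / (1 - cdot z w) ^ p * ip E y x"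
    if "w \<in> unit_ball" "y \<in> vecs E" "z \<in> unit_ball" "x \<in> vecs E" for w z :: "complex ^ 'n" and y x
  proof -
    have "(1 - cdot z w) ^ p = (1 - cdot z w) ^ m * (1 - cdot z w) ^ (p - m)"
      using pm by (simp add: power_add[symmetric])
    then show ?thesis
      using is_rkhs_gram[OF is_rkhs_rkhs[OF E] E that, of "p - m"] adj that by (simp add: F_def)
  qed
  have cm: "ev \<in> contractive_multipliers m F p E"
  proof (rule multiplier_criterion[OF F E hol])
    show "psd (unit_ball \<times> vecs E) (multiplier_defect m F p E ev)"
      by (rule psd_eq_0I) (use gram in \<open>auto simp: multiplier_defect_def\<close>)
  qed
  note RF = is_rkhs_rkhs[where ?'n = 'n, OF F, of m] and RE = is_rkhs_rkhs[where ?'n = 'n, OF E, of p]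
  interpret E: hilb E by (rule E)
  interpret F: hilb F by (rule F)
  interpret RF: hilb "rkhs m F :: (complex ^ 'n \<Rightarrow> complex ^ 'n \<Rightarrow> 'a) hilbert" by (rule is_rkhsD(1)[OF RF])
  interpret RE: hilb "rkhs p E :: (complex ^ 'n \<Rightarrow> 'a) hilbert" by (rule is_rkhsD(1)[OF RE])
  let ?T = "mult_op ev" and ?S = "hadj (rkhs m F) (rkhs p E) (mult_op ev)"
  note T = mult_op_bounded_ops[OF F cm]
  note S_in = hadj_in[OF RF.hilb_axioms RE.semi_hilb_axioms T]
    and ip_S = ip_hadj[OF RF.hilb_axioms RE.semi_hilb_axioms T]
  have TS_in: "?T (?S h) \<in> vecs (rkhs p E)" if "h \<in> vecs (rkhs p E)" for h
    using bounded_opsD(1)[OF T S_in[OF that]] .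
  \<comment> \<open>M^* sends the kernel function at w to k_m(z, w) times the kernel function of
    exponent p - m; evaluating that function again at z multiplies the two kernels.\<close>
  have TS_kernel: "?T (?S (kernel_fun p w y)) = kernel_fun p w y"
    if w: "w \<in> unit_ball" and y: "y \<in> vecs E" for w y
  proof -
    have "(1 - cdot z w) ^ p = (1 - cdot z w) ^ m * (1 - cdot z w) ^ (p - m)" for z
      using pm by (simp add: power_add[symmetric])
    then show ?thesis
      unfolding hadj_mult_op[OF F E cm w y] adj[OF w y]
      by (simp add: fun_eq_iff mult_op_def ev_def kernel_fun_def scaleC_fun_def scaleC_scaleC)
  qed
  have "?T (?S h) = h" if h: "h \<in> vecs (rkhs p E)" for h
  proof (rule is_rkhs_eqI[OF RE RE E TS_in[OF h] h])
    fix z :: "complex ^ 'n" and x assume z: "z \<in> unit_ball" and x: "x \<in> vecs E"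
    note l = is_rkhsD(4)[OF RE z x]
    have "ip E (?T (?S h) z) x = ip (rkhs p E) (?T (?S h)) (kernel_fun p z x)"
      by (rule is_rkhsD(5)[OF RE z x TS_in[OF h], symmetric])
    also have "\<dots> = ip (rkhs m F) (?S h) (?S (kernel_fun p z x))"
      by (rule ip_S[OF l S_in[OF h]])
    also have "\<dots> = cnj (ip (rkhs m F) (?S (kernel_fun p z x)) (?S h))"
      by (rule RF.ip_cnj[OF S_in[OF l] S_in[OF h]])
    also have "\<dots> = cnj (ip (rkhs p E) (?T (?S (kernel_fun p z x))) h)"
      using ip_S[OF h S_in[OF l]] by simp
    also have "\<dots> = ip (rkhs p E) h (kernel_fun p z x)"
      unfolding TS_kernel[OF z x] by (rule RE.ip_cnj[OF l h, symmetric])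
    also have "\<dots> = ip E (h z) x"
      by (rule is_rkhsD(5)[OF RE z x h])
    finally show "ip E (?T (?S h) z) x = ip E (h z) x" .
  qed
  then show ?thesis
    using cm unfolding ev_def F_def coisometric_multipliers_def coisometric_def by simp
qed

lemma multiplier_imp_factors_through:
  fixes \<Phi> :: "complex ^ 'n \<Rightarrow> 'e::complex_vector \<Rightarrow> 'g::complex_vector"
  assumes E: "hilb E" and E': "hilb E'" and pm: "p > m"
    and \<Phi>: "\<Phi> \<in> contractive_multipliers 1 E (p - m + 1) E'"
  shows "factors_through m E p E' (rkhs (p - m) E' :: (complex ^ 'n \<Rightarrow> 'g) hilbert) \<Phi>"
proof -
  define F where "F = (rkhs (p - m) E' :: (complex ^ 'n \<Rightarrow> 'g) hilbert)"
  have RF: "is_rkhs (p - m) E' F" unfolding F_def by (rule is_rkhs_rkhs[OF E'])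
  note R1 = is_rkhs_rkhs[where ?'n = 'n, OF E, of 1] and Rq = is_rkhs_rkhs[where ?'n = 'n, OF E', of "p - m + 1"]
  interpret E: hilb E by fact
  interpret E': hilb E' by fact
  interpret F: hilb F by (rule is_rkhsD(1)[OF RF])
  interpret R1: hilb "rkhs 1 E :: (complex ^ 'n \<Rightarrow> 'e) hilbert" by (rule is_rkhsD(1)[OF R1])
  interpret Rq: hilb "rkhs (p - m + 1) E' :: (complex ^ 'n \<Rightarrow> 'g) hilbert" by (rule is_rkhsD(1)[OF Rq])
  define J :: "((complex ^ 'n) \<times> 'g) set" where "J = unit_ball \<times> vecs E'"
  have J: "fst j \<in> unit_ball" "snd j \<in> vecs E'" if "j \<in> J" for j using that by (auto simp: J_def)
  define c where "c = (\<lambda>(i :: (complex ^ 'n) \<times> 'g) (j :: (complex ^ 'n) \<times> 'g). 1 - cdot (fst j) (fst i))"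
  have c_nonzero: "c i j \<noteq> 0" if "i \<in> J" "j \<in> J" for i j
    using unit_ball_nonzero[OF J(1)[OF that(2)] J(1)[OF that(1)]] by (simp add: c_def)
  define \<beta> where "\<beta> j = hadj E E' (\<Phi> (fst j)) (snd j)" for j
  have \<beta>: "\<beta> j \<in> vecs E" if "j \<in> J" for j
    unfolding \<beta>_def by (rule hadj_in[OF E E'.semi_hilb_axioms multiplierD(1)[OF \<Phi> J(1)[OF that]] J(2)[OF that]])
  define \<alpha> where "\<alpha> j = (kernel_fun (p - m) (fst j) (snd j) :: complex ^ 'n \<Rightarrow> 'g)" for j
  have \<alpha>: "\<alpha> j \<in> vecs F" if "j \<in> J" for j
    unfolding \<alpha>_def by (rule is_rkhsD(4)[OF RF J(1)[OF that] J(2)[OF that]])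
  have \<alpha>_gram: "ip F (\<alpha> i) (\<alpha> j) = 1 / c i j ^ (p - m) * ip E' (snd i) (snd j)" if "i \<in> J" "j \<in> J" for i j
    unfolding \<alpha>_def c_def using is_rkhs_gram[OF RF E'] J[OF that(1)] J[OF that(2)] by blast
  \<comment> \<open>The kernel K of the overview, written on pairs of a point and a vector.\<close>
  define L where "L i j = 1 / c i j ^ (p - m + 1) * ip E' (snd i) (snd j) - 1 / c i j * ip E (\<beta> i) (\<beta> j)" for i j
  define k where "k j = (kernel_fun (p - m + 1) (fst j) (snd j) :: complex ^ 'n \<Rightarrow> 'g)" for j
  let ?S = "hadj (rkhs 1 E) (rkhs (p - m + 1) E') (mult_op \<Phi>)"
  \<comment> \<open>This is I - M M^* \<ge> 0 on the kernel functions of exponent p - m + 1, and it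
    is the only source of positivity in the construction.\<close>
  have "psd J (\<lambda>i j. ip (rkhs (p - m + 1) E') (k i) (k j) - ip (rkhs 1 E) (?S (k i)) (?S (k j)))"
    unfolding k_def
    by (rule psd_contraction[OF R1.hilb_axioms Rq.semi_hilb_axioms mult_op_bounded_ops[OF E \<Phi>] multiplierD(3)[OF \<Phi>]
          is_rkhsD(4)[OF Rq J]])
  then have psd: "psd J L"
  proof (rule psd_cong)
    fix i j assume ij: "i \<in> J" "j \<in> J"
    note i = J[OF ij(1)] and j = J[OF ij(2)]
    have "ip (rkhs (p - m + 1) E') (k i) (k j) = 1 / c i j ^ (p - m + 1) * ip E' (snd i) (snd j)"
      unfolding k_def c_def by (rule is_rkhs_gram[OF Rq E' i j])
    moreover have "ip (rkhs 1 E) (kernel_fun 1 (fst i) (\<beta> i) :: complex ^ 'n \<Rightarrow> 'e) (kernel_fun 1 (fst j) (\<beta> j))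
        = 1 / c i j * ip E (\<beta> i) (\<beta> j)"
      unfolding c_def using is_rkhs_gram[OF R1 E i(1) \<beta>[OF ij(1)] j(1) \<beta>[OF ij(2)]] by simp
    ultimately show "ip (rkhs (p - m + 1) E') (k i) (k j) - ip (rkhs 1 E) (?S (k i)) (?S (k j)) = L i j"
      unfolding L_def k_def hadj_mult_op[OF E E' \<Phi> i] hadj_mult_op[OF E E' \<Phi> j] \<beta>_def[symmetric] by simp
  qed
  have herm: "L j i = cnj (L i j)" if "i \<in> J" "j \<in> J" for i j
    using that E'.ip_cnj[of "snd i" "snd j"] E.ip_cnj[OF \<beta>[OF that(1)] \<beta>[OF that(2)]] J
    by (simp add: L_def c_def cnj_cdot)
  obtain G :: "(((complex ^ 'n) \<times> 'g \<Rightarrow> complex) \<Rightarrow> complex) hilbert" and \<gamma>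
    where G: "complex_hilbert G" and \<gamma>: "\<And>j. j \<in> J \<Longrightarrow> \<gamma> j \<in> vecs G"
      "\<And>i j. i \<in> J \<Longrightarrow> j \<in> J \<Longrightarrow> ip G (\<gamma> i) (\<gamma> j) = L i j"
    using kolmogorov[OF psd herm] by metis
  interpret G: hilb G by (rule hilb.intro[OF G])
  have gram: "ip F (\<alpha> i) (\<alpha> j) + cdot (fst j) (fst i) * ip G (\<gamma> i) (\<gamma> j) = ip E (\<beta> i) (\<beta> j) + ip G (\<gamma> i) (\<gamma> j)"
    if ij: "i \<in> J" "j \<in> J" for i j
  proof -
    \<comment> \<open>Multiplication by 1 - <z, w> lowers both exponents by one, and the first term
      becomes the Gram matrix of the \<alpha> j.\<close>
    have "c i j * L i j = 1 / c i j ^ (p - m) * ip E' (snd i) (snd j) - ip E (\<beta> i) (\<beta> j)"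
      using c_nonzero[OF ij] by (simp add: L_def right_diff_distrib)
    then show ?thesis
      by (simp add: \<alpha>_gram[OF ij] \<gamma>(2)[OF ij] c_def algebra_simps)
  qed
  obtain U where col: "colligation E F G U"
    and real: "\<And>e g j. e \<in> vecs E \<Longrightarrow> g \<in> vecs G \<Longrightarrow> j \<in> J \<Longrightarrow>
      ip F (colligation.opA U e + colligation.opC U g) (\<alpha> j)
        + ip G (row_op (colligation.opB U) (fst j) e + row_op (colligation.opD U) (fst j) g) (\<gamma> j)
      = ip E e (\<beta> j) + ip G g (\<gamma> j)"
    by (rule realization[OF E F.hilb_axioms G.hilb_axioms,
          where J = J and \<alpha> = \<alpha> and \<beta> = \<beta> and \<gamma> = \<gamma> and w = fst])
      (rule \<alpha> | rule \<beta> | rule \<gamma>(1) | rule gram | rule that | assumption)+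
  interpret colligation E F G U by (rule col)
  have hol: "holomorphic_op E F transfer"
    by (rule qdiff_holomorphic_op[OF E F.hilb_axioms qdiff_transfer])
  have "transfer \<in> schur_agler E F"
    unfolding schur_agler_def
  proof (rule multiplier_criterion[OF E F.hilb_axioms hol])
    have "psd (unit_ball \<times> vecs F) (\<lambda>i j. (ip F (snd i) (snd j)
        - ip E (hadj E F (transfer (fst i)) (snd i)) (hadj E F (transfer (fst j)) (snd j)))
        / (1 - cdot (fst j) (fst i)))"
      by (rule transfer_psd) auto
    then show "psd (unit_ball \<times> vecs F) (multiplier_defect 1 E 1 F transfer)"
      by (rule psd_cong) (simp add: multiplier_defect_def diff_divide_distrib)
  qed
  moreover have "\<Phi> z e = transfer z e z" if z: "z \<in> unit_ball" and e: "e \<in> vecs E" for z e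
  proof (rule E'.vec_eqI)
    have tr: "transfer z e \<in> vecs F"
      using bounded_opsD(1)[OF qdiff_bounded_ops[OF qdiff_transfer z] e] .
    show "\<Phi> z e \<in> vecs E'" using bounded_opsD(1)[OF multiplierD(1)[OF \<Phi> z] e] .
    show "transfer z e z \<in> vecs E'" using is_rkhsD(2)[OF RF tr z] .
    fix y assume y: "y \<in> vecs E'"
    have j: "(z, y) \<in> J" using z y by (simp add: J_def)
    define b where "b = row_op opB z e"
    have b: "b \<in> vecs G" unfolding b_def using bounded_opsD(1)[OF row_B e] .
    define g where "g = res z b"
    have g: "g \<in> vecs G" and g_eq: "g = b + row_op opD z g"
      unfolding g_def using res_in[OF z b] res_eq[OF z b] by auto
    \<comment> \<open>The state solves g = z B e + z D g, so the terms with \<gamma> agree on both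
      sides and only A e + C g, the transfer function, remains.\<close>
    have "ip F (opA e + opC g) (\<alpha> (z, y)) + ip G g (\<gamma> (z, y)) = ip E e (\<beta> (z, y)) + ip G g (\<gamma> (z, y))"
      using real[OF e g j] g_eq by (simp add: b_def[symmetric])
    then have "ip F (transfer z e) (\<alpha> (z, y)) = ip E e (\<beta> (z, y))"
      by (simp add: transfer_def g_def b_def)
    then show "ip E' (\<Phi> z e) y = ip E' (transfer z e z) y"
      using is_rkhsD(5)[OF RF z y tr] ip_hadj[OF E E'.semi_hilb_axioms multiplierD(1)[OF \<Phi> z] y e]
      by (simp add: \<alpha>_def \<beta>_def)
  qed
  moreover have "(\<lambda>z f. f z) \<in> coisometric_multipliers m F p E'"
    unfolding F_def by (rule coisometric_evaluation[OF E']) (use pm in simp)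
  ultimately show ?thesis
    unfolding factors_through_def F_def[symmetric] using F.complex_hilbert by blast
qed

text \<open>The ambient type in the equivalence is the one in which
  \<open>multiplier_imp_factors_through\<close> places its space; the separate implication extends
  necessity to any ambient type, in which \<open>factors_through_imp_multiplier\<close> is
  polymorphic.\<close>

theorem theorem3p13:
  fixes E :: "'e::complex_vector hilbert"
    and E' :: "'g::complex_vector hilbert"
    and m p :: nat
    and \<Phi> :: "complex ^ 'n \<Rightarrow> 'e \<Rightarrow> 'g"
  assumes "complex_hilbert E" and "complex_hilbert E'"
    and "m \<ge> 1" and "p > m"
    and "\<Phi> \<in> contractive_multipliers m E p E'"
  shows "((\<exists>F :: (complex ^ 'n \<Rightarrow> 'g) hilbert. factors_through m E p E' F \<Phi>) \<longleftrightarrow>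
            \<Phi> \<in> contractive_multipliers 1 E (p - m + 1) E') \<and>
         ((\<exists>F :: 'f::complex_vector hilbert. factors_through m E p E' F \<Phi>) \<longrightarrow>
            \<Phi> \<in> contractive_multipliers 1 E (p - m + 1) E')"
proof -
  note hilb = hilb.intro[OF assms(1)] hilb.intro[OF assms(2)]
  have "\<Phi> \<in> contractive_multipliers 1 E (p - m + 1) E'"
    if "factors_through m E p E' F \<Phi>" for F :: "(complex ^ 'n \<Rightarrow> 'g) hilbert"
    by (rule factors_through_imp_multiplier[OF hilb assms(4) multiplierD(4)[OF assms(5)] that])
  moreover have "\<Phi> \<in> contractive_multipliers 1 E (p - m + 1) E'"
    if "factors_through m E p E' F \<Phi>" for F :: "'f hilbert"
    by (rule factors_through_imp_multiplier[OF hilb assms(4) multiplierD(4)[OF assms(5)] that])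
  moreover have "factors_through m E p E' (rkhs (p - m) E' :: (complex ^ 'n \<Rightarrow> 'g) hilbert) \<Phi>"
    if "\<Phi> \<in> contractive_multipliers 1 E (p - m + 1) E'"
    by (rule multiplier_imp_factors_through[OF hilb assms(4) that])
  ultimately show ?thesis by blast
qed

end
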